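(* Let $\mathcal N$ be a single-qubit quantum channel that has a unique fixed point and satisfies $c(\mathcal N)<\frac1{48}$, and let $C_\partial>0$. Consider an $n$-qubit ($n\ge2$) noisy local circuit on a bounded-degree interaction graph $G$ with layer maps $\Phi_\ell=\mathcal N^{\otimes n}\circ\mathcal U_\ell$, where each $\mathcal U_\ell$ is a product of disjoint two-qubit gates supported on edges of $G$. Fix a bipartition $A\mid A^c$ of the vertices with boundary size $a(A)>0$, and assume that each layer contains at most $C_\partial a(A)$ gates crossing the cut. For the input $\rho_0=|0\rangle\langle0|^{\otimes n}$ and any depth $L\ge0$, let $\rho_L=\Phi_L\circ\cdots\circ\Phi_1(\rho_0)$. Then there is a constant $C$ depending only on $\mathcal N$ and $C_\partial$ such that $$S^A_{OE}(\rho_L)\le C\,\big(a(A)\log n+\log n\big).$$ Consequently, for every fixed absolute Hilbert-Schmidt error tolerance $\varepsilon>0$ there is a constant $C'$ depending only on $\mathcal N$, $C_\partial$ and $\varepsilon$ such that $$\log\overline\chi_\partial^{\mathrm{abs}}(A)\le C'\log n ,$$ so that $\overline\chi_\partial^{\mathrm{abs}}(A)$ is bounded by a polynomial in $n$, uniformly in $L$.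
   Context: $\mathcal U_\ell(\cdot)=U_\ell(\cdot)U_\ell^\dagger$. A gate crosses the cut if its support meets both $A$ and $A^c$; $a(A)$ is the number of edges of $G$ with one endpoint in $A$ and the other in $A^c$. A fixed point of $\mathcal N$ is a density matrix $\omega$ with $\mathcal N(\omega)=\omega$. Contraction coefficient: any single-qubit channel can be written $\mathcal N(\cdot)=U\mathcal N'(V^\dagger(\cdot)V)U^\dagger$ with $U,V$ single-qubit unitaries and $\mathcal N'\big(\tfrac12(\mathbb I+\vec v\cdot\vec\sigma)\big)=\tfrac12\big(\mathbb I+(D\vec v+\vec t)\cdot\vec\sigma\big)$, where $D=\mathrm{diag}(D_X,D_Y,D_Z)$ is real with entries of the same sign, $\vec t=(t_X,t_Y,t_Z)\in\mathbb R^3$, $\vec\sigma=(X,Y,Z)$ the Pauli matrices. Then $c(\mathcal N)=\frac13(t_X^2+t_Y^2+t_Z^2+D_X^2+D_Y^2+D_Z^2)$. Operator Schmidt decomposition across $A\mid A^c$: $\rho=\sum_{\alpha}\lambda_\alpha L_\alpha\otimes R_\alpha$, $\lambda_1\ge\lambda_2\ge\dots>0$, with $\{L_\alpha\}$ on $A$, $\{R_\alpha\}$ on $A^c$ Hilbert-Schmidt orthonormal. $S^A_{OE}(\rho)=-\sum_\alpha\lambda_\alpha^2\log_2\lambda_\alpha^2$. Let $\widehat\rho_\chi=\sum_{\alpha\le\chi}\lambda_\alpha L_\alpha\otimes R_\alpha$; $R_{\mathrm{abs}}$ is the least integer $\chi\ge1$ with $\|\rho-\widehat\rho_\chi\|_2^2\le\varepsilon$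 (Hilbert-Schmidt norm), and the average boundary-bond dimension of $\rho=\rho_L$ is $\overline\chi_\partial^{\mathrm{abs}}(A)=R_{\mathrm{abs}}^{1/a(A)}$. *)

theory Defs
  imports "HOL-Analysis.Analysis" "HOL-Computational_Algebra.Polynomial"
begin

section \<open>Operators over a finite index set\<close>

text \<open>
  An operator on the Hilbert space with orthonormal basis \<open>I\<close> is given by its matrix entries
  \<open>X i j\<close> with \<open>i, j \<in> I\<close>; entries outside \<open>I\<close> carry no meaning.  Qubits are labelled by
  natural numbers, and for a set \<open>W\<close> of qubits the computational basis of the space of \<open>W\<close> is
  \<open>Pow W\<close>: the set \<open>S \<subseteq> W\<close> stands for the basis vector whose qubits in \<open>S\<close> are in state
  \<open>1\<close> and whose qubits in \<open>W - S\<close> are in state \<open>0\<close>.  Restriction of a basis vector to a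
  subset \<open>A\<close> of qubits is then \<open>S \<inter> A\<close>.
\<close>

type_synonym 'i operator = "'i \<Rightarrow> 'i \<Rightarrow> complex"

definition psd_on :: "'i set \<Rightarrow> 'i operator \<Rightarrow> bool" where
  "psd_on I X \<longleftrightarrow>
     (\<forall>v :: 'i \<Rightarrow> complex.
        let q = (\<Sum>i\<in>I. \<Sum>j\<in>I. cnj (v i) * X i j * v j) in Im q = 0 \<and> 0 \<le> Re q)"

definition unitary_on :: "'i set \<Rightarrow> 'i operator \<Rightarrow> bool" where
  "unitary_on I U \<longleftrightarrow>
     (\<forall>i\<in>I. \<forall>j\<in>I. (\<Sum>k\<in>I. U i k * cnj (U j k)) = of_bool (i = j)) \<and>
     (\<forall>i\<in>I. \<forall>j\<in>I. (\<Sum>k\<in>I. cnj (U k i) * U k j) = of_bool (i = j))"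

definition conjugate_on :: "'i set \<Rightarrow> 'i operator \<Rightarrow> 'i operator \<Rightarrow> 'i operator" where
  "conjugate_on I U X = (\<lambda>i j. \<Sum>k\<in>I. \<Sum>l\<in>I. U i k * X k l * cnj (U j l))"

definition hs_inner_on :: "'i set \<Rightarrow> 'i operator \<Rightarrow> 'i operator \<Rightarrow> complex" where
  "hs_inner_on I X Y = (\<Sum>i\<in>I. \<Sum>j\<in>I. cnj (X i j) * Y i j)"

definition hs_norm_on :: "'i set \<Rightarrow> 'i operator \<Rightarrow> real" where
  "hs_norm_on I X = sqrt (\<Sum>i\<in>I. \<Sum>j\<in>I. (cmod (X i j))\<^sup>2)"

section \<open>Single-qubit channels\<close>

text \<open>Rows and columns are indexed by \<open>bool\<close>, with \<open>False\<close> for \<open>0\<close> and \<open>True\<close> for \<open>1\<close>.\<close>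

type_synonym qubit_matrix = "complex ^ bool ^ bool"

definition adj :: "qubit_matrix \<Rightarrow> qubit_matrix" where
  "adj M = (\<chi> i j. cnj (M $ j $ i))"

definition unitary :: "qubit_matrix \<Rightarrow> bool" where
  "unitary U \<longleftrightarrow> U ** adj U = mat 1 \<and> adj U ** U = mat 1"

definition density_matrix :: "qubit_matrix \<Rightarrow> bool" where
  "density_matrix M \<longleftrightarrow> psd_on UNIV (\<lambda>i j. M $ i $ j) \<and> trace M = 1"

definition complex_linear :: "(qubit_matrix \<Rightarrow> qubit_matrix) \<Rightarrow> bool" where
  "complex_linear N \<longleftrightarrow>
     (\<forall>X Y. N (X + Y) = N X + N Y) \<and>
     (\<forall>c X. N (\<chi> i j. c * X $ i $ j) = (\<chi> i j. c * N X $ i $ j))"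

text \<open>The map \<open>N \<otimes> id\<close> on a qubit together with an ancilla indexed by \<open>nat\<close>.\<close>

definition ampliation ::
  "(qubit_matrix \<Rightarrow> qubit_matrix) \<Rightarrow> (bool \<times> nat) operator \<Rightarrow> (bool \<times> nat) operator" where
  "ampliation N X = (\<lambda>(i, a) (j, b). N (\<chi> i' j'. X (i', a) (j', b)) $ i $ j)"

definition completely_positive :: "(qubit_matrix \<Rightarrow> qubit_matrix) \<Rightarrow> bool" where
  "completely_positive N \<longleftrightarrow>
     (\<forall>d X. psd_on (UNIV \<times> {..<d}) X \<longrightarrow> psd_on (UNIV \<times> {..<d}) (ampliation N X))"

definition quantum_channel :: "(qubit_matrix \<Rightarrow> qubit_matrix) \<Rightarrow> bool" where
  "quantum_channel N \<longleftrightarrow>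
     complex_linear N \<and> completely_positive N \<and> (\<forall>X. trace (N X) = trace X)"

definition fixed_point :: "(qubit_matrix \<Rightarrow> qubit_matrix) \<Rightarrow> qubit_matrix \<Rightarrow> bool" where
  "fixed_point N \<omega> \<longleftrightarrow> density_matrix \<omega> \<and> N \<omega> = \<omega>"

definition pauli_X :: qubit_matrix where
  "pauli_X = (\<chi> i j. if i = j then 0 else 1)"

definition pauli_Y :: qubit_matrix where
  "pauli_Y = (\<chi> i j. if i = j then 0 else if i then \<i> else - \<i>)"

definition pauli_Z :: qubit_matrix where
  "pauli_Z = (\<chi> i j. if i \<noteq> j then 0 else if i then - 1 else 1)"

definition bloch :: "real \<Rightarrow> real \<Rightarrow> real \<Rightarrow> qubit_matrix" where
  "bloch x y z =
     (1/2) *\<^sub>R (mat 1 + x *\<^sub>R pauli_X + y *\<^sub>R pauli_Y + z *\<^sub>R pauli_Z)"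

text \<open>
  The coefficient is read off from a normal form of the channel.  Every single-qubit channel has
  one, and the value is the same for all of them, because local unitaries rotate the translation
  vector and multiply the linear part of the Bloch map by rotations on both sides.
\<close>

definition has_contraction_coeff :: "(qubit_matrix \<Rightarrow> qubit_matrix) \<Rightarrow> real \<Rightarrow> bool" where
  "has_contraction_coeff N c \<longleftrightarrow>
     (\<exists>U V N' DX DY DZ tX tY tZ.
        unitary U \<and> unitary V \<and>
        (\<forall>\<rho>. N \<rho> = U ** N' (adj V ** \<rho> ** V) ** adj U) \<and>
        (\<forall>x y z. N' (bloch x y z) = bloch (DX * x + tX) (DY * y + tY) (DZ * z + tZ)) \<and>
        ((0 \<le> DX \<and> 0 \<le> DY \<and> 0 \<le> DZ) \<or> (DX \<le> 0 \<and> DY \<le> 0 \<and> DZ \<le> 0)) \<and>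
        c = (tX\<^sup>2 + tY\<^sup>2 + tZ\<^sup>2 + DX\<^sup>2 + DY\<^sup>2 + DZ\<^sup>2) / 3)"

section \<open>Noisy local circuits\<close>

definition matrix_unit :: "bool \<Rightarrow> bool \<Rightarrow> qubit_matrix" where
  "matrix_unit a b = (\<chi> i j. of_bool (i = a \<and> j = b))"

text \<open>
  The \<open>n\<close>-fold tensor power of \<open>N\<close> on the qubits \<open>{..<n}\<close>: it maps the product matrix unit
  \<open>|S'><T'|\<close> to the product over \<open>k < n\<close> of the images of its single-qubit factors.
\<close>

definition noise ::
  "(qubit_matrix \<Rightarrow> qubit_matrix) \<Rightarrow> nat \<Rightarrow> nat set operator \<Rightarrow> nat set operator" where
  "noise N n X = (\<lambda>S T. \<Sum>S'\<in>Pow {..<n}. \<Sum>T'\<in>Pow {..<n}.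
     X S' T' * (\<Prod>k<n. N (matrix_unit (k \<in> S') (k \<in> T')) $ (k \<in> S) $ (k \<in> T)))"

text \<open>
  A layer is a set \<open>M\<close> of edges together with a gate for every edge \<open>e \<in> M\<close>, which is an
  operator on the two qubits of \<open>e\<close>, hence indexed by \<open>Pow e\<close>.
\<close>

type_synonym layer = "nat set set \<times> (nat set \<Rightarrow> nat set operator)"

definition interaction_graph :: "nat \<Rightarrow> nat \<Rightarrow> nat set set \<Rightarrow> bool" where
  "interaction_graph n \<Delta> E \<longleftrightarrow>
     (\<forall>e\<in>E. e \<subseteq> {..<n} \<and> card e = 2) \<and> (\<forall>v<n. card {e\<in>E. v \<in> e} \<le> \<Delta>)"

definition local_layer :: "nat set set \<Rightarrow> layer \<Rightarrow> bool" where
  "local_layer E ly \<longleftrightarrow> (case ly of (M, g) \<Rightarrow>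
     M \<subseteq> E \<and> pairwise disjnt M \<and> (\<forall>e\<in>M. unitary_on (Pow e) (g e)))"

text \<open>The product of the gates of a layer, acting as the identity on the qubits outside \<open>\<Union>M\<close>.\<close>

definition layer_unitary :: "layer \<Rightarrow> nat set operator" where
  "layer_unitary ly = (case ly of (M, g) \<Rightarrow>
     (\<lambda>S T. if S - \<Union>M = T - \<Union>M then \<Prod>e\<in>M. g e (S \<inter> e) (T \<inter> e) else 0))"

definition noisy_layer ::
  "(qubit_matrix \<Rightarrow> qubit_matrix) \<Rightarrow> nat \<Rightarrow> layer \<Rightarrow> nat set operator \<Rightarrow> nat set operator" where
  "noisy_layer N n ly \<rho> = noise N n (conjugate_on (Pow {..<n}) (layer_unitary ly) \<rho>)"

definition initial_state :: "nat set operator" where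
  "initial_state = (\<lambda>S T. of_bool (S = {} \<and> T = {}))"

text \<open>The head of the list is the layer applied first; the depth is the length of the list.\<close>

definition output_state ::
  "(qubit_matrix \<Rightarrow> qubit_matrix) \<Rightarrow> nat \<Rightarrow> layer list \<Rightarrow> nat set operator" where
  "output_state N n lys = fold (noisy_layer N n) lys initial_state"

definition crosses :: "nat set \<Rightarrow> nat set \<Rightarrow> bool" where
  "crosses A e \<longleftrightarrow> e \<inter> A \<noteq> {} \<and> e - A \<noteq> {}"

definition boundary_size :: "nat set set \<Rightarrow> nat set \<Rightarrow> nat" where
  "boundary_size E A = card {e\<in>E. crosses A e}"

definition circuit_setting ::
  "real \<Rightarrow> nat \<Rightarrow> nat \<Rightarrow> nat set set \<Rightarrow> nat set \<Rightarrow> layer list \<Rightarrow> bool" where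
  "circuit_setting Cb n \<Delta> E A lys \<longleftrightarrow>
     2 \<le> n \<and> interaction_graph n \<Delta> E \<and> A \<subseteq> {..<n} \<and> 0 < boundary_size E A \<and>
     (\<forall>ly\<in>set lys. local_layer E ly \<and>
        real (card {e\<in>fst ly. crosses A e}) \<le> Cb * real (boundary_size E A))"

section \<open>Operator entanglement and bond dimension\<close>

text \<open>
  The number of terms, the coefficients and the two families of operators in a decomposition of an
  operator on the qubits \<open>V\<close>; terms are numbered from \<open>0\<close>.
\<close>

type_synonym schmidt_data =
  "nat \<times> (nat \<Rightarrow> real) \<times> (nat \<Rightarrow> nat set operator) \<times> (nat \<Rightarrow> nat set operator)"

definition orthonormal_on :: "'i set \<Rightarrow> nat \<Rightarrow> (nat \<Rightarrow> 'i operator) \<Rightarrow> bool" where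
  "orthonormal_on I r F \<longleftrightarrow>
     (\<forall>\<alpha><r. \<forall>\<beta><r. hs_inner_on I (F \<alpha>) (F \<beta>) = of_bool (\<alpha> = \<beta>))"

definition is_operator_schmidt ::
  "nat set \<Rightarrow> nat set \<Rightarrow> nat set operator \<Rightarrow> schmidt_data \<Rightarrow> bool" where
  "is_operator_schmidt V A \<rho> D \<longleftrightarrow> (case D of (r, lam, L, R) \<Rightarrow>
     (\<forall>\<alpha><r. 0 < lam \<alpha>) \<and>
     (\<forall>\<alpha> \<beta>. \<alpha> \<le> \<beta> \<and> \<beta> < r \<longrightarrow> lam \<beta> \<le> lam \<alpha>) \<and>
     orthonormal_on (Pow A) r L \<and> orthonormal_on (Pow (V - A)) r R \<and>
     (\<forall>S\<in>Pow V. \<forall>T\<in>Pow V.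
        \<rho> S T = (\<Sum>\<alpha><r. of_real (lam \<alpha>) * L \<alpha> (S \<inter> A) (T \<inter> A) * R \<alpha> (S - A) (T - A))))"

text \<open>
  A decomposition always exists (singular value decomposition).  The number of terms and the
  coefficients do not depend on the choice, so neither do the quantities defined from it below.
\<close>

definition operator_schmidt :: "nat set \<Rightarrow> nat set \<Rightarrow> nat set operator \<Rightarrow> schmidt_data" where
  "operator_schmidt V A \<rho> = (SOME D. is_operator_schmidt V A \<rho> D)"

definition operator_entanglement :: "nat set \<Rightarrow> nat set \<Rightarrow> nat set operator \<Rightarrow> real" where
  "operator_entanglement V A \<rho> = (case operator_schmidt V A \<rho> of (r, lam, L, R) \<Rightarrow>
     - (\<Sum>\<alpha><r. (lam \<alpha>)\<^sup>2 * log 2 ((lam \<alpha>)\<^sup>2)))"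

definition schmidt_truncation ::
  "nat set \<Rightarrow> nat set \<Rightarrow> nat set operator \<Rightarrow> nat \<Rightarrow> nat set operator" where
  "schmidt_truncation V A \<rho> m = (case operator_schmidt V A \<rho> of (r, lam, L, R) \<Rightarrow>
     (\<lambda>S T. \<Sum>\<alpha><min m r.
        of_real (lam \<alpha>) * L \<alpha> (S \<inter> A) (T \<inter> A) * R \<alpha> (S - A) (T - A)))"

definition R_abs :: "real \<Rightarrow> nat set \<Rightarrow> nat set \<Rightarrow> nat set operator \<Rightarrow> nat" where
  "R_abs \<epsilon> V A \<rho> = (LEAST m. 1 \<le> m \<and>
     (hs_norm_on (Pow V) (\<lambda>S T. \<rho> S T - schmidt_truncation V A \<rho> m S T))\<^sup>2 \<le> \<epsilon>)"

definition avg_bond_dim ::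
  "real \<Rightarrow> nat set \<Rightarrow> nat set set \<Rightarrow> nat set \<Rightarrow> nat set operator \<Rightarrow> real" where
  "avg_bond_dim \<epsilon> V E A \<rho> = real (R_abs \<epsilon> V A \<rho>) powr (1 / real (boundary_size E A))"

end

(*
Let Dep be the single-qubit map M |-> tr(M) I / 2. In the normal form of the channel,
N - N o Dep is a combination of four unitary conjugations whose weights have absolute sum at
most s = |D_X| + |D_Y| + |D_Z|, and c(N) < 1/48 gives s < 1/2. Consider an operator X with
vanishing partial trace over one qubit. A gate layer moves this property from the qubit to the
at most two qubits of a gate, and writing id = (id - Dep) + Dep on these qubits shows that after
the noise the operator is a sum of operators of the same kind with total trace norm multiplied
by at most 2s < 1. Hence two runs of the same l layers from different initial states end at
Hilbert-Schmidt distance at most n (2s)^l: the output is determined up to that error by its last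
l layers. Applied to the product initial state, these create operator Schmidt rank at most 16^l'
where l' counts their crossing gates. With l of order log n, Eckart-Young turns this into a tail
bound for the Schmidt coefficients, and both claims follow.
*)

theory Submission
  imports Defs
begin

section \<open>Singular value decomposition on finite index sets\<close>

text \<open>The Hilbert-Schmidt norm cannot carry the argument by itself: a non-unital channel may
  increase it. The trace norm can, because positive trace-preserving maps contract it and a signed
  mixture of unitary conjugations scales it by at most the sum of the absolute weights. What has to
  be beaten is the possible doubling of the affected qubits in each layer, hence
  \<open>2 * s < 1\<close>. A difference of two states has vanishing trace over all qubits together,
  not over a single one. The first layer is therefore treated as one block of n qubits, which is the
  source of the factor n in the error. For the entropy a small constant error would not do: the tail
  may contain exponentially many Schmidt coefficients, so tail mass \<delta> can contribute about 2
  n \<delta>. A depth of order log n brings the squared error down to 1/n^2, which keeps this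
  contribution bounded while the logarithm of the rank stays of order a(A) log n. The defined
  quantities are read off from a chosen Schmidt decomposition, so existence of one has to be
  established too.\<close>

definition ip :: "'a set \<Rightarrow> ('a \<Rightarrow> complex) \<Rightarrow> ('a \<Rightarrow> complex) \<Rightarrow> complex" where
  "ip I x y = (\<Sum>i\<in>I. cnj (x i) * y i)"

definition nsq :: "'a set \<Rightarrow> ('a \<Rightarrow> complex) \<Rightarrow> real" where
  "nsq I x = (\<Sum>i\<in>I. (cmod (x i))\<^sup>2)"

definition orthonormal_family :: "'a set \<Rightarrow> nat \<Rightarrow> (nat \<Rightarrow> 'a \<Rightarrow> complex) \<Rightarrow> bool" where
  "orthonormal_family I r e \<longleftrightarrow> (\<forall>\<alpha><r. \<forall>\<beta><r. ip I (e \<alpha>) (e \<beta>) = of_bool (\<alpha> = \<beta>))"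

lemma nsq_nonneg [simp]: "0 \<le> nsq I x"
  by (simp add: nsq_def sum_nonneg)

lemma ip_self: "ip I x x = of_real (nsq I x)"
  by (simp only: ip_def nsq_def of_real_sum complex_norm_square) (simp add: mult.commute)

lemma cnj_ip: "cnj (ip I x y) = ip I y x"
  by (simp add: ip_def mult.commute)

lemma ip_diff_right: "ip I x (\<lambda>i. y i - z i) = ip I x y - ip I x z"
  by (simp add: ip_def right_diff_distrib sum_subtractf)

lemma ip_diff_left: "ip I (\<lambda>i. y i - z i) x = ip I y x - ip I z x"
  by (simp add: ip_def left_diff_distrib sum_subtractf)

lemma ip_scale_right: "ip I x (\<lambda>i. a * y i) = a * ip I x y"
  by (simp add: ip_def sum_distrib_left mult_ac)

lemma ip_scale_left: "ip I (\<lambda>i. a * y i) x = cnj a * ip I y x"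
  by (simp add: ip_def sum_distrib_left mult_ac)

lemma ip_sum_right: "ip I x (\<lambda>i. \<Sum>\<alpha>\<in>J. y \<alpha> i) = (\<Sum>\<alpha>\<in>J. ip I x (y \<alpha>))"
  unfolding ip_def sum_distrib_left by (rule sum.swap)

lemma ip_sum_left: "ip I (\<lambda>i. \<Sum>\<alpha>\<in>J. y \<alpha> i) x = (\<Sum>\<alpha>\<in>J. ip I (y \<alpha>) x)"
  unfolding ip_def cnj_sum sum_distrib_right by (rule sum.swap)

lemma ip_cong: "(\<And>i. i \<in> I \<Longrightarrow> x i = x' i) \<Longrightarrow> (\<And>i. i \<in> I \<Longrightarrow> y i = y' i) \<Longrightarrow> ip I x y = ip I x' y'"
  by (simp add: ip_def)

lemma nsq_scale: "nsq I (\<lambda>i. a * x i) = (cmod a)\<^sup>2 * nsq I x"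
  by (simp add: nsq_def sum_distrib_left norm_mult power_mult_distrib)

lemma nsq_eq_0: "finite I \<Longrightarrow> nsq I x = 0 \<longleftrightarrow> (\<forall>i\<in>I. x i = 0)"
  by (simp add: nsq_def sum_nonneg_eq_0_iff)

text \<open>Completing the square. Taking the projections for \<open>c\<close> gives Bessel,
  dropping the last sum gives best approximation, and \<open>x = 0\<close> gives Parseval.\<close>

lemma nsq_diff_combination:
  assumes "orthonormal_family I r e"
  shows "nsq I (\<lambda>i. x i - (\<Sum>\<alpha><r. c \<alpha> * e \<alpha> i)) =
    nsq I x - (\<Sum>\<alpha><r. (cmod (ip I (e \<alpha>) x))\<^sup>2) + (\<Sum>\<alpha><r. (cmod (c \<alpha> - ip I (e \<alpha>) x))\<^sup>2)"
proof -
  let ?y = "\<lambda>i. \<Sum>\<alpha><r. c \<alpha> * e \<alpha> i" and ?p = "\<lambda>\<alpha>. ip I (e \<alpha>) x"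
  have e: "ip I (e \<alpha>) (e \<beta>) = of_bool (\<alpha> = \<beta>)" if "\<alpha> < r" "\<beta> < r" for \<alpha> \<beta>
    using assms that by (simp add: orthonormal_family_def)
  have xy: "ip I x ?y = (\<Sum>\<alpha><r. c \<alpha> * cnj (?p \<alpha>))"
    by (simp add: ip_sum_right ip_scale_right cnj_ip)
  have yx: "ip I ?y x = (\<Sum>\<alpha><r. cnj (c \<alpha>) * ?p \<alpha>)"
    by (simp add: ip_sum_left ip_scale_left)
  have "ip I ?y ?y = (\<Sum>\<alpha><r. cnj (c \<alpha>) * (\<Sum>\<beta><r. c \<beta> * ip I (e \<alpha>) (e \<beta>)))"
    by (simp add: ip_sum_left ip_scale_left ip_sum_right ip_scale_right)
  also have "\<dots> = (\<Sum>\<alpha><r. cnj (c \<alpha>) * c \<alpha>)"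
  proof (rule sum.cong[OF refl])
    fix \<alpha> assume "\<alpha> \<in> {..<r}"
    then have "(\<Sum>\<beta><r. c \<beta> * ip I (e \<alpha>) (e \<beta>)) = (\<Sum>\<beta><r. if \<beta> = \<alpha> then c \<beta> else 0)"
      by (intro sum.cong) (auto simp: e)
    then show "cnj (c \<alpha>) * (\<Sum>\<beta><r. c \<beta> * ip I (e \<alpha>) (e \<beta>)) = cnj (c \<alpha>) * c \<alpha>"
      using \<open>\<alpha> \<in> {..<r}\<close> by simp
  qed
  finally have yy: "ip I ?y ?y = (\<Sum>\<alpha><r. cnj (c \<alpha>) * c \<alpha>)" .
  have "of_real (nsq I (\<lambda>i. x i - ?y i)) = ip I x x - ip I x ?y - (ip I ?y x - ip I ?y ?y)"
    by (simp only: ip_self[symmetric] ip_diff_left ip_diff_right algebra_simps)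
  also have "\<dots> = ip I x x - (\<Sum>\<alpha><r. ?p \<alpha> * cnj (?p \<alpha>)) +
      (\<Sum>\<alpha><r. (c \<alpha> - ?p \<alpha>) * cnj (c \<alpha> - ?p \<alpha>))"
    by (simp add: xy yx yy sum.distrib sum_subtractf algebra_simps)
  also have "\<dots> = of_real (nsq I x - (\<Sum>\<alpha><r. (cmod (?p \<alpha>))\<^sup>2) + (\<Sum>\<alpha><r. (cmod (c \<alpha> - ?p \<alpha>))\<^sup>2))"
    by (simp only: ip_self of_real_add of_real_diff of_real_sum complex_norm_square)
  finally show ?thesis by (simp only: of_real_eq_iff)
qed

lemma bessel:
  assumes "orthonormal_family I r e"
  shows "(\<Sum>\<alpha><r. (cmod (ip I (e \<alpha>) x))\<^sup>2) \<le> nsq I x"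
  using nsq_diff_combination[OF assms, of x "\<lambda>\<alpha>. ip I (e \<alpha>) x"]
    nsq_nonneg[of I "\<lambda>i. x i - (\<Sum>\<alpha><r. ip I (e \<alpha>) x * e \<alpha> i)"]
  by simp

lemma nsq_diff_combination_ge:
  assumes "orthonormal_family I r e"
  shows "nsq I x - (\<Sum>\<alpha><r. (cmod (ip I (e \<alpha>) x))\<^sup>2) \<le> nsq I (\<lambda>i. x i - (\<Sum>\<alpha><r. c \<alpha> * e \<alpha> i))"
  by (simp add: nsq_diff_combination[OF assms] sum_nonneg)

lemma nsq_combination:
  assumes "orthonormal_family I r e"
  shows "nsq I (\<lambda>i. \<Sum>\<alpha><r. c \<alpha> * e \<alpha> i) = (\<Sum>\<alpha><r. (cmod (c \<alpha>))\<^sup>2)"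
  using nsq_diff_combination[OF assms, of "\<lambda>_. 0" c]
  by (simp add: nsq_def ip_def)

text \<open>Double counting: the squared norms add up to \<open>r\<close>, while each coordinate
  contributes at most 1 by Bessel against the corresponding unit vector. This bound makes the greedy
  construction below stop.\<close>

lemma orthonormal_family_card:
  assumes "finite I" "orthonormal_family I r e"
  shows "r \<le> card I"
proof -
  have "real r = (\<Sum>\<alpha><r. nsq I (e \<alpha>))"
  proof -
    have "nsq I (e \<alpha>) = 1" if "\<alpha> < r" for \<alpha>
      using assms(2) that ip_self[of I "e \<alpha>"] by (simp add: orthonormal_family_def)
    then show ?thesis by simp
  qed
  also have "\<dots> = (\<Sum>i\<in>I. \<Sum>\<alpha><r. (cmod (e \<alpha> i))\<^sup>2)"
    unfolding nsq_def by (rule sum.swap)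
  also have "\<dots> \<le> (\<Sum>i\<in>I. 1)"
  proof (rule sum_mono)
    fix i assume i: "i \<in> I"
    have "ip I (e \<alpha>) (\<lambda>j. of_bool (j = i)) = cnj (e \<alpha> i)" for \<alpha>
      using i assms(1) by (simp add: ip_def of_bool_def if_distrib[of "\<lambda>x. _ * x"] cong: if_cong)
    moreover have "nsq I (\<lambda>j. of_bool (j = i)) = 1"
    proof -
      have "nsq I (\<lambda>j. of_bool (j = i)) = (\<Sum>j\<in>I. if j = i then 1 else 0)"
        unfolding nsq_def by (intro sum.cong) auto
      then show ?thesis using i assms(1) by simp
    qed
    ultimately show "(\<Sum>\<alpha><r. (cmod (e \<alpha> i))\<^sup>2) \<le> 1"
      using bessel[OF assms(2), of "\<lambda>j. of_bool (j = i)"] by simp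
  qed
  finally show ?thesis by simp
qed

lemma orthonormal_family_extend:
  assumes "orthonormal_family I r e" "nsq I x = 1" "\<And>\<alpha>. \<alpha> < r \<Longrightarrow> ip I (e \<alpha>) x = 0"
  shows "orthonormal_family I (Suc r) (e(r := x))"
proof -
  have "ip I x (e \<alpha>) = 0" if "\<alpha> < r" for \<alpha>
    using assms(3)[OF that] cnj_ip[of I "e \<alpha>" x] by simp
  then show ?thesis
    using assms by (auto simp: orthonormal_family_def less_Suc_eq ip_self)
qed

lemma gram_schmidt:
  assumes "finite I"
  shows "\<exists>r e. r \<le> m \<and> orthonormal_family I r e \<and>
     (\<forall>\<beta><m. \<exists>c. \<forall>i\<in>I. f \<beta> i = (\<Sum>\<alpha><r. c \<alpha> * e \<alpha> i))"
proof (induction m)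
  case 0
  show ?case by (auto simp: orthonormal_family_def)
next
  case (Suc m)
  then obtain r e where r: "r \<le> m" and e: "orthonormal_family I r e"
    and span: "\<And>\<beta>. \<beta> < m \<Longrightarrow> \<exists>c. \<forall>i\<in>I. f \<beta> i = (\<Sum>\<alpha><r. c \<alpha> * e \<alpha> i)" by blast
  let ?c = "\<lambda>\<alpha>. ip I (e \<alpha>) (f m)"
  define x where "x = (\<lambda>i. f m i - (\<Sum>\<alpha><r. ?c \<alpha> * e \<alpha> i))"
  show ?case
  proof (cases "nsq I x = 0")
    case True
    then have "\<forall>i\<in>I. f m i = (\<Sum>\<alpha><r. ?c \<alpha> * e \<alpha> i)"
      using assms by (simp add: nsq_eq_0 x_def)
    then have "\<exists>c. \<forall>i\<in>I. f m i = (\<Sum>\<alpha><r. c \<alpha> * e \<alpha> i)" by (intro exI[of _ ?c])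
    then show ?thesis using r e span by (auto simp: less_Suc_eq intro!: exI[of _ r] exI[of _ e])
  next
    case False
    define t where "t = sqrt (nsq I x)"
    have t: "t > 0" "t\<^sup>2 = nsq I x" using False by (simp_all add: t_def less_le)
    define y where "y = (\<lambda>i. of_real (1 / t) * x i)"
    have "nsq I y = 1"
      unfolding y_def nsq_scale using t(1) by (simp add: norm_divide power_divide flip: t(2))
    moreover have "ip I (e \<alpha>) y = 0" if "\<alpha> < r" for \<alpha>
    proof -
      have "(\<Sum>\<beta><r. ?c \<beta> * ip I (e \<alpha>) (e \<beta>)) = (\<Sum>\<beta><r. if \<beta> = \<alpha> then ?c \<beta> else 0)"
        using e that by (intro sum.cong) (auto simp: orthonormal_family_def)
      then have "ip I (e \<alpha>) x = 0"
        unfolding x_def ip_diff_right ip_sum_right ip_scale_right using that by simp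
      then show ?thesis by (simp only: y_def ip_scale_right)simp
    qed
    ultimately have on: "orthonormal_family I (Suc r) (e(r := y))"
      by (rule orthonormal_family_extend[OF e])
    have "\<exists>c. \<forall>i\<in>I. f \<beta> i = (\<Sum>\<alpha><Suc r. c \<alpha> * (e(r := y)) \<alpha> i)" if "\<beta> < Suc m" for \<beta>
    proof (cases "\<beta> = m")
      case True
      \<comment> \<open>\<open>f m\<close> is its projection plus \<open>t * y\<close>, so the new
        coefficient is the length \<open>t\<close> of the remainder.\<close>
      have "f m i = (\<Sum>\<alpha><Suc r. (?c(r := of_real t)) \<alpha> * (e(r := y)) \<alpha> i)" for i
      proof -
        have "(\<Sum>\<alpha><r. (?c(r := of_real t)) \<alpha> * (e(r := y)) \<alpha> i) = (\<Sum>\<alpha><r. ?c \<alpha> * e \<alpha> i)"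
          by (intro sum.cong) auto
        then show ?thesis using t(1) by (simp add: y_def x_def)
      qed
      then show ?thesis using True by blast
    next
      case False
      with that span obtain c where c: "\<forall>i\<in>I. f \<beta> i = (\<Sum>\<alpha><r. c \<alpha> * e \<alpha> i)"
        by (auto simp: less_Suc_eq)
      have "(\<Sum>\<alpha><Suc r. (c(r := 0)) \<alpha> * (e(r := y)) \<alpha> i) = (\<Sum>\<alpha><r. c \<alpha> * e \<alpha> i)" for i
      proof -
        have "(\<Sum>\<alpha><r. (c(r := 0)) \<alpha> * (e(r := y)) \<alpha> i) = (\<Sum>\<alpha><r. c \<alpha> * e \<alpha> i)"
          by (intro sum.cong) auto
        then show ?thesis by simp
      qed
      then have "\<forall>i\<in>I. f \<beta> i = (\<Sum>\<alpha><Suc r. (c(r := 0)) \<alpha> * (e(r := y)) \<alpha> i)" using c by simp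
      then show ?thesis by (intro exI[of _ "c(r := 0)"])
    qed
    then show ?thesis using on r by blast
  qed
qed

text \<open>Ky Fan's argument: weights in the unit interval of total mass \<open>m\<close> are best spent on the \<open>m\<close>
  largest values.\<close>

lemma weighted_sum_le_head:
  fixes p q :: "nat \<Rightarrow> real"
  assumes "\<And>\<alpha> \<beta>. \<alpha> \<le> \<beta> \<Longrightarrow> \<beta> < r \<Longrightarrow> p \<beta> \<le> p \<alpha>" "\<And>\<alpha>. \<alpha> < r \<Longrightarrow> 0 \<le> p \<alpha>"
    and "\<And>\<alpha>. \<alpha> < r \<Longrightarrow> 0 \<le> q \<alpha>" "\<And>\<alpha>. \<alpha> < r \<Longrightarrow> q \<alpha> \<le> 1" "(\<Sum>\<alpha><r. q \<alpha>) \<le> real m"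
  shows "(\<Sum>\<alpha><r. p \<alpha> * q \<alpha>) \<le> (\<Sum>\<alpha><min m r. p \<alpha>)"
proof (cases "m < r")
  case False
  then have "(\<Sum>\<alpha><r. p \<alpha> * q \<alpha>) \<le> (\<Sum>\<alpha><r. p \<alpha>)"
    using assms by (intro sum_mono) (auto intro: mult_left_le)
  then show ?thesis using False by (simp add: min_def)
next
  case True
  have split: "(\<Sum>\<alpha><r. h \<alpha>) = (\<Sum>\<alpha><m. h \<alpha>) + (\<Sum>\<alpha>\<in>{m..<r}. h \<alpha>)" for h :: "nat \<Rightarrow> real"
    using sum.atLeastLessThan_concat[of 0 m r h] True by (simp add: atLeast0LessThan)
  \<comment> \<open>\<open>p m\<close> is the threshold: head values are at least \<open>p m\<close>
    and tail values at most \<open>p m\<close>, so moving weight from the tail into the free room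
    \<open>1 - q \<alpha>\<close> of the head loses nothing.\<close>
  have "(\<Sum>\<alpha><m. p \<alpha> * (1 - q \<alpha>)) \<ge> (\<Sum>\<alpha><m. p m * (1 - q \<alpha>))"
    using True assms by (intro sum_mono mult_right_mono) auto
  moreover have "(\<Sum>\<alpha>\<in>{m..<r}. p \<alpha> * q \<alpha>) \<le> (\<Sum>\<alpha>\<in>{m..<r}. p m * q \<alpha>)"
    using True assms by (intro sum_mono mult_right_mono) auto
  moreover have "p m * (\<Sum>\<alpha>\<in>{m..<r}. q \<alpha>) \<le> p m * (real m - (\<Sum>\<alpha><m. q \<alpha>))"
    using assms(5) split[of q] True assms(2)[of m] by (intro mult_left_mono) auto
  ultimately show ?thesis
    using True split[of "\<lambda>\<alpha>. p \<alpha> * q \<alpha>"]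
    by (simp add: right_diff_distrib sum_subtractf sum_distrib_left mult.commute min_def)
qed

section \<open>Eckart-Young bound for tails of singular values\<close>

lemma nsq_bilinear_combination:
  assumes u: "orthonormal_family I r u" and v: "orthonormal_family J r v"
  shows "(\<Sum>j\<in>J. nsq I (\<lambda>i. \<Sum>\<alpha><r. c \<alpha> * u \<alpha> i * v \<alpha> j)) = (\<Sum>\<alpha><r. (cmod (c \<alpha>))\<^sup>2)"
proof -
  have "nsq I (\<lambda>i. \<Sum>\<alpha><r. c \<alpha> * u \<alpha> i * v \<alpha> j) = (\<Sum>\<alpha><r. (cmod (c \<alpha> * v \<alpha> j))\<^sup>2)" for j
    using nsq_combination[OF u, of "\<lambda>\<alpha>. c \<alpha> * v \<alpha> j"] by (simp only: mult_ac)
  then have "(\<Sum>j\<in>J. nsq I (\<lambda>i. \<Sum>\<alpha><r. c \<alpha> * u \<alpha> i * v \<alpha> j)) =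
      (\<Sum>j\<in>J. \<Sum>\<alpha><r. (cmod (c \<alpha> * v \<alpha> j))\<^sup>2)"
    by simp
  also have "\<dots> = (\<Sum>\<alpha><r. (cmod (c \<alpha>))\<^sup>2 * nsq J (v \<alpha>))"
    by (subst sum.swap) (simp add: nsq_def norm_mult power_mult_distrib sum_distrib_left)
  also have "\<dots> = (\<Sum>\<alpha><r. (cmod (c \<alpha>))\<^sup>2)"
  proof (rule sum.cong[OF refl])
    fix \<alpha> assume "\<alpha> \<in> {..<r}"
    then have "nsq J (v \<alpha>) = 1" using v ip_self[of J "v \<alpha>"] by (simp add: orthonormal_family_def)
    then show "(cmod (c \<alpha>))\<^sup>2 * nsq J (v \<alpha>) = (cmod (c \<alpha>))\<^sup>2" by simp
  qed
  finally show ?thesis .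
qed

text \<open>The columns of \<open>K\<close> lie in the span of at most \<open>m\<close> orthonormal
  vectors \<open>e\<close>, so \<open>K\<close> is no closer to \<open>M\<close> than the columnwise
  projection of \<open>M\<close> onto that span. The projection keeps mass
  \<open>(lam \<alpha>)\<^sup>2 * q \<alpha>\<close>, where \<open>q \<alpha>\<close> is the squared
  length of the projected \<open>u \<alpha>\<close>. These weights lie between 0 and 1 and sum to at
  most \<open>m\<close>, so Ky Fan's argument bounds the mass kept.\<close>

lemma singular_tail_le:
  fixes M :: "'a \<Rightarrow> 'b \<Rightarrow> complex"
  assumes "finite I" "finite J"
    and M: "\<And>i j. i \<in> I \<Longrightarrow> j \<in> J \<Longrightarrow> M i j = (\<Sum>\<alpha><r. of_real (lam \<alpha>) * u \<alpha> i * v \<alpha> j)"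
    and u: "orthonormal_family I r u" and v: "orthonormal_family J r v"
    and pos: "\<And>\<alpha>. \<alpha> < r \<Longrightarrow> 0 < lam \<alpha>"
    and dec: "\<And>\<alpha> \<beta>. \<alpha> \<le> \<beta> \<Longrightarrow> \<beta> < r \<Longrightarrow> lam \<beta> \<le> lam \<alpha>"
    and K: "\<And>i j. i \<in> I \<Longrightarrow> j \<in> J \<Longrightarrow> K i j = (\<Sum>\<beta><m. f \<beta> i * g \<beta> j)"
  shows "(\<Sum>\<alpha>\<in>{m..<r}. (lam \<alpha>)\<^sup>2) \<le> (\<Sum>i\<in>I. \<Sum>j\<in>J. (cmod (M i j - K i j))\<^sup>2)"
proof -
  obtain s e where s: "s \<le> m" and e: "orthonormal_family I s e"
    and span: "\<forall>\<beta><m. \<exists>c. \<forall>i\<in>I. f \<beta> i = (\<Sum>\<alpha><s. c \<alpha> * e \<alpha> i)"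
    using gram_schmidt[OF assms(1), of m f] by blast
  from span obtain c where c: "\<And>\<beta> i. \<beta> < m \<Longrightarrow> i \<in> I \<Longrightarrow> f \<beta> i = (\<Sum>\<alpha><s. c \<beta> \<alpha> * e \<alpha> i)"
    by metis
  define q where "q \<alpha> = (\<Sum>\<gamma><s. (cmod (ip I (e \<gamma>) (u \<alpha>)))\<^sup>2)" for \<alpha>
  have u1: "nsq I (u \<alpha>) = 1" if "\<alpha> < r" for \<alpha>
    using u that ip_self[of I "u \<alpha>"] by (simp add: orthonormal_family_def)
  have e1: "nsq I (e \<alpha>) = 1" if "\<alpha> < s" for \<alpha>
    using e that ip_self[of I "e \<alpha>"] by (simp add: orthonormal_family_def)
  have q1: "q \<alpha> \<le> 1" if "\<alpha> < r" for \<alpha>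
    using bessel[OF e, of "u \<alpha>"] u1[OF that] by (simp add: q_def)
  \<comment> \<open>Bessel with the roles exchanged: each unit vector \<open>e \<gamma>\<close> is
    projected onto the span of the \<open>u \<alpha>\<close>.\<close>
  have "(\<Sum>\<alpha><r. q \<alpha>) = (\<Sum>\<gamma><s. \<Sum>\<alpha><r. (cmod (ip I (u \<alpha>) (e \<gamma>)))\<^sup>2)"
  proof -
    have "cmod (ip I (u \<alpha>) (e \<gamma>)) = cmod (ip I (e \<gamma>) (u \<alpha>))" for \<alpha> \<gamma>
      by (simp flip: cnj_ip[of I "e \<gamma>" "u \<alpha>"])
    then show ?thesis unfolding q_def by (subst sum.swap) simp
  qed
  also have "\<dots> \<le> (\<Sum>\<gamma><s. 1)"
  proof (rule sum_mono)
    fix \<gamma> assume "\<gamma> \<in> {..<s}"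
    then show "(\<Sum>\<alpha><r. (cmod (ip I (u \<alpha>) (e \<gamma>)))\<^sup>2) \<le> 1"
      using bessel[OF u, of "e \<gamma>"] e1[of \<gamma>] by simp
  qed
  finally have qm: "(\<Sum>\<alpha><r. q \<alpha>) \<le> real m" using s by simp
  have head: "(\<Sum>\<alpha><r. (lam \<alpha>)\<^sup>2 * q \<alpha>) \<le> (\<Sum>\<alpha><min m r. (lam \<alpha>)\<^sup>2)"
    using pos dec q1 qm
    by (intro weighted_sum_le_head) (auto simp: q_def sum_nonneg less_imp_le intro!: power_mono)
  have col: "nsq I (\<lambda>i. M i j) - (\<Sum>\<gamma><s. (cmod (ip I (e \<gamma>) (\<lambda>i. M i j)))\<^sup>2) \<le>
      nsq I (\<lambda>i. M i j - K i j)" if j: "j \<in> J" for j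
  proof -
    have "K i j = (\<Sum>\<gamma><s. (\<Sum>\<beta><m. c \<beta> \<gamma> * g \<beta> j) * e \<gamma> i)" if "i \<in> I" for i
    proof -
      have "K i j = (\<Sum>\<beta><m. \<Sum>\<gamma><s. c \<beta> \<gamma> * g \<beta> j * e \<gamma> i)"
        using K[OF that j] c that by (simp add: sum_distrib_left sum_distrib_right mult_ac)
      also have "\<dots> = (\<Sum>\<gamma><s. (\<Sum>\<beta><m. c \<beta> \<gamma> * g \<beta> j) * e \<gamma> i)"
        unfolding sum_distrib_right by (rule sum.swap)
      finally show ?thesis .
    qed
    then have "nsq I (\<lambda>i. M i j - K i j) =
        nsq I (\<lambda>i. M i j - (\<Sum>\<gamma><s. (\<Sum>\<beta><m. c \<beta> \<gamma> * g \<beta> j) * e \<gamma> i))"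
      by (simp add: nsq_def)
    then show ?thesis using nsq_diff_combination_ge[OF e] by simp
  qed
  have ipM: "ip I x (\<lambda>i. M i j) = (\<Sum>\<alpha><r. (of_real (lam \<alpha>) * ip I x (u \<alpha>)) * v \<alpha> j)"
    if "j \<in> J" for x j
  proof -
    have "ip I x (\<lambda>i. M i j) = ip I x (\<lambda>i. \<Sum>\<alpha><r. (of_real (lam \<alpha>) * v \<alpha> j) * u \<alpha> i)"
      using M that by (intro ip_cong) (auto simp: mult_ac)
    then show ?thesis by (simp only: ip_sum_right ip_scale_right) (simp only: mult_ac)
  qed
  have total: "(\<Sum>j\<in>J. nsq I (\<lambda>i. M i j)) = (\<Sum>\<alpha><r. (lam \<alpha>)\<^sup>2)"
  proof -
    have "(\<Sum>j\<in>J. nsq I (\<lambda>i. M i j)) =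
        (\<Sum>j\<in>J. nsq I (\<lambda>i. \<Sum>\<alpha><r. of_real (lam \<alpha>) * u \<alpha> i * v \<alpha> j))"
      using M by (intro sum.cong refl) (simp add: nsq_def)
    then show ?thesis by (simp only: nsq_bilinear_combination[OF u v]) simp
  qed
  have proj: "(\<Sum>j\<in>J. \<Sum>\<gamma><s. (cmod (ip I (e \<gamma>) (\<lambda>i. M i j)))\<^sup>2) = (\<Sum>\<alpha><r. (lam \<alpha>)\<^sup>2 * q \<alpha>)"
  proof -
    have "(\<Sum>j\<in>J. \<Sum>\<gamma><s. (cmod (ip I (e \<gamma>) (\<lambda>i. M i j)))\<^sup>2) =
        (\<Sum>\<gamma><s. nsq J (\<lambda>j. \<Sum>\<alpha><r. (of_real (lam \<alpha>) * ip I (e \<gamma>) (u \<alpha>)) * v \<alpha> j))"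
      by (subst sum.swap) (simp add: nsq_def ipM)
    also have "\<dots> = (\<Sum>\<gamma><s. \<Sum>\<alpha><r. (lam \<alpha>)\<^sup>2 * (cmod (ip I (e \<gamma>) (u \<alpha>)))\<^sup>2)"
      by (simp only: nsq_combination[OF v]) (simp add: norm_mult power_mult_distrib)
    finally show ?thesis by (subst (asm) (2) sum.swap) (simp add: q_def sum_distrib_left)
  qed
  have "(\<Sum>\<alpha>\<in>{m..<r}. (lam \<alpha>)\<^sup>2) = (\<Sum>\<alpha><r. (lam \<alpha>)\<^sup>2) - (\<Sum>\<alpha><min m r. (lam \<alpha>)\<^sup>2)"
    using sum.atLeastLessThan_concat[of 0 m r "\<lambda>\<alpha>. (lam \<alpha>)\<^sup>2"]
    by (cases "m \<le> r") (auto simp: atLeast0LessThan min_def)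
  also have "\<dots> \<le> (\<Sum>j\<in>J. nsq I (\<lambda>i. M i j)) - (\<Sum>j\<in>J. \<Sum>\<gamma><s. (cmod (ip I (e \<gamma>) (\<lambda>i. M i j)))\<^sup>2)"
    using head by (simp add: total proj)
  also have "\<dots> \<le> (\<Sum>j\<in>J. nsq I (\<lambda>i. M i j - K i j))"
    unfolding sum_subtractf[symmetric] by (intro sum_mono col)
  also have "\<dots> = (\<Sum>i\<in>I. \<Sum>j\<in>J. (cmod (M i j - K i j))\<^sup>2)"
    unfolding nsq_def by (rule sum.swap)
  finally show ?thesis .
qed

section \<open>Singular vectors by maximisation, and the decomposition they give\<close>

lemma unit_vectors_compact:
  assumes "finite I"
  shows "compact {u :: 'a \<Rightarrow> complex. (\<forall>i. i \<notin> I \<longrightarrow> u i = 0) \<and> nsq I u = 1}"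
proof -
  let ?S = "{u :: 'a \<Rightarrow> complex. (\<forall>i. i \<notin> I \<longrightarrow> u i = 0) \<and> nsq I u = 1}"
  \<comment> \<open>The topology is that of pointwise convergence on the whole type. Pinning vectors
    to 0 off \<open>I\<close> places them in a product of compact sets.\<close>
  have "compact (PiE UNIV (\<lambda>i. if i \<in> I then cball (0::complex) 1 else {0}))"
    using compactin_PiE[of "\<lambda>_. euclidean" UNIV "\<lambda>i. if i \<in> I then cball (0::complex) 1 else {0}"]
    by (simp add: euclidean_product_topology)
  moreover have "closed {u :: 'a \<Rightarrow> complex. nsq I u = 1}"
    unfolding nsq_def
    by (intro closed_Collect_eq continuous_intros continuous_on_product_coordinates)
  ultimately have "compact (PiE UNIV (\<lambda>i. if i \<in> I then cball (0::complex) 1 else {0}) \<inter> {u. nsq I u = 1})"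
    by (rule compact_Int_closed)
  moreover have "?S = PiE UNIV (\<lambda>i. if i \<in> I then cball (0::complex) 1 else {0}) \<inter> {u. nsq I u = 1}"
  proof -
    have "cmod (u i) \<le> 1" if "nsq I u = 1" "i \<in> I" for u i
    proof -
      have "(cmod (u i))\<^sup>2 \<le> nsq I u"
        unfolding nsq_def using that assms by (intro member_le_sum) auto
      then have "(cmod (u i))\<^sup>2 \<le> 1\<^sup>2" using that by simp
      then show ?thesis by (rule power2_le_imp_le) simp
    qed
    then show ?thesis by (auto simp: PiE_iff split: if_splits)
  qed
  ultimately show ?thesis by simp
qed

text \<open>Both vectors are conjugated because the terms \<open>lam * u i * v j\<close> of a
  decomposition conjugate neither factor; for orthonormal families the value at
  \<open>u \<alpha>\<close>, \<open>v \<alpha>\<close> is then \<open>lam \<alpha>\<close>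
  itself.\<close>

definition bform :: "'a set \<Rightarrow> 'b set \<Rightarrow> ('a \<Rightarrow> 'b \<Rightarrow> complex) \<Rightarrow> ('a \<Rightarrow> complex) \<Rightarrow> ('b \<Rightarrow> complex) \<Rightarrow> complex" where
  "bform I J M u v = (\<Sum>i\<in>I. \<Sum>j\<in>J. cnj (u i) * M i j * cnj (v j))"

lemma bform_right: "bform I J M u v = ip J v (\<lambda>j. \<Sum>i\<in>I. cnj (u i) * M i j)"
  unfolding bform_def ip_def by (subst sum.swap) (simp add: sum_distrib_left mult_ac)

lemma bform_left: "bform I J M u v = ip I u (\<lambda>i. \<Sum>j\<in>J. M i j * cnj (v j))"
  unfolding bform_def ip_def by (simp add: sum_distrib_left mult_ac)

lemma bform_scale: "bform I J M (\<lambda>i. a * u i) (\<lambda>j. b * v j) = cnj a * cnj b * bform I J M u v"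
  by (simp add: bform_def sum_distrib_left mult_ac)

text \<open>Equality case of Cauchy-Schwarz. Testing the maximum on the normalised \<open>p\<close>
  bounds its length by \<open>lam\<close>; then the squared length of \<open>p - lam * v\<close>,
  which equals that of \<open>p\<close> minus the square of \<open>lam\<close>, must vanish.\<close>

lemma unit_maximiser_parallel:
  assumes "finite J" "nsq J v = 1" "ip J v p = of_real lam" "0 < lam"
    and max: "\<And>w. nsq J w = 1 \<Longrightarrow> cmod (ip J w p) \<le> lam"
  shows "\<forall>j\<in>J. p j = of_real lam * v j"
proof -
  define t where "t = sqrt (nsq J p)"
  have t: "t\<^sup>2 = nsq J p" "0 \<le> t" by (simp_all add: t_def)
  have "t \<noteq> 0"
  proof
    assume "t = 0"
    then have "\<forall>j\<in>J. p j = 0" using assms(1) t by (simp flip: nsq_eq_0)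
    then have "ip J v p = 0" by (simp add: ip_def)
    then show False using assms by simp
  qed
  have "nsq J (\<lambda>j. of_real (1 / t) * p j) = 1"
    unfolding nsq_scale using t \<open>t \<noteq> 0\<close> by (simp add: norm_divide power_divide flip: t(1))
  from max[OF this] have "cmod (of_real (1 / t) * of_real (nsq J p)) \<le> lam"
    by (simp only: ip_scale_left ip_self) simp
  then have "t \<le> lam" using t \<open>t \<noteq> 0\<close> by (simp add: norm_mult norm_divide power2_eq_square flip: t(1))
  then have "nsq J p \<le> lam\<^sup>2" using t by (metis power_mono)
  have pv: "ip J p v = of_real lam" using assms(3) cnj_ip[of J v p] by simp
  have "complex_of_real (nsq J (\<lambda>j. p j - of_real lam * v j)) = of_real (nsq J p - lam\<^sup>2)"
    by (simp only: ip_self[symmetric] ip_diff_left ip_diff_right ip_scale_left ip_scale_right)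
      (simp add: ip_self assms pv power2_eq_square)
  then have "nsq J (\<lambda>j. p j - of_real lam * v j) = nsq J p - lam\<^sup>2" by (simp only: of_real_eq_iff)
  then have "nsq J (\<lambda>j. p j - of_real lam * v j) = 0"
    using \<open>nsq J p \<le> lam\<^sup>2\<close> nsq_nonneg[of J "\<lambda>j. p j - of_real lam * v j"] by linarith
  then show ?thesis using assms(1) by (simp add: nsq_eq_0)
qed

lemma bform_maximiser:
  fixes M :: "'a \<Rightarrow> 'b \<Rightarrow> complex"
  assumes fin: "finite I" "finite J" and nz: "\<exists>i\<in>I. \<exists>j\<in>J. M i j \<noteq> 0"
  obtains u v lam where "0 < lam" "nsq I u = 1" "nsq J v = 1" "bform I J M u v = of_real lam"
    "\<And>x y. nsq I x = 1 \<Longrightarrow> nsq J y = 1 \<Longrightarrow> cmod (bform I J M x y) \<le> lam"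
    "\<And>j. j \<in> J \<Longrightarrow> (\<Sum>i\<in>I. cnj (u i) * M i j) = of_real lam * v j"
    "\<And>i. i \<in> I \<Longrightarrow> (\<Sum>j\<in>J. M i j * cnj (v j)) = of_real lam * u i"
proof -
  let ?S = "{u :: 'a \<Rightarrow> complex. (\<forall>i. i \<notin> I \<longrightarrow> u i = 0) \<and> nsq I u = 1}"
  let ?T = "{u :: 'b \<Rightarrow> complex. (\<forall>i. i \<notin> J \<longrightarrow> u i = 0) \<and> nsq J u = 1}"
  let ?f = "\<lambda>w. cmod (bform I J M (fst w) (snd w))"
  obtain i0 j0 where ij: "i0 \<in> I" "j0 \<in> J" "M i0 j0 \<noteq> 0" using nz by blast
  \<comment> \<open>Unit vectors at a nonzero entry of \<open>M\<close>; they make the maximum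
    positive.\<close>
  define a :: "'a \<Rightarrow> complex" where "a = (\<lambda>i. if i = i0 then 1 else 0)"
  define b :: "'b \<Rightarrow> complex" where "b = (\<lambda>j. if j = j0 then 1 else 0)"
  have "nsq I a = (\<Sum>i\<in>I. if i = i0 then 1 else 0)" unfolding nsq_def a_def by (intro sum.cong) auto
  then have a: "a \<in> ?S" using ij fin by (auto simp: a_def)
  have "nsq J b = (\<Sum>i\<in>J. if i = j0 then 1 else 0)" unfolding nsq_def b_def by (intro sum.cong) auto
  then have b: "b \<in> ?T" using ij fin by (auto simp: b_def)
  have "bform I J M a b = (\<Sum>i\<in>I. if i = i0 then (\<Sum>j\<in>J. if j = j0 then M i j else 0) else 0)"
    unfolding bform_def a_def b_def by (intro sum.cong refl) (auto intro!: sum.cong)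
  then have ab: "bform I J M a b = M i0 j0" using ij fin by simp
  have "continuous_on (?S \<times> ?T) ?f"
  proof -
    have *: "continuous_on (?S \<times> ?T) (\<lambda>w. fst w i)" "continuous_on (?S \<times> ?T) (\<lambda>w. snd w j)" for i j
      by (rule continuous_on_compose2[OF continuous_on_product_coordinates],
          auto intro: continuous_intros)+
    show ?thesis unfolding bform_def by (intro continuous_intros *)
  qed
  moreover have "compact (?S \<times> ?T)"
    by (intro compact_Times unit_vectors_compact fin)
  moreover have "?S \<times> ?T \<noteq> {}" using a b by blast
  ultimately obtain w where w: "w \<in> ?S \<times> ?T" and wmax: "\<And>z. z \<in> ?S \<times> ?T \<Longrightarrow> ?f z \<le> ?f w"
    using continuous_attains_sup[of "?S \<times> ?T" ?f] by blast
  define lam where "lam = ?f w"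
  have lam: "0 < lam" using wmax[of "(a, b)"] a b ab ij by (auto simp: lam_def)
  have max: "cmod (bform I J M x y) \<le> lam" if "nsq I x = 1" "nsq J y = 1" for x y
  proof -
    let ?x = "\<lambda>i. if i \<in> I then x i else 0" and ?y = "\<lambda>j. if j \<in> J then y j else 0"
    have "nsq I ?x = nsq I x" "nsq J ?y = nsq J y" "bform I J M ?x ?y = bform I J M x y"
      by (simp_all add: nsq_def bform_def)
    then show ?thesis using wmax[of "(?x, ?y)"] that by (simp add: lam_def)
  qed
  define z where "z = bform I J M (fst w) (snd w)"
  have z: "cmod z = lam" by (simp add: z_def lam_def)
  \<comment> \<open>The phase of \<open>z\<close> is moved into \<open>u\<close>. As
    \<open>bform\<close> conjugates its first vector, the value becomes
    \<open>cnj z * z / lam\<close>, which is \<open>lam\<close>.\<close>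
  define u where "u = (\<lambda>i. (z / of_real lam) * fst w i)"
  define v where "v = snd w"
  have u1: "nsq I u = 1" unfolding u_def nsq_scale using w z lam by (auto simp: norm_divide)
  have v1: "nsq J v = 1" using w by (auto simp: v_def)
  have "z * cnj z = of_real (lam\<^sup>2)" using z complex_norm_square[of z] by simp
  then have uv: "bform I J M u v = of_real lam"
    using bform_scale[of I J M "z / of_real lam" "fst w" 1 "snd w"] lam
    by (simp add: u_def v_def field_simps power2_eq_square flip: z_def)
  have "\<forall>j\<in>J. (\<Sum>i\<in>I. cnj (u i) * M i j) = of_real lam * v j"
    using uv max u1 by (intro unit_maximiser_parallel fin v1 lam) (simp_all flip: bform_right)
  moreover have "\<forall>i\<in>I. (\<Sum>j\<in>J. M i j * cnj (v j)) = of_real lam * u i"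
    using uv max v1 by (intro unit_maximiser_parallel fin u1 lam) (simp_all flip: bform_left)
  ultimately show ?thesis using that lam u1 v1 uv max by blast
qed

text \<open>
  Partial decompositions found by maximising \<open>cmod (bform I J M x y)\<close> over unit vectors. In the
  last clause only \<open>x\<close> is required to be orthogonal to the earlier vectors, because then the part
  of \<open>M\<close> already split off does not contribute, whatever \<open>y\<close> is.
\<close>

definition greedy_triples ::
  "'a set \<Rightarrow> 'b set \<Rightarrow> ('a \<Rightarrow> 'b \<Rightarrow> complex) \<Rightarrow> nat \<Rightarrow> (nat \<Rightarrow> real) \<Rightarrow> (nat \<Rightarrow> 'a \<Rightarrow> complex) \<Rightarrow>
    (nat \<Rightarrow> 'b \<Rightarrow> complex) \<Rightarrow> bool" where
  "greedy_triples I J M r lam u v \<longleftrightarrow>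
     orthonormal_family I r u \<and> orthonormal_family J r v \<and>
     (\<forall>\<alpha><r. 0 < lam \<alpha> \<and> bform I J M (u \<alpha>) (v \<alpha>) = of_real (lam \<alpha>) \<and>
       (\<forall>j\<in>J. (\<Sum>i\<in>I. cnj (u \<alpha> i) * M i j) = of_real (lam \<alpha>) * v \<alpha> j) \<and>
       (\<forall>i\<in>I. (\<Sum>j\<in>J. M i j * cnj (v \<alpha> j)) = of_real (lam \<alpha>) * u \<alpha> i) \<and>
       (\<forall>x y. nsq I x = 1 \<longrightarrow> nsq J y = 1 \<longrightarrow> (\<forall>\<beta><\<alpha>. ip I (u \<beta>) x = 0) \<longrightarrow>
          cmod (bform I J M x y) \<le> lam \<alpha>))"

text \<open>The residual \<open>M'\<close> is annihilated by all earlier \<open>u \<alpha>\<close>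
  and \<open>v \<alpha>\<close>. Each vector of a maximising pair for \<open>M'\<close> is, up to
  the factor \<open>l\<close>, the image of the other one, hence orthogonal to the earlier vectors;
  and on such vectors \<open>M'\<close> and \<open>M\<close> define the same form.\<close>

lemma greedy_triples_extend:
  fixes M :: "'a \<Rightarrow> 'b \<Rightarrow> complex"
  assumes fin: "finite I" "finite J" and g: "greedy_triples I J M r lam u v"
    and nz: "\<exists>i\<in>I. \<exists>j\<in>J. M i j \<noteq> (\<Sum>\<alpha><r. of_real (lam \<alpha>) * u \<alpha> i * v \<alpha> j)"
  shows "\<exists>lam' u' v'. greedy_triples I J M (Suc r) lam' u' v'"
proof -
  have onu: "orthonormal_family I r u" and onv: "orthonormal_family J r v"
    and g': "\<And>\<alpha>. \<alpha> < r \<Longrightarrow> 0 < lam \<alpha>"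
      "\<And>\<alpha> j. \<alpha> < r \<Longrightarrow> j \<in> J \<Longrightarrow> (\<Sum>i\<in>I. cnj (u \<alpha> i) * M i j) = of_real (lam \<alpha>) * v \<alpha> j"
      "\<And>\<alpha> i. \<alpha> < r \<Longrightarrow> i \<in> I \<Longrightarrow> (\<Sum>j\<in>J. M i j * cnj (v \<alpha> j)) = of_real (lam \<alpha>) * u \<alpha> i"
    using g by (simp_all add: greedy_triples_def)
  define M' where "M' i j = M i j - (\<Sum>\<alpha><r. of_real (lam \<alpha>) * u \<alpha> i * v \<alpha> j)" for i j
  have rowM': "(\<Sum>i\<in>I. cnj (x i) * M' i j) =
      (\<Sum>i\<in>I. cnj (x i) * M i j) - (\<Sum>\<alpha><r. of_real (lam \<alpha>) * ip I x (u \<alpha>) * v \<alpha> j)" for x j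
  proof -
    have "(\<Sum>i\<in>I. cnj (x i) * (\<Sum>\<alpha><r. of_real (lam \<alpha>) * u \<alpha> i * v \<alpha> j)) =
        (\<Sum>\<alpha><r. of_real (lam \<alpha>) * ip I x (u \<alpha>) * v \<alpha> j)"
      unfolding ip_def sum_distrib_left sum_distrib_right by (subst sum.swap) (simp only: mult_ac)
    then show ?thesis by (simp add: M'_def right_diff_distrib sum_subtractf)
  qed
  have colM': "(\<Sum>j\<in>J. M' i j * cnj (y j)) =
      (\<Sum>j\<in>J. M i j * cnj (y j)) - (\<Sum>\<alpha><r. of_real (lam \<alpha>) * ip J y (v \<alpha>) * u \<alpha> i)" for y i
  proof -
    have "(\<Sum>j\<in>J. (\<Sum>\<alpha><r. of_real (lam \<alpha>) * u \<alpha> i * v \<alpha> j) * cnj (y j)) =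
        (\<Sum>\<alpha><r. of_real (lam \<alpha>) * ip J y (v \<alpha>) * u \<alpha> i)"
      unfolding ip_def sum_distrib_left sum_distrib_right by (subst sum.swap) (simp only: mult_ac)
    then show ?thesis by (simp add: M'_def left_diff_distrib sum_subtractf)
  qed
  have row0: "(\<Sum>i\<in>I. cnj (u \<alpha> i) * M' i j) = 0" if "\<alpha> < r" "j \<in> J" for \<alpha> j
  proof -
    have "(\<Sum>\<beta><r. of_real (lam \<beta>) * ip I (u \<alpha>) (u \<beta>) * v \<beta> j) =
        (\<Sum>\<beta><r. if \<beta> = \<alpha> then of_real (lam \<beta>) * v \<beta> j else 0)"
      using onu that by (intro sum.cong) (auto simp: orthonormal_family_def)
    then show ?thesis using that g'(2) by (simp add: rowM')
  qed
  have col0: "(\<Sum>j\<in>J. M' i j * cnj (v \<alpha> j)) = 0" if "\<alpha> < r" "i \<in> I" for \<alpha> i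
  proof -
    have "(\<Sum>\<beta><r. of_real (lam \<beta>) * ip J (v \<alpha>) (v \<beta>) * u \<beta> i) =
        (\<Sum>\<beta><r. if \<beta> = \<alpha> then of_real (lam \<beta>) * u \<beta> i else 0)"
      using onv that by (intro sum.cong) (auto simp: orthonormal_family_def)
    then show ?thesis using that g'(3) by (simp add: colM')
  qed
  have "\<exists>i\<in>I. \<exists>j\<in>J. M' i j \<noteq> 0" using nz by (simp add: M'_def)
  then obtain x y l where l: "0 < l" and x: "nsq I x = 1" and y: "nsq J y = 1"
    and xy: "bform I J M' x y = of_real l"
    and max: "\<And>x y. nsq I x = 1 \<Longrightarrow> nsq J y = 1 \<Longrightarrow> cmod (bform I J M' x y) \<le> l"
    and row: "\<And>j. j \<in> J \<Longrightarrow> (\<Sum>i\<in>I. cnj (x i) * M' i j) = of_real l * y j"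
    and col: "\<And>i. i \<in> I \<Longrightarrow> (\<Sum>j\<in>J. M' i j * cnj (y j)) = of_real l * x i"
    by (rule bform_maximiser[OF fin]) (rule that; assumption)
  have ux: "ip I (u \<alpha>) x = 0" if "\<alpha> < r" for \<alpha>
  proof -
    have "of_real l * ip I (u \<alpha>) x = ip I (u \<alpha>) (\<lambda>i. \<Sum>j\<in>J. M' i j * cnj (y j))"
      unfolding ip_scale_right[symmetric] by (intro ip_cong) (simp_all add: col)
    also have "\<dots> = ip J y (\<lambda>j. \<Sum>i\<in>I. cnj (u \<alpha> i) * M' i j)"
      by (simp only: bform_left[symmetric] bform_right[symmetric])
    also have "\<dots> = 0" using row0[OF that] by (simp add: ip_def)
    finally show ?thesis using l by simp
  qed
  have vy: "ip J (v \<alpha>) y = 0" if "\<alpha> < r" for \<alpha>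
  proof -
    have "of_real l * ip J (v \<alpha>) y = ip J (v \<alpha>) (\<lambda>j. \<Sum>i\<in>I. cnj (x i) * M' i j)"
      unfolding ip_scale_right[symmetric] by (intro ip_cong) (simp_all add: row)
    also have "\<dots> = ip I x (\<lambda>i. \<Sum>j\<in>J. M' i j * cnj (v \<alpha> j))"
      by (simp only: bform_left[symmetric] bform_right[symmetric])
    also have "\<dots> = 0" using col0[OF that] by (simp add: ip_def)
    finally show ?thesis using l by simp
  qed
  have xu: "ip I x' (u \<alpha>) = 0" if "ip I (u \<alpha>) x' = 0" for x' \<alpha>
    using that cnj_ip[of I "u \<alpha>" x'] by simp
  have yv: "ip J y (v \<alpha>) = 0" if "\<alpha> < r" for \<alpha>
    using vy[OF that] cnj_ip[of J "v \<alpha>" y] by simp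
  have Beq: "bform I J M' x' y' = bform I J M x' y'" if "\<forall>\<alpha><r. ip I (u \<alpha>) x' = 0" for x' y'
    unfolding bform_right rowM' using that xu by (intro ip_cong) auto
  let ?u = "u(r := x)" and ?v = "v(r := y)" and ?lam = "lam(r := l)"
  have "\<forall>\<alpha><Suc r. 0 < ?lam \<alpha> \<and> bform I J M (?u \<alpha>) (?v \<alpha>) = of_real (?lam \<alpha>) \<and>
       (\<forall>j\<in>J. (\<Sum>i\<in>I. cnj (?u \<alpha> i) * M i j) = of_real (?lam \<alpha>) * ?v \<alpha> j) \<and>
       (\<forall>i\<in>I. (\<Sum>j\<in>J. M i j * cnj (?v \<alpha> j)) = of_real (?lam \<alpha>) * ?u \<alpha> i) \<and>
       (\<forall>x y. nsq I x = 1 \<longrightarrow> nsq J y = 1 \<longrightarrow> (\<forall>\<beta><\<alpha>. ip I (?u \<beta>) x = 0) \<longrightarrow>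
          cmod (bform I J M x y) \<le> ?lam \<alpha>)"
  proof (intro allI impI)
    fix \<alpha> assume "\<alpha> < Suc r"
    then consider "\<alpha> < r" | "\<alpha> = r" by linarith
    then show "0 < ?lam \<alpha> \<and> bform I J M (?u \<alpha>) (?v \<alpha>) = of_real (?lam \<alpha>) \<and>
       (\<forall>j\<in>J. (\<Sum>i\<in>I. cnj (?u \<alpha> i) * M i j) = of_real (?lam \<alpha>) * ?v \<alpha> j) \<and>
       (\<forall>i\<in>I. (\<Sum>j\<in>J. M i j * cnj (?v \<alpha> j)) = of_real (?lam \<alpha>) * ?u \<alpha> i) \<and>
       (\<forall>x y. nsq I x = 1 \<longrightarrow> nsq J y = 1 \<longrightarrow> (\<forall>\<beta><\<alpha>. ip I (?u \<beta>) x = 0) \<longrightarrow>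
          cmod (bform I J M x y) \<le> ?lam \<alpha>)"
    proof cases
      case 1
      then have "?u \<alpha> = u \<alpha>" "?v \<alpha> = v \<alpha>" "?lam \<alpha> = lam \<alpha>" "\<forall>\<beta><\<alpha>. ?u \<beta> = u \<beta>" by auto
      then show ?thesis using g 1 by (simp add: greedy_triples_def)
    next
      case 2
      have "bform I J M x y = of_real l" using Beq[of x y] ux xy by simp
      moreover have "(\<Sum>i\<in>I. cnj (x i) * M i j) = of_real l * y j" if "j \<in> J" for j
        using rowM'[of x j] row[OF that] ux xu by simp
      moreover have "(\<Sum>j\<in>J. M i j * cnj (y j)) = of_real l * x i" if "i \<in> I" for i
        using colM'[of i y] col[OF that] yv by simp
      moreover have "cmod (bform I J M x' y') \<le> l"
        if "nsq I x' = 1" "nsq J y' = 1" "\<forall>\<beta><\<alpha>. ip I (?u \<beta>) x' = 0" for x' y'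
        using that max[of x' y'] Beq[of x' y'] 2 by simp
      ultimately show ?thesis using l 2 by simp
    qed
  qed
  moreover have "orthonormal_family I (Suc r) ?u" "orthonormal_family J (Suc r) ?v"
    by (intro orthonormal_family_extend onu onv x y ux vy; assumption)+
  ultimately have "greedy_triples I J M (Suc r) ?lam ?u ?v"
    unfolding greedy_triples_def by blast
  then show ?thesis by blast
qed

text \<open>If no stage reproduced \<open>M\<close>, the greedy construction would go on for
  \<open>card I + 1\<close> steps and produce too many orthonormal vectors.\<close>

theorem singular_value_decomposition:
  fixes M :: "'a \<Rightarrow> 'b \<Rightarrow> complex"
  assumes fin: "finite I" "finite J"
  obtains r lam u v where "orthonormal_family I r u" "orthonormal_family J r v"
    "\<forall>\<alpha><r. 0 < lam \<alpha>" "\<forall>\<alpha> \<beta>. \<alpha> \<le> \<beta> \<and> \<beta> < r \<longrightarrow> (lam \<beta> :: real) \<le> lam \<alpha>"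
    "\<forall>i\<in>I. \<forall>j\<in>J. M i j = (\<Sum>\<alpha><r. of_real (lam \<alpha>) * u \<alpha> i * v \<alpha> j)"
proof -
  have "\<exists>r lam u v. greedy_triples I J M r lam u v \<and>
      (\<forall>i\<in>I. \<forall>j\<in>J. M i j = (\<Sum>\<alpha><r. of_real (lam \<alpha>) * u \<alpha> i * v \<alpha> j))"
  proof (rule ccontr)
    assume contra: "\<not> ?thesis"
    have "\<exists>lam u v. greedy_triples I J M r lam u v" for r
    proof (induction r)
      case 0
      show ?case by (auto simp: greedy_triples_def orthonormal_family_def)
    next
      case (Suc r)
      then obtain lam u v where g: "greedy_triples I J M r lam u v" by blast
      with contra have "\<exists>i\<in>I. \<exists>j\<in>J. M i j \<noteq> (\<Sum>\<alpha><r. of_real (lam \<alpha>) * u \<alpha> i * v \<alpha> j)" by blast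
      then show ?case by (rule greedy_triples_extend[OF fin g])
    qed
    then obtain lam u v where "greedy_triples I J M (Suc (card I)) lam u v" by blast
    then show False
      using orthonormal_family_card[OF fin(1), of "Suc (card I)" u] by (simp add: greedy_triples_def)
  qed
  then obtain r lam u v where g: "greedy_triples I J M r lam u v"
    and M: "\<forall>i\<in>I. \<forall>j\<in>J. M i j = (\<Sum>\<alpha><r. of_real (lam \<alpha>) * u \<alpha> i * v \<alpha> j)" by blast
  have on: "orthonormal_family I r u" "orthonormal_family J r v"
    using g by (simp_all add: greedy_triples_def)
  \<comment> \<open>The later pair \<open>u \<beta>\<close>, \<open>v \<beta>\<close> was already an
    admissible competitor at stage \<open>\<alpha>\<close>, so its value cannot exceed the maximum
    found there.\<close>
  have "lam \<beta> \<le> lam \<alpha>" if "\<alpha> \<le> \<beta>" "\<beta> < r" for \<alpha> \<beta>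
  proof -
    have "nsq I (u \<beta>) = 1" "nsq J (v \<beta>) = 1"
      using on that ip_self[of I "u \<beta>"] ip_self[of J "v \<beta>"] by (auto simp: orthonormal_family_def)
    moreover have "\<forall>\<gamma><\<alpha>. ip I (u \<gamma>) (u \<beta>) = 0" using on that by (auto simp: orthonormal_family_def)
    ultimately have "cmod (bform I J M (u \<beta>) (v \<beta>)) \<le> lam \<alpha>"
    proof -
      have "\<forall>x y. nsq I x = 1 \<longrightarrow> nsq J y = 1 \<longrightarrow> (\<forall>\<gamma><\<alpha>. ip I (u \<gamma>) x = 0) \<longrightarrow>
          cmod (bform I J M x y) \<le> lam \<alpha>"
        using g that by (simp only: greedy_triples_def) (meson le_less_trans)
      then show ?thesis using \<open>nsq I (u \<beta>) = 1\<close> \<open>nsq J (v \<beta>) = 1\<close> \<open>\<forall>\<gamma><\<alpha>. ip I (u \<gamma>) (u \<beta>) = 0\<close> by blast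
    qed
    moreover have "bform I J M (u \<beta>) (v \<beta>) = of_real (lam \<beta>)" "0 < lam \<beta>"
      using g that by (simp_all add: greedy_triples_def)
    ultimately show ?thesis by simp
  qed
  moreover have "\<forall>\<alpha><r. 0 < lam \<alpha>" using g by (simp add: greedy_triples_def)
  ultimately show ?thesis using that[OF on _ _ M] by simp
qed

section \<open>Single-qubit maps on many qubits\<close>

definition with_bit :: "nat set \<Rightarrow> nat \<Rightarrow> bool \<Rightarrow> nat set" where
  "with_bit S k a = (if a then insert k S else S - {k})"

text \<open>\<open>F\<close> on tensor factor \<open>k\<close>, written without naming the set of
  all qubits: every other label of \<open>S\<close> and \<open>T\<close> is kept.\<close>

definition site :: "(qubit_matrix \<Rightarrow> qubit_matrix) \<Rightarrow> nat \<Rightarrow> nat set operator \<Rightarrow> nat set operator" where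
  "site F k X = (\<lambda>S T. \<Sum>a\<in>UNIV. \<Sum>b\<in>UNIV.
     X (with_bit S k a) (with_bit T k b) * F (matrix_unit a b) $ (k \<in> S) $ (k \<in> T))"

text \<open>The 2 by 2 block of \<open>X\<close> in which only qubit \<open>k\<close> varies;
  \<open>site F k\<close> acts on each such block by \<open>F\<close>.\<close>

definition slice :: "nat \<Rightarrow> nat set operator \<Rightarrow> nat set \<Rightarrow> nat set \<Rightarrow> qubit_matrix" where
  "slice k X S T = (\<chi> a b. X (with_bit S k a) (with_bit T k b))"

lemma with_bit_same [simp]: "with_bit (with_bit S k a) k b = with_bit S k b"
  by (auto simp: with_bit_def)

lemma with_bit_commute: "j \<noteq> k \<Longrightarrow> with_bit (with_bit S j a) k b = with_bit (with_bit S k b) j a"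
  by (auto simp: with_bit_def)

lemma mem_with_bit [simp]: "j \<in> with_bit S k a \<longleftrightarrow> (if j = k then a else j \<in> S)"
  by (auto simp: with_bit_def)

lemma sum_bool: "(\<Sum>a\<in>(UNIV::bool set). f a) = f False + f True"
  by (simp add: UNIV_bool)

lemma site_commute:
  "j \<noteq> k \<Longrightarrow> site F j (site G k X) = site G k (site F j X)"
  by (intro ext) (simp add: site_def sum_bool with_bit_commute[of j k] algebra_simps)

lemma site_add: "site F k (\<lambda>S T. X S T + Y S T) = (\<lambda>S T. site F k X S T + site F k Y S T)"
  by (intro ext) (simp add: site_def sum_bool algebra_simps)

lemma site_diff: "site F k (\<lambda>S T. X S T - Y S T) = (\<lambda>S T. site F k X S T - site F k Y S T)"
  by (intro ext) (simp add: site_def sum_bool algebra_simps)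

lemma complex_linear_expand:
  assumes "complex_linear F"
  shows "F M $ i $ j = (\<Sum>a\<in>UNIV. \<Sum>b\<in>UNIV. M $ a $ b * F (matrix_unit a b) $ i $ j)"
proof -
  have add: "F (X + Y) = F X + F Y" and scale: "F (\<chi> i j. c * X $ i $ j) = (\<chi> i j. c * F X $ i $ j)" for X Y c
    using assms by (auto simp: complex_linear_def)
  let ?E = "\<lambda>a b. (\<chi> i j. M $ a $ b * matrix_unit a b $ i $ j) :: qubit_matrix"
  have "M = (?E False False + ?E False True) + (?E True False + ?E True True)"
    by (auto simp: vec_eq_iff matrix_unit_def)
  then have "F M = F ((?E False False + ?E False True) + (?E True False + ?E True True))"
    by (rule arg_cong)
  also have "\<dots> = (F (?E False False) + F (?E False True)) + (F (?E True False) + F (?E True True))"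
    by (simp only: add)
  finally have "F M = (F (?E False False) + F (?E False True)) + (F (?E True False) + F (?E True True))" .
  then show ?thesis by (simp only: scale) (simp add: sum_bool)
qed

lemma site_slice: "complex_linear F \<Longrightarrow> site F k X S T = F (slice k X S T) $ (k \<in> S) $ (k \<in> T)"
  by (subst complex_linear_expand, assumption) (simp add: site_def slice_def)

lemma slice_site: "complex_linear F \<Longrightarrow> slice k (site F k X) S T = F (slice k X S T)"
  by (simp add: vec_eq_iff slice_def[of k "site F k X"] site_slice) (simp add: slice_def)

lemma sum_Pow_insert:
  assumes "k \<notin> B" "finite B"
  shows "(\<Sum>S\<in>Pow (insert k B). f S) = (\<Sum>S\<in>Pow B. \<Sum>a\<in>UNIV. f (with_bit S k a))"
proof -
  have "(\<Sum>S\<in>Pow (insert k B). f S) = (\<Sum>S\<in>Pow B. f S) + (\<Sum>S\<in>insert k ` Pow B. f S)"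
    unfolding Pow_insert using assms by (intro sum.union_disjoint) auto
  also have "(\<Sum>S\<in>insert k ` Pow B. f S) = (\<Sum>S\<in>Pow B. f (insert k S))"
    using assms by (intro sum.reindex_cong[of "insert k"]) (auto simp: inj_on_def insert_ident)
  finally have *: "(\<Sum>S\<in>Pow (insert k B). f S) = (\<Sum>S\<in>Pow B. f S) + (\<Sum>S\<in>Pow B. f (insert k S))" .
  show ?thesis
  proof -
    have "f (S - {k}) = f S" if "S \<in> Pow B" for S
    proof -
      have "S - {k} = S" using that assms by auto
      then show ?thesis by simp
    qed
    then show ?thesis by (simp add: * sum_bool with_bit_def sum.distrib)
  qed
qed

section \<open>Partial traces and the depolarising map\<close>

lemma sum_Pow_split:
  assumes "finite V" "e \<subseteq> V"
  shows "(\<Sum>K\<in>Pow V. f K) = (\<Sum>Q\<in>Pow e. \<Sum>K\<in>Pow (V - e). f (Q \<union> K))"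
proof -
  have "bij_betw (\<lambda>(Q, K). Q \<union> K) (Pow e \<times> Pow (V - e)) (Pow V)"
  proof (rule bij_betwI[of _ _ _ "\<lambda>K. (K \<inter> e, K - e)"])
    fix z assume "z \<in> Pow e \<times> Pow (V - e)"
    then obtain Q K where z: "z = (Q, K)" "Q \<subseteq> e" "K \<subseteq> V - e" by auto
    then have "(Q \<union> K) \<inter> e = Q" "Q \<union> K - e = K" by auto
    then show "((case z of (Q, K) \<Rightarrow> Q \<union> K) \<inter> e, (case z of (Q, K) \<Rightarrow> Q \<union> K) - e) = z"
      using z by simp
  qed (use assms in auto)
  from sum.reindex_bij_betw[OF this, of f] show ?thesis
    by (simp add: sum.cartesian_product case_prod_unfold)
qed

text \<open>The result is still a function of all labels that merely ignores those in
  \<open>e\<close>, so partial traces and single-qubit maps compose without a change of index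
  set.\<close>

definition ptrace :: "nat set \<Rightarrow> nat set operator \<Rightarrow> nat set operator" where
  "ptrace e X = (\<lambda>S T. \<Sum>R\<in>Pow e. X (S - e \<union> R) (T - e \<union> R))"

lemma ptrace_single: "ptrace {k} X S T = (\<Sum>a\<in>UNIV. X (with_bit S k a) (with_bit T k a))"
proof -
  have "Pow {k} = {{}, {k}}" by auto
  then show ?thesis by (simp add: ptrace_def sum_bool with_bit_def insert_Diff_if)
qed

lemma ptrace_insert:
  assumes "k \<notin> e" "finite e"
  shows "ptrace (insert k e) X = ptrace e (ptrace {k} X)"
proof (intro ext)
  fix S T
  have *: "S - insert k e \<union> with_bit R k a = with_bit (S - e \<union> R) k a" if "R \<subseteq> e" for S R a
    using that assms(1) by (auto simp: with_bit_def)
  show "ptrace (insert k e) X S T = ptrace e (ptrace {k} X) S T"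
    unfolding ptrace_def[of "insert k e"] ptrace_def[of e] ptrace_single sum_Pow_insert[OF assms]
    by (intro sum.cong refl) (simp add: *)
qed

lemma ptrace_zero: "ptrace e (\<lambda>S T. 0) = (\<lambda>S T. 0)"
  by (simp add: ptrace_def)

definition traceless :: "nat set \<Rightarrow> nat set operator \<Rightarrow> bool" where
  "traceless e X \<longleftrightarrow> ptrace e X = (\<lambda>S T. 0)"

lemma traceless_mono:
  assumes "traceless {k} X" "k \<in> e" "finite e"
  shows "traceless e X"
  using assms ptrace_insert[of k "e - {k}" X] by (simp add: traceless_def ptrace_zero insert_absorb)

definition dep :: "qubit_matrix \<Rightarrow> qubit_matrix" where
  "dep M = (\<chi> i j. if i = j then trace M / 2 else 0)"

lemma dep_linear: "complex_linear dep"
  by (auto simp: complex_linear_def dep_def vec_eq_iff trace_def sum_bool field_simps)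

lemma trace_dep: "trace (dep M) = trace M"
  by (simp add: dep_def trace_def sum_bool)

lemma ptrace_site_same:
  assumes "complex_linear F" "\<And>M. trace (F M) = trace M"
  shows "ptrace {k} (site F k X) = ptrace {k} X"
proof (intro ext)
  fix S T
  have "ptrace {k} (site F k X) S T = trace (slice k (site F k X) S T)"
    by (simp add: ptrace_single trace_def slice_def)
  also have "\<dots> = trace (slice k X S T)" by (simp add: slice_site assms)
  also have "\<dots> = ptrace {k} X S T" by (simp add: ptrace_single trace_def slice_def)
  finally show "ptrace {k} (site F k X) S T = ptrace {k} X S T" .
qed

lemma ptrace_site_other:
  "j \<noteq> k \<Longrightarrow> ptrace {j} (site F k X) = site F k (ptrace {j} X)"
  by (intro ext) (simp add: ptrace_single site_def sum_bool with_bit_commute[of j k] algebra_simps)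

lemma traceless_site:
  assumes "complex_linear F" "\<And>M. trace (F M) = trace M" "traceless {j} X"
  shows "traceless {j} (site F k X)"
proof (cases "j = k")
  case False
  then show ?thesis
    using assms by (simp add: traceless_def ptrace_site_other) (simp add: site_def)
qed (use assms in \<open>simp add: traceless_def ptrace_site_same\<close>)

lemma site_dep: "site dep k X S T = of_bool (k \<in> S \<longleftrightarrow> k \<in> T) / 2 * ptrace {k} X S T"
  by (simp add: site_slice dep_linear) (simp add: dep_def slice_def trace_def ptrace_single)

lemma traceless_diff_dep: "traceless {k} (\<lambda>S T. X S T - site dep k X S T)"
proof -
  have "ptrace {k} (\<lambda>S T. X S T - site dep k X S T) = (\<lambda>S T. ptrace {k} X S T - ptrace {k} (site dep k X) S T)"
    by (intro ext) (simp add: ptrace_single sum_bool)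
  then show ?thesis by (simp add: traceless_def ptrace_site_same dep_linear trace_dep)
qed

text \<open>Depolarising \<open>k\<close> means tracing it out and inserting half the identity, so a
  further trace over \<open>e\<close> is, up to a factor, the trace over \<open>insert k e\<close>.
  This allows qubits to be split off one at a time.\<close>

lemma traceless_dep:
  assumes "k \<notin> e" "finite e" "traceless (insert k e) X"
  shows "traceless e (site dep k X)"
proof -
  have "ptrace e (site dep k X) S T = of_bool (k \<in> S \<longleftrightarrow> k \<in> T) / 2 * ptrace (insert k e) X S T" for S T
  proof -
    have *: "k \<in> S - e \<union> R \<longleftrightarrow> k \<in> S" if "R \<in> Pow e" for S R using that assms(1) by auto
    show ?thesis
      unfolding ptrace_insert[OF assms(1,2)] ptrace_def[of e] site_dep sum_distrib_left
      by (intro sum.cong refl) (simp only: *)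
  qed
  then show ?thesis using assms(3) by (simp add: traceless_def fun_eq_iff)
qed

section \<open>Tensor-power noise as successive single-qubit maps\<close>

definition sites :: "(qubit_matrix \<Rightarrow> qubit_matrix) \<Rightarrow> nat list \<Rightarrow> nat set operator \<Rightarrow> nat set operator" where
  "sites F ks = fold (site F) ks"

text \<open>Maps on different qubits commute, so the noise on \<open>k\<close> can be moved to the
  front, where it meets the part of the operator that it damps.\<close>

lemma sites_remove1:
  assumes "k \<in> set ks"
  shows "sites F ks X = sites F (remove1 k ks) (site F k X)"
proof -
  have "site F x \<circ> site F y = site F y \<circ> site F x" for x y
    by (cases "x = y") (auto simp: fun_eq_iff site_commute)
  then have "fold (site F) ks = fold (site F) (remove1 k ks) \<circ> site F k"
    using assms by (intro fold_remove1_split) auto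
  then show ?thesis by (simp add: sites_def)
qed

lemma sites_add: "sites F ks (\<lambda>S T. X S T + Y S T) = (\<lambda>S T. sites F ks X S T + sites F ks Y S T)"
  by (induction ks arbitrary: X Y) (simp_all add: sites_def site_add)

lemma traceless_sites:
  assumes "complex_linear F" "\<And>M. trace (F M) = trace M" "traceless {j} X"
  shows "traceless {j} (sites F ks X)"
  using assms(3) by (induction ks arbitrary: X) (simp_all add: sites_def traceless_site assms)

text \<open>An intermediate stage of the tensor power: bits below \<open>m\<close> are summed over,
  the others are still those of \<open>S\<close> and \<open>T\<close>. With \<open>m = n\<close> the
  kernel is that of \<open>noise\<close>.\<close>

lemma sites_upt:
  "sites F [0..<m] X S T = (\<Sum>S'\<in>Pow {..<m}. \<Sum>T'\<in>Pow {..<m}.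
     X (S - {..<m} \<union> S') (T - {..<m} \<union> T') * (\<Prod>k<m. F (matrix_unit (k \<in> S') (k \<in> T')) $ (k \<in> S) $ (k \<in> T)))"
proof (induction m arbitrary: S T)
  case 0
  then show ?case by (simp add: sites_def)
next
  case (Suc m)
  let ?K = "\<lambda>k S' T' S T. F (matrix_unit (k \<in> S') (k \<in> T')) $ (k \<in> S) $ (k \<in> T)"
  have ins: "{..<Suc m} = insert m {..<m}" by auto
  have set1: "S - {..<Suc m} \<union> with_bit S' m a = with_bit S m a - {..<m} \<union> S'" if "S' \<in> Pow {..<m}" for S S' a
    using that by (auto simp: with_bit_def)
  have prod1: "(\<Prod>k<m. ?K k (with_bit S' m a) (with_bit T' m b) S T) = (\<Prod>k<m. ?K k S' T' (with_bit S m a) (with_bit T m b))"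
    for S' T' a b by (intro prod.cong) auto
  have "sites F [0..<Suc m] X S T = (\<Sum>a\<in>UNIV. \<Sum>b\<in>UNIV.
     sites F [0..<m] X (with_bit S m a) (with_bit T m b) * F (matrix_unit a b) $ (m \<in> S) $ (m \<in> T))"
    by (simp add: sites_def site_def)
  also have "\<dots> = (\<Sum>a\<in>UNIV. \<Sum>b\<in>UNIV. \<Sum>S'\<in>Pow {..<m}. \<Sum>T'\<in>Pow {..<m}.
     X (with_bit S m a - {..<m} \<union> S') (with_bit T m b - {..<m} \<union> T') *
     (\<Prod>k<m. ?K k S' T' (with_bit S m a) (with_bit T m b)) * F (matrix_unit a b) $ (m \<in> S) $ (m \<in> T))"
    unfolding Suc.IH sum_distrib_right ..
  also have "\<dots> = (\<Sum>a\<in>UNIV. \<Sum>b\<in>UNIV. \<Sum>S'\<in>Pow {..<m}. \<Sum>T'\<in>Pow {..<m}.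
     X (S - {..<Suc m} \<union> with_bit S' m a) (T - {..<Suc m} \<union> with_bit T' m b) *
     (\<Prod>k<Suc m. ?K k (with_bit S' m a) (with_bit T' m b) S T))"
    proof (intro sum.cong refl)
    fix a b S' T' assume "S' \<in> Pow {..<m}" "T' \<in> Pow {..<m}"
    then show "X (with_bit S m a - {..<m} \<union> S') (with_bit T m b - {..<m} \<union> T') *
       (\<Prod>k<m. ?K k S' T' (with_bit S m a) (with_bit T m b)) * F (matrix_unit a b) $ (m \<in> S) $ (m \<in> T) =
     X (S - {..<Suc m} \<union> with_bit S' m a) (T - {..<Suc m} \<union> with_bit T' m b) *
     (\<Prod>k<Suc m. ?K k (with_bit S' m a) (with_bit T' m b) S T)"
      by (simp only: set1 prod1 prod.lessThan_Suc) simp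
  qed
  also have "\<dots> = (\<Sum>S'\<in>Pow {..<m}. \<Sum>a\<in>UNIV. \<Sum>T'\<in>Pow {..<m}. \<Sum>b\<in>UNIV.
     X (S - {..<Suc m} \<union> with_bit S' m a) (T - {..<Suc m} \<union> with_bit T' m b) *
     (\<Prod>k<Suc m. ?K k (with_bit S' m a) (with_bit T' m b) S T))"
    by (simp only: sum_bool sum.distrib add.assoc)
  also have "\<dots> = (\<Sum>S'\<in>Pow {..<Suc m}. \<Sum>T'\<in>Pow {..<Suc m}.
     X (S - {..<Suc m} \<union> S') (T - {..<Suc m} \<union> T') * (\<Prod>k<Suc m. ?K k S' T' S T))"
    unfolding ins by (simp only: sum_Pow_insert lessThan_iff less_irrefl finite_lessThan not_False_eq_True)
  finally show ?case .
qed

lemma noise_eq_sites: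
  assumes "S \<subseteq> {..<n}" "T \<subseteq> {..<n}"
  shows "noise N n X S T = sites N [0..<n] X S T"
proof -
  have "S - {..<n} = {}" "T - {..<n} = {}" using assms by auto
  then show ?thesis by (simp only: noise_def sites_upt Un_empty_left)
qed

section \<open>Positive operators\<close>

definition qform :: "'i set \<Rightarrow> 'i operator \<Rightarrow> ('i \<Rightarrow> complex) \<Rightarrow> complex" where
  "qform I X v = (\<Sum>i\<in>I. \<Sum>j\<in>I. cnj (v i) * X i j * v j)"

lemma psd_on_qform: "psd_on I X \<longleftrightarrow> (\<forall>v. Im (qform I X v) = 0 \<and> 0 \<le> Re (qform I X v))"
  by (simp add: psd_on_def qform_def Let_def)

lemma psd_on_reindex:
  assumes "bij_betw g I J"
  shows "psd_on I (\<lambda>i j. X (g i) (g j)) \<longleftrightarrow> psd_on J X"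
proof -
  have "qform J X v = qform I (\<lambda>i j. X (g i) (g j)) (v \<circ> g)" for v
    by (simp add: qform_def sum.reindex_bij_betw[OF assms, symmetric])
  moreover have "qform I (\<lambda>i j. X (g i) (g j)) v = qform J X (v \<circ> inv_into I g)" for v
  proof -
    have "inv_into I g (g i) = i" if "i \<in> I" for i
      using assms that by (simp add: bij_betw_def)
    then show ?thesis by (simp add: qform_def sum.reindex_bij_betw[OF assms, symmetric])
  qed
  ultimately show ?thesis by (metis psd_on_qform)
qed

lemma psd_on_cong:
  assumes "\<And>i j. i \<in> I \<Longrightarrow> j \<in> I \<Longrightarrow> X i j = Y i j"
  shows "psd_on I X \<longleftrightarrow> psd_on I Y"
  using assms by (simp add: psd_on_qform qform_def)

lemma qform_add: "qform I (\<lambda>i j. X i j + Y i j) v = qform I X v + qform I Y v"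
  by (simp add: qform_def algebra_simps sum.distrib)

lemma qform_scale: "qform I (\<lambda>i j. a * X i j) v = a * qform I X v"
  by (simp add: qform_def sum_distrib_left mult_ac)

lemma psd_on_add: "psd_on I X \<Longrightarrow> psd_on I Y \<Longrightarrow> psd_on I (\<lambda>i j. X i j + Y i j)"
  by (simp add: psd_on_qform qform_add)

lemma psd_on_scale: "psd_on I X \<Longrightarrow> 0 \<le> a \<Longrightarrow> psd_on I (\<lambda>i j. of_real a * X i j)"
  by (simp add: psd_on_qform qform_scale)

lemma qform_conjugate: "qform I (conjugate_on I U X) v = qform I X (\<lambda>k. \<Sum>i\<in>I. cnj (U i k) * v i)"
proof -
  have "qform I X (\<lambda>k. \<Sum>i\<in>I. cnj (U i k) * v i) =
      (\<Sum>k\<in>I. \<Sum>l\<in>I. \<Sum>i\<in>I. \<Sum>j\<in>I. cnj (v i) * (U i k * X k l * cnj (U j l)) * v j)"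
    unfolding qform_def cnj_sum sum_distrib_left sum_distrib_right
    by (rule sum.cong[OF refl], rule sum.cong[OF refl], subst sum.swap, intro sum.cong refl, simp add: mult_ac)
  also have "\<dots> = (\<Sum>i\<in>I. \<Sum>j\<in>I. \<Sum>k\<in>I. \<Sum>l\<in>I. cnj (v i) * (U i k * X k l * cnj (U j l)) * v j)"
    unfolding sum.cartesian_product
    by (rule sum.reindex_bij_witness[of _ "\<lambda>(i, j, k, l). (k, l, i, j)" "\<lambda>(k, l, i, j). (i, j, k, l)"]) auto
  also have "\<dots> = qform I (conjugate_on I U X) v"
    unfolding qform_def conjugate_on_def sum_distrib_left sum_distrib_right ..
  finally show ?thesis by simp
qed

lemma psd_on_conjugate: "psd_on I X \<Longrightarrow> psd_on I (conjugate_on I U X)"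
  by (simp add: psd_on_qform qform_conjugate)

lemma qform_pair:
  assumes "finite I" "i \<in> I" "j \<in> I" "i \<noteq> j"
  shows "qform I X (\<lambda>k. if k = i then x else if k = j then y else 0) =
    cnj x * X i i * x + cnj x * X i j * y + cnj y * X j i * x + cnj y * X j j * y"
proof -
  let ?v = "\<lambda>k. if k = i then x else if k = j then y else 0"
  have *: "(\<Sum>k\<in>I. f k) = f i + f j" if "\<And>k. k \<noteq> i \<Longrightarrow> k \<noteq> j \<Longrightarrow> f k = 0" for f :: "_ \<Rightarrow> complex"
  proof -
    have "(\<Sum>k\<in>I. f k) = (\<Sum>k\<in>{i, j}. f k)"
      using assms that by (intro sum.mono_neutral_right) auto
    then show ?thesis using assms(4) by simp
  qed
  have "qform I X ?v = (\<Sum>k\<in>I. cnj (?v k) * X k i * ?v i + cnj (?v k) * X k j * ?v j)"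
    unfolding qform_def by (intro sum.cong refl *) simp
  also have "\<dots> = (cnj (?v i) * X i i * ?v i + cnj (?v i) * X i j * ?v j) +
      (cnj (?v j) * X j i * ?v i + cnj (?v j) * X j j * ?v j)"
    by (intro *) simp
  finally show ?thesis using assms(4) by (simp add: add_ac)
qed

lemma psd_on_diag:
  assumes "psd_on I X" "finite I" "i \<in> I"
  shows "Im (X i i) = 0" "0 \<le> Re (X i i)"
proof -
  have "qform I X (\<lambda>k. if k = i then 1 else 0) = (\<Sum>k\<in>I. if k = i then X k i else 0)"
    unfolding qform_def using assms
    by (intro sum.cong refl) (simp add: if_distrib[of "\<lambda>x. _ * x"] cong: if_cong)
  then have "qform I X (\<lambda>k. if k = i then 1 else 0) = X i i" using assms by simp
  then show "Im (X i i) = 0" "0 \<le> Re (X i i)" using assms(1) by (metis psd_on_qform)+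
qed

text \<open>Nonnegativity of a principal 2 by 2 minor, obtained by testing the form on vectors
  supported at \<open>i\<close> and \<open>j\<close>.\<close>

lemma psd_on_entry_le:
  assumes "psd_on I X" "finite I" "i \<in> I" "j \<in> I"
  shows "(cmod (X i j))\<^sup>2 \<le> Re (X i i) * Re (X j j)"
proof (cases "i = j")
  case True
  then show ?thesis
    using psd_on_diag[OF assms(1-3)] by (simp add: cmod_power2) (simp add: power2_eq_square)
next
  case False
  have q: "Im (cnj x * X i i * x + cnj x * X i j * y + cnj y * X j i * x + cnj y * X j j * y) = 0"
    "0 \<le> Re (cnj x * X i i * x + cnj x * X i j * y + cnj y * X j i * x + cnj y * X j j * y)" for x y
    using assms(1) unfolding psd_on_qform qform_pair[OF assms(2-4) False, symmetric] by blast+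
  have d: "Im (X i i) = 0" "0 \<le> Re (X i i)" "Im (X j j) = 0" "0 \<le> Re (X j j)"
    using psd_on_diag[OF assms(1-3)] psd_on_diag[OF assms(1,2,4)] by auto
  \<comment> \<open>The form is real at \<open>(1, 1)\<close> and at \<open>(1, \<i>)\<close>; the
    first relates the imaginary parts of the two entries, the second their real parts.\<close>
  have herm: "X j i = cnj (X i j)"
    using q(1)[of 1 1] q(1)[of 1 \<i>] d by (simp add: complex_eq_iff)
  define p where "p = cmod (X i j)"
  have real: "0 \<le> t\<^sup>2 * Re (X i i) - 2 * t * s * p + s\<^sup>2 * Re (X j j)" for t s :: real
  proof (cases "p = 0")
    case True
    then show ?thesis using d by simp
  next
    case False
    \<comment> \<open>The phase is chosen so that \<open>X i j * y\<close> and
      \<open>cnj y * X j i\<close> both equal \<open>- (s * p)\<close>.\<close>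
    define y where "y = - (of_real (s / p) * cnj (X i j))"
    have xx: "X i j * cnj (X i j) = of_real (p\<^sup>2)"
      by (simp add: p_def complex_norm_square[symmetric])
    have "X i j * y = - (of_real (s / p) * (X i j * cnj (X i j)))"
      by (simp add: y_def)
    then have yr: "X i j * y = - of_real (s * p)"
      using False unfolding xx by (simp add: power2_eq_square)
    have yl: "cnj y * X j i = - of_real (s * p)"
    proof -
      have "cnj y * X j i = - (of_real (s / p) * (X i j * cnj (X i j)))"
        by (simp add: y_def herm)
      then show ?thesis using False unfolding xx by (simp add: power2_eq_square)
    qed
    have yy: "cnj y * y = of_real (s\<^sup>2)"
    proof -
      have "cmod y = \<bar>s\<bar>" using False by (simp add: y_def norm_mult norm_divide p_def)
      then show ?thesis by (simp add: complex_norm_square[symmetric] mult.commute flip: of_real_power)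
    qed
    have "cnj (of_real t) * X i i * of_real t + cnj (of_real t) * X i j * y +
        cnj y * X j i * of_real t + cnj y * X j j * y =
        of_real (t\<^sup>2) * X i i + of_real t * (X i j * y) + (cnj y * X j i) * of_real t + (cnj y * y) * X j j"
      by (simp add: power2_eq_square mult_ac)
    also have "\<dots> = of_real (t\<^sup>2) * X i i - of_real (2 * t * s * p) + of_real (s\<^sup>2) * X j j"
      unfolding yr yl yy by simp
    finally have "Re (cnj (of_real t) * X i i * of_real t + cnj (of_real t) * X i j * y +
        cnj y * X j i * of_real t + cnj y * X j j * y) =
        t\<^sup>2 * Re (X i i) - 2 * t * s * p + s\<^sup>2 * Re (X j j)"
      by simp
    then show ?thesis using q(2)[of "of_real t" y] by linarith
  qed
  show ?thesis
  proof (cases "Re (X i i) = 0")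
    case True
    have "p = 0"
    proof (rule ccontr)
      assume "p \<noteq> 0"
      \<comment> \<open>At this value of \<open>t\<close> the quadratic form would be -1.\<close>
      then show False using real[of "(Re (X j j) + 1) / (2 * p)" 1] True by simp
    qed
    then show ?thesis using True by (simp add: p_def)
  next
    case False
    have "0 \<le> Re (X i i) * (Re (X i i) * Re (X j j) - p\<^sup>2)"
      using real[of p "Re (X i i)"] by (simp add: power2_eq_square algebra_simps)
    then show ?thesis using False d by (simp add: zero_le_mult_iff p_def)
  qed
qed

section \<open>Traces, Hilbert-Schmidt norms and trace-norm bounds\<close>

definition otrace :: "'i set \<Rightarrow> 'i operator \<Rightarrow> complex" where
  "otrace I X = (\<Sum>i\<in>I. X i i)"

lemma psd_on_otrace_nonneg: "psd_on I X \<Longrightarrow> finite I \<Longrightarrow> 0 \<le> Re (otrace I X)"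
  by (simp add: otrace_def sum_nonneg psd_on_diag)

text \<open>The entrywise bound summed over all entries; no eigenvalues are involved.\<close>

lemma hs_norm_psd_le:
  assumes "psd_on I X" "finite I"
  shows "hs_norm_on I X \<le> Re (otrace I X)"
proof -
  have "(\<Sum>i\<in>I. \<Sum>j\<in>I. (cmod (X i j))\<^sup>2) \<le> (\<Sum>i\<in>I. \<Sum>j\<in>I. Re (X i i) * Re (X j j))"
    by (intro sum_mono psd_on_entry_le[OF assms])
  also have "\<dots> = (Re (otrace I X))\<^sup>2"
    by (simp add: otrace_def power2_eq_square sum_product)
  finally show ?thesis
    unfolding hs_norm_on_def using psd_on_otrace_nonneg[OF assms] by (intro real_le_lsqrt) auto
qed

lemma hs_norm_L2: "hs_norm_on I X = L2_set (\<lambda>(i, j). cmod (X i j)) (I \<times> I)"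
  by (simp add: hs_norm_on_def L2_set_def sum.cartesian_product case_prod_unfold)

lemma hs_norm_triangle: "hs_norm_on I (\<lambda>i j. X i j + Y i j) \<le> hs_norm_on I X + hs_norm_on I Y"
proof -
  have "hs_norm_on I (\<lambda>i j. X i j + Y i j) \<le>
      L2_set (\<lambda>z. (case z of (i, j) \<Rightarrow> cmod (X i j)) + (case z of (i, j) \<Rightarrow> cmod (Y i j))) (I \<times> I)"
    unfolding hs_norm_L2 by (intro L2_set_mono) (auto intro: norm_triangle_ineq)
  also have "\<dots> \<le> hs_norm_on I X + hs_norm_on I Y"
    unfolding hs_norm_L2 by (rule L2_set_triangle_ineq)
  finally show ?thesis .
qed

lemma hs_norm_uminus: "hs_norm_on I (\<lambda>i j. - X i j) = hs_norm_on I X"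
  by (simp add: hs_norm_on_def)

text \<open>An upper bound for the trace norm of a Hermitian operator, witnessed by a difference of
  positive operators; this avoids spectral decompositions.\<close>

definition tbound :: "'i set \<Rightarrow> real \<Rightarrow> 'i operator \<Rightarrow> bool" where
  "tbound I b X \<longleftrightarrow> (\<exists>P M. psd_on I P \<and> psd_on I M \<and> X = (\<lambda>i j. P i j - M i j) \<and>
     Re (otrace I P) + Re (otrace I M) \<le> b)"

lemma tbound_hs_norm:
  assumes "tbound I b X" "finite I"
  shows "hs_norm_on I X \<le> b"
proof -
  obtain P M where *: "psd_on I P" "psd_on I M" "X = (\<lambda>i j. P i j - M i j)"
    "Re (otrace I P) + Re (otrace I M) \<le> b"
    using assms(1) by (auto simp: tbound_def)
  have "hs_norm_on I X \<le> hs_norm_on I P + hs_norm_on I M"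
    using hs_norm_triangle[of I P "\<lambda>i j. - M i j"] by (simp add: * hs_norm_uminus)
  then show ?thesis using hs_norm_psd_le[OF *(1) assms(2)] hs_norm_psd_le[OF *(2) assms(2)] *(4) by linarith
qed

lemma psd_on_zero: "psd_on I (\<lambda>i j. 0)"
  by (simp add: psd_on_qform qform_def)

lemma tbound_psd: "psd_on I X \<Longrightarrow> tbound I (Re (otrace I X)) X"
  unfolding tbound_def by (rule exI[of _ X], rule exI[of _ "\<lambda>i j. 0"]) (simp add: psd_on_zero otrace_def)

lemma tbound_zero: "tbound I 0 (\<lambda>i j. 0)"
  using tbound_psd[OF psd_on_zero[of I]] by (simp add: otrace_def)

lemma tbound_mono: "tbound I b X \<Longrightarrow> b \<le> c \<Longrightarrow> tbound I c X"
  by (fastforce simp: tbound_def)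

lemma otrace_add: "otrace I (\<lambda>i j. X i j + Y i j) = otrace I X + otrace I Y"
  by (simp add: otrace_def sum.distrib)

lemma otrace_scale: "otrace I (\<lambda>i j. a * X i j) = a * otrace I X"
  by (simp add: otrace_def sum_distrib_left)

lemma tbound_add:
  assumes "tbound I b X" "tbound I c Y"
  shows "tbound I (b + c) (\<lambda>i j. X i j + Y i j)"
proof -
  obtain P M P' M' where *: "psd_on I P" "psd_on I M" "X = (\<lambda>i j. P i j - M i j)"
    "Re (otrace I P) + Re (otrace I M) \<le> b"
    "psd_on I P'" "psd_on I M'" "Y = (\<lambda>i j. P' i j - M' i j)"
    "Re (otrace I P') + Re (otrace I M') \<le> c"
    using assms by (auto simp: tbound_def)
  then show ?thesis unfolding tbound_def
    by - (rule exI[of _ "\<lambda>i j. P i j + P' i j"], rule exI[of _ "\<lambda>i j. M i j + M' i j"],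
      auto simp: otrace_add fun_eq_iff intro!: psd_on_add)
qed

lemma tbound_scale:
  assumes "tbound I b X"
  shows "tbound I (\<bar>a\<bar> * b) (\<lambda>i j. of_real a * X i j)"
proof -
  obtain P M where *: "psd_on I P" "psd_on I M" "X = (\<lambda>i j. P i j - M i j)"
    "Re (otrace I P) + Re (otrace I M) \<le> b"
    using assms(1) by (auto simp: tbound_def)
  let ?P = "\<lambda>i j. of_real \<bar>a\<bar> * P i j" and ?M = "\<lambda>i j. of_real \<bar>a\<bar> * M i j"
  have psd: "psd_on I ?P" "psd_on I ?M" using * by (auto intro!: psd_on_scale)
  have "\<bar>a\<bar> * (Re (otrace I P) + Re (otrace I M)) \<le> \<bar>a\<bar> * b"
    by (intro mult_left_mono *) simp
  then have tr: "Re (otrace I ?P) + Re (otrace I ?M) \<le> \<bar>a\<bar> * b"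
    by (simp add: otrace_scale distrib_left)
  show ?thesis
  proof (cases "0 \<le> a")
    case True
    then have "(\<lambda>i j. of_real a * X i j) = (\<lambda>i j. ?P i j - ?M i j)" by (simp add: * right_diff_distrib)
    then show ?thesis unfolding tbound_def using psd tr by blast
  next
    case False
    then have "(\<lambda>i j. of_real a * X i j) = (\<lambda>i j. ?M i j - ?P i j)" by (simp add: * right_diff_distrib)
    then show ?thesis unfolding tbound_def using psd tr by (intro exI[of _ ?M] exI[of _ ?P]) simp
  qed
qed

lemma tbound_sum:
  assumes "finite A" "\<And>m. m \<in> A \<Longrightarrow> tbound I (b m) (X m)"
  shows "tbound I (\<Sum>m\<in>A. b m) (\<lambda>i j. \<Sum>m\<in>A. X m i j)"
  using assms by (induction A rule: finite_induct) (simp_all add: tbound_zero tbound_add)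

text \<open>Positive trace-preserving maps contract the trace norm: they carry a pair of witnesses
  to a pair with the same traces.\<close>

lemma tbound_map:
  assumes "tbound I b X" "\<And>P. psd_on I P \<Longrightarrow> psd_on I (G P)" "\<And>P. otrace I (G P) = otrace I P"
    "\<And>P M. G (\<lambda>i j. P i j - M i j) = (\<lambda>i j. G P i j - G M i j)"
  shows "tbound I b (G X)"
proof -
  obtain P M where *: "psd_on I P" "psd_on I M" "X = (\<lambda>i j. P i j - M i j)"
    "Re (otrace I P) + Re (otrace I M) \<le> b"
    using assms(1) by (auto simp: tbound_def)
  then show ?thesis unfolding tbound_def using assms(2-)
    by (intro exI[of _ "G P"] exI[of _ "G M"]) auto
qed

text \<open>Complete positivity is defined with ancillas \<open>{..<d}\<close>. Enumerating the
  subsets of \<open>V - {k}\<close> turns the remaining qubits into such an ancilla.\<close>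

lemma psd_on_site:
  assumes "complex_linear F" "completely_positive F" "finite V" "k \<in> V" "psd_on (Pow V) P"
  shows "psd_on (Pow V) (site F k P)"
proof -
  let ?B = "V - {k}"
  define d where "d = card (Pow ?B)"
  have "finite (Pow ?B)" using assms(3) by simp
  then obtain h where h: "bij_betw h {..<d} (Pow ?B)"
    unfolding d_def by (metis atLeast0LessThan ex_bij_betw_nat_finite)
  define g where "g = (\<lambda>(i, a). with_bit (h a) k i)"
  have hk: "h a \<subseteq> ?B" if "a < d" for a using h that by (auto simp: bij_betw_def)
  have "bij_betw g (UNIV \<times> {..<d}) (Pow V)"
  proof (rule bij_betwI[of _ _ _ "\<lambda>S. (k \<in> S, inv_into {..<d} h (S - {k}))"])
    show "g \<in> UNIV \<times> {..<d} \<rightarrow> Pow V"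
    proof
      fix x :: "bool \<times> nat" assume "x \<in> UNIV \<times> {..<d}"
      then obtain i a where "x = (i, a)" "a < d" by auto
      then show "g x \<in> Pow V" using hk[of a] assms(4) by (auto simp: g_def with_bit_def)
    qed
    show "(\<lambda>S. (k \<in> S, inv_into {..<d} h (S - {k}))) \<in> Pow V \<rightarrow> UNIV \<times> {..<d}"
    proof
      fix S assume "S \<in> Pow V"
      then have "S - {k} \<in> h ` {..<d}" using h by (auto simp: bij_betw_def)
      then show "(k \<in> S, inv_into {..<d} h (S - {k})) \<in> UNIV \<times> {..<d}"
        using inv_into_into[of "S - {k}" h "{..<d}"] by simp
    qed
    show "(k \<in> g x, inv_into {..<d} h (g x - {k})) = x" if x: "x \<in> UNIV \<times> {..<d}" for x
    proof -
      obtain i a where x': "x = (i, a)" "a < d" using x by auto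
      have "g x - {k} = h a" using hk[OF x'(2)] by (auto simp: g_def x'(1) with_bit_def)
      moreover have "inv_into {..<d} h (h a) = a" using h x'(2) by (simp add: bij_betw_def)
      ultimately show ?thesis by (simp add: x'(1)) (simp add: g_def)
    qed
    show "g (k \<in> S, inv_into {..<d} h (S - {k})) = S" if "S \<in> Pow V" for S
    proof -
      have "S - {k} \<in> h ` {..<d}" using h that by (auto simp: bij_betw_def)
      then have "h (inv_into {..<d} h (S - {k})) = S - {k}" by (rule f_inv_into_f)
      then have "g (k \<in> S, inv_into {..<d} h (S - {k})) = with_bit (S - {k}) k (k \<in> S)"
        unfolding g_def split_conv by (rule arg_cong[where f = "\<lambda>s. with_bit s k (k \<in> S)"])
      also have "\<dots> = S" by (auto simp: with_bit_def)
      finally show ?thesis .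
    qed
  qed
  then have re: "psd_on (UNIV \<times> {..<d}) (\<lambda>x y. Q (g x) (g y)) \<longleftrightarrow> psd_on (Pow V) Q" for Q
    by (rule psd_on_reindex)
  have "psd_on (UNIV \<times> {..<d}) (ampliation F (\<lambda>x y. P (g x) (g y)))"
    using assms(2)[unfolded completely_positive_def, rule_format, OF iffD2[OF re assms(5)]] .
  moreover have "ampliation F (\<lambda>x y. P (g x) (g y)) = (\<lambda>x y. site F k P (g x) (g y))"
    unfolding site_slice[OF assms(1)] slice_def
  proof (intro ext)
    fix x y
    show "ampliation F (\<lambda>x y. P (g x) (g y)) x y =
        F (\<chi> a b. P (with_bit (g x) k a) (with_bit (g y) k b)) $ (k \<in> g x) $ (k \<in> g y)"
      by (cases x; cases y) (simp only: ampliation_def g_def split_conv with_bit_same mem_with_bit if_True refl)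
  qed
  ultimately have "psd_on (UNIV \<times> {..<d}) (\<lambda>x y. site F k P (g x) (g y))" by (simp only: )
  then show ?thesis by (rule iffD1[OF re])
qed

lemma otrace_site:
  assumes "complex_linear F" "\<And>M. trace (F M) = trace M" "finite V" "k \<in> V"
  shows "otrace (Pow V) (site F k P) = otrace (Pow V) P"
proof -
  have "otrace (Pow V) X = (\<Sum>S\<in>Pow (V - {k}). ptrace {k} X S S)" for X
    using sum_Pow_insert[of k "V - {k}" "\<lambda>S. X S S"] assms(3,4)
    by (simp add: otrace_def ptrace_single insert_absorb)
  then show ?thesis by (simp add: ptrace_site_same assms)
qed

lemma tbound_site:
  assumes "quantum_channel F" "finite V" "k \<in> V" "tbound (Pow V) b X"
  shows "tbound (Pow V) b (site F k X)"
  using assms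
  by (intro tbound_map[of _ _ _ "site F k"]) (auto simp: quantum_channel_def psd_on_site otrace_site site_diff)

lemma tbound_sites:
  assumes "quantum_channel F" "finite V" "set ks \<subseteq> V" "tbound (Pow V) b X"
  shows "tbound (Pow V) b (sites F ks X)"
  using assms(3,4) by (induction ks arbitrary: X) (simp_all add: sites_def tbound_site assms)

lemma sum_Times: "(\<Sum>x\<in>A \<times> B. f x) = (\<Sum>a\<in>A. \<Sum>b\<in>B. f (a, b))"
  by (simp add: sum.cartesian_product)

lemma conjugation_channel:
  assumes "unitary W"
  shows "quantum_channel (\<lambda>M. W ** M ** adj W)"
proof -
  have entry: "(W ** M ** adj W) $ i $ j = (\<Sum>c\<in>UNIV. \<Sum>e\<in>UNIV. W $ i $ c * M $ c $ e * cnj (W $ j $ e))" for M i j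
    by (simp add: matrix_matrix_mult_def adj_def sum_bool algebra_simps)
  have lin: "complex_linear (\<lambda>M. W ** M ** adj W)"
    by (simp add: complex_linear_def vec_eq_iff entry sum_bool algebra_simps)
  moreover have "completely_positive (\<lambda>M. W ** M ** adj W)"
    unfolding completely_positive_def
  proof (intro allI impI)
    fix d and X :: "(bool \<times> nat) operator"
    assume X: "psd_on (UNIV \<times> {..<d}) X"
    \<comment> \<open>\<open>W\<close> tensored with the identity on the ancilla: the ampliation of
      a conjugation is again a conjugation.\<close>
    define U :: "(bool \<times> nat) operator" where "U = (\<lambda>(i, a) (c, b). if a = b then W $ i $ c else 0)"
    have "ampliation (\<lambda>M. W ** M ** adj W) X x y = conjugate_on (UNIV \<times> {..<d}) U X x y"
      if xy: "x \<in> UNIV \<times> {..<d}" "y \<in> UNIV \<times> {..<d}" for x y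
    proof -
      obtain i a j b where x: "x = (i, a)" "a < d" and y: "y = (j, b)" "b < d" using xy by auto
      have "conjugate_on (UNIV \<times> {..<d}) U X x y = (\<Sum>c\<in>UNIV. \<Sum>a'<d. \<Sum>e\<in>UNIV. \<Sum>b'<d.
          U (i, a) (c, a') * X (c, a') (e, b') * cnj (U (j, b) (e, b')))"
        by (simp only: conjugate_on_def x y sum_Times)
      also have "\<dots> = (\<Sum>c\<in>UNIV. \<Sum>a'<d. \<Sum>e\<in>UNIV.
          U (i, a) (c, a') * X (c, a') (e, b) * cnj (W $ j $ e))"
      proof (intro sum.cong refl)
        fix c a' e
        have "(\<Sum>b'<d. U (i, a) (c, a') * X (c, a') (e, b') * cnj (U (j, b) (e, b'))) =
            (\<Sum>b'<d. if b' = b then U (i, a) (c, a') * X (c, a') (e, b') * cnj (W $ j $ e) else 0)"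
          by (rule sum.cong[OF refl]) (simp add: U_def)
        then show "(\<Sum>b'<d. U (i, a) (c, a') * X (c, a') (e, b') * cnj (U (j, b) (e, b'))) =
            U (i, a) (c, a') * X (c, a') (e, b) * cnj (W $ j $ e)"
          using y by simp
      qed
      also have "\<dots> = (\<Sum>c\<in>UNIV. \<Sum>e\<in>UNIV. W $ i $ c * X (c, a) (e, b) * cnj (W $ j $ e))"
      proof (intro sum.cong refl)
        fix c
        have "(\<Sum>a'<d. \<Sum>e\<in>UNIV. U (i, a) (c, a') * X (c, a') (e, b) * cnj (W $ j $ e)) =
            (\<Sum>a'<d. if a' = a then (\<Sum>e\<in>UNIV. W $ i $ c * X (c, a') (e, b) * cnj (W $ j $ e)) else 0)"
          by (rule sum.cong[OF refl]) (simp add: U_def)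
        then show "(\<Sum>a'<d. \<Sum>e\<in>UNIV. U (i, a) (c, a') * X (c, a') (e, b) * cnj (W $ j $ e)) =
            (\<Sum>e\<in>UNIV. W $ i $ c * X (c, a) (e, b) * cnj (W $ j $ e))"
          using x by simp
      qed
      finally show ?thesis by (simp add: ampliation_def x y entry)
    qed
    then show "psd_on (UNIV \<times> {..<d}) (ampliation (\<lambda>M. W ** M ** adj W) X)"
      using psd_on_cong psd_on_conjugate[OF X, of U] by (metis (no_types, lifting))
  qed
  moreover have "trace (W ** M ** adj W) = trace M" for M
  proof -
    have "trace (W ** M ** adj W) = trace (adj W ** (W ** M))" by (rule trace_mul_sym)
    also have "adj W ** (W ** M) = M" using assms by (simp add: matrix_mul_assoc unitary_def)
    finally show ?thesis .
  qed
  ultimately show ?thesis by (simp add: quantum_channel_def)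
qed

text \<open>Each conjugation preserves the bound, so only absolute weights count. It is applied both
  to the damped difference between \<open>N\<close> and \<open>N\<close> after \<open>dep\<close>,
  and to \<open>dep\<close> itself, whose weights sum to 1.\<close>

lemma tbound_site_mixture:
  fixes r :: nat
  assumes "\<And>M. F M = (\<Sum>m<r. w m *\<^sub>R (W m ** M ** adj (W m)))" "\<And>m. m < r \<Longrightarrow> unitary (W m)"
    and "finite V" "k \<in> V" "tbound (Pow V) b X"
  shows "tbound (Pow V) ((\<Sum>m<r. \<bar>w m\<bar>) * b) (site F k X)"
proof -
  let ?G = "\<lambda>m M. W m ** M ** adj (W m)"
  have "site F k X S T = (\<Sum>m<r. of_real (w m) * site (?G m) k X S T)" for S T
    by (simp add: site_def assms(1) sum_bool scaleR_conv_of_real[where 'a=complex] sum_distrib_left sum.distrib algebra_simps)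
  then have "site F k X = (\<lambda>S T. \<Sum>m<r. of_real (w m) * site (?G m) k X S T)" by (intro ext)
  moreover have "tbound (Pow V) (\<Sum>m<r. \<bar>w m\<bar> * b) (\<lambda>S T. \<Sum>m<r. of_real (w m) * site (?G m) k X S T)"
    using assms by (intro tbound_sum tbound_scale tbound_site conjugation_channel) auto
  ultimately show ?thesis by (simp add: sum_distrib_right)
qed

section \<open>Loss of memory under noise\<close>

definition pauli :: "nat \<Rightarrow> qubit_matrix" where
  "pauli m = (if m = 0 then mat 1 else if m = 1 then pauli_X else if m = 2 then pauli_Y else pauli_Z)"

lemma mat2_eq_iff: "(A :: qubit_matrix) = B \<longleftrightarrow>
  A $ False $ False = B $ False $ False \<and> A $ False $ True = B $ False $ True \<and>
  A $ True $ False = B $ True $ False \<and> A $ True $ True = B $ True $ True"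
  by (auto simp: vec_eq_iff all_bool_eq)

lemma mult_entry: "((A :: qubit_matrix) ** B) $ i $ j = A $ i $ False * B $ False $ j + A $ i $ True * B $ True $ j"
  by (simp add: matrix_matrix_mult_def sum_bool)

lemma adj_entry: "adj A $ i $ j = cnj (A $ j $ i)"
  by (simp add: adj_def)

lemma adj_mult: "adj (A ** B) = adj B ** adj A"
  by (simp add: mat2_eq_iff mult_entry adj_entry mult.commute)

lemma adj_adj [simp]: "adj (adj A) = A"
  by (simp add: mat2_eq_iff adj_entry)

lemma pauli_entry:
  "pauli_X $ i $ j = (if i = j then 0 else 1)"
  "pauli_Y $ i $ j = (if i = j then 0 else if i then \<i> else - \<i>)"
  "pauli_Z $ i $ j = (if i \<noteq> j then 0 else if i then - 1 else 1)"
  "(mat 1 :: qubit_matrix) $ i $ j = (if i = j then 1 else 0)"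
  by (simp_all add: pauli_X_def pauli_Y_def pauli_Z_def mat_def)

lemma adj_pauli [simp]: "adj (pauli m) = pauli m"
  by (simp add: mat2_eq_iff adj_entry pauli_def pauli_entry)

lemma unitary_pauli: "unitary (pauli m)"
  by (simp add: unitary_def) (simp add: mat2_eq_iff mult_entry pauli_def pauli_entry)

lemma unitary_mult:
  assumes "unitary A" "unitary B"
  shows "unitary (A ** B)"
proof -
  have "A ** B ** (adj B ** adj A) = A ** (B ** adj B) ** adj A"
    "adj B ** adj A ** (A ** B) = adj B ** (adj A ** A) ** B"
    by (simp_all only: matrix_mul_assoc)
  then show ?thesis using assms by (simp add: unitary_def adj_mult)
qed

lemma unitary_adj: "unitary A \<Longrightarrow> unitary (adj A)"
  by (simp add: unitary_def)

lemma sum_less_4: "(\<Sum>m<(4::nat). f m) = f 0 + f 1 + f 2 + (f 3 :: 'a :: comm_monoid_add)"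
  by (simp add: eval_nat_numeral add.assoc)

text \<open>The Pauli twirl: averaging over the four conjugations cancels every traceless
  part.\<close>

lemma dep_mixture: "dep M = (\<Sum>m<4. (1/4) *\<^sub>R (pauli m ** M ** adj (pauli m)))"
  unfolding adj_pauli
  by (simp add: sum_less_4 mat2_eq_iff mult_entry pauli_def pauli_entry dep_def trace_def sum_bool
      scaleR_conv_of_real[where 'a=complex] field_simps)

lemma trace_entry: "trace (M :: qubit_matrix) = M $ False $ False + M $ True $ True"
  by (simp add: trace_def sum_bool)

text \<open>Precomposing with \<open>dep\<close> and subtracting removes the identity component and
  with it the translation. What remains is a diagonal map on the Pauli coefficients, and such a map
  is a real combination of Pauli conjugations.\<close>

lemma channel_mixture:
  assumes lin: "complex_linear N" and coeff: "has_contraction_coeff N c" and c: "c < 1 / 48"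
  obtains w W s where "\<forall>m<4. unitary (W m)" "(\<Sum>m<(4::nat). \<bar>w m\<bar>) \<le> s" "0 \<le> s" "s < 1 / 2"
    "\<forall>M. N M - N (dep M) = (\<Sum>m<(4::nat). w m *\<^sub>R (W m ** M ** adj (W m)))"
proof -
  obtain U V N' DX DY DZ tX tY tZ where U: "unitary U" and V: "unitary V"
    and N: "\<And>\<rho>. N \<rho> = U ** N' (adj V ** \<rho> ** V) ** adj U"
    and N': "\<And>x y z. N' (bloch x y z) = bloch (DX * x + tX) (DY * y + tY) (DZ * z + tZ)"
    and ceq: "c = (tX\<^sup>2 + tY\<^sup>2 + tZ\<^sup>2 + DX\<^sup>2 + DY\<^sup>2 + DZ\<^sup>2) / 3"
    using coeff unfolding has_contraction_coeff_def by blast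
  have UU: "adj U ** U = mat 1" "adj V ** V = mat 1" "V ** adj V = mat 1"
    using U V by (simp_all add: unitary_def)
  \<comment> \<open>The normal form prescribes \<open>N'\<close> on Bloch matrices only. Solving for
    it shows that it is linear, hence known everywhere.\<close>
  have N'_eq: "N' M = adj U ** N (V ** M ** adj V) ** U" for M
  proof -
    have "adj V ** (V ** M ** adj V) ** V = (adj V ** V) ** M ** (adj V ** V)"
      by (simp only: matrix_mul_assoc)
    then have "adj V ** (V ** M ** adj V) ** V = M" by (simp add: UU)
    then have "adj U ** N (V ** M ** adj V) ** U = adj U ** (U ** N' M ** adj U) ** U"
      using N[of "V ** M ** adj V"] by simp
    also have "\<dots> = (adj U ** U) ** N' M ** (adj U ** U)" by (simp only: matrix_mul_assoc)
    finally show ?thesis by (simp add: UU)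
  qed
  define sc :: "complex \<Rightarrow> qubit_matrix \<Rightarrow> qubit_matrix" where "sc a X = (\<chi> i j. a * X $ i $ j)" for a X
  have sc_entry [simp]: "sc a X $ i $ j = a * X $ i $ j" for a X i j by (simp add: sc_def)
  have conj_lin: "A ** (X + Y) ** B = A ** X ** B + A ** Y ** B" "A ** sc a X ** B = sc a (A ** X ** B)"
    "A ** (r *\<^sub>R X) ** B = r *\<^sub>R (A ** X ** B)"
    for A B X Y :: qubit_matrix and a r
    by (simp_all add: mat2_eq_iff mult_entry algebra_simps)
  have Nlin: "N (X + Y) = N X + N Y" "N (sc a X) = sc a (N X)" for X Y a
    using lin by (auto simp: complex_linear_def sc_def)
  have N'lin: "N' (X + Y) = N' X + N' Y" "N' (sc a X) = sc a (N' X)" for X Y a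
    unfolding N'_eq conj_lin Nlin by (rule refl)+
  let ?bx = "\<lambda>M :: qubit_matrix. M $ False $ True + M $ True $ False"
  let ?by = "\<lambda>M :: qubit_matrix. \<i> * (M $ False $ True - M $ True $ False)"
  let ?bz = "\<lambda>M :: qubit_matrix. M $ False $ False - M $ True $ True"
  have bloch_entry: "bloch x y z $ i $ j = (1/2) * (mat 1 $ i $ j + of_real x * pauli_X $ i $ j +
      of_real y * pauli_Y $ i $ j + of_real z * pauli_Z $ i $ j)" for x y z i j
    by (simp add: bloch_def scaleR_conv_of_real[where 'a=complex])
  \<comment> \<open>These four Bloch matrices span all matrices: subtracting
    \<open>bloch 0 0 0\<close> from the other three leaves half the Pauli matrices.\<close>
  have form: "N' M = sc (trace M - ?bx M - ?by M - ?bz M) (N' (bloch 0 0 0)) +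
      sc (?bx M) (N' (bloch 1 0 0)) + sc (?by M) (N' (bloch 0 1 0)) + sc (?bz M) (N' (bloch 0 0 1))" for M
  proof -
    have "M = sc (trace M - ?bx M - ?by M - ?bz M) (bloch 0 0 0) +
      sc (?bx M) (bloch 1 0 0) + sc (?by M) (bloch 0 1 0) + sc (?bz M) (bloch 0 0 1)"
      by (simp add: mat2_eq_iff trace_entry bloch_entry pauli_entry field_simps)
    then have "N' M = N' (sc (trace M - ?bx M - ?by M - ?bz M) (bloch 0 0 0) +
      sc (?bx M) (bloch 1 0 0) + sc (?by M) (bloch 0 1 0) + sc (?bz M) (bloch 0 0 1))" by (rule arg_cong)
    then show ?thesis by (simp only: N'lin)
  qed
  \<comment> \<open>Conjugation by a Pauli matrix fixes that matrix and flips the sign of the other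
    two. The weights solve the resulting sign system, such as
    \<open>w 0 + w 1 - w 2 - w 3 = DX\<close>, and sum to 0 because the identity is sent to
    0.\<close>
  define w :: "nat \<Rightarrow> real" where "w m = (if m = 0 then DX + DY + DZ else if m = 1 then DX - DY - DZ
    else if m = 2 then DY - DX - DZ else DZ - DX - DY) / 4" for m
  have diff: "N' M - N' (dep M) = (\<Sum>m<4. w m *\<^sub>R (pauli m ** M ** pauli m))" for M
  proof -
    have "N' M - N' (dep M) = sc (?bx M) (N' (bloch 1 0 0) - N' (bloch 0 0 0)) +
        sc (?by M) (N' (bloch 0 1 0) - N' (bloch 0 0 0)) + sc (?bz M) (N' (bloch 0 0 1) - N' (bloch 0 0 0))"
    proof -
      have d: "?bx (dep M) = 0" "?by (dep M) = 0" "?bz (dep M) = 0" by (simp_all add: dep_def)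
      show ?thesis unfolding form[of M] form[of "dep M"] d trace_dep
        by (simp add: mat2_eq_iff algebra_simps)
    qed
    also have "\<dots> = sc (of_real DX / 2 * ?bx M) pauli_X + sc (of_real DY / 2 * ?by M) pauli_Y +
        sc (of_real DZ / 2 * ?bz M) pauli_Z"
      unfolding N' by (simp add: mat2_eq_iff bloch_entry pauli_entry field_simps)
    also have "\<dots> = (\<Sum>m<4. w m *\<^sub>R (pauli m ** M ** pauli m))"
      by (simp add: sum_less_4 w_def mat2_eq_iff mult_entry pauli_def pauli_entry
          scaleR_conv_of_real[where 'a=complex] field_simps)
    finally show ?thesis .
  qed
  define W where "W m = U ** pauli m ** adj V" for m
  have main: "N M - N (dep M) = (\<Sum>m<4. w m *\<^sub>R (W m ** M ** adj (W m)))" for M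
  proof -
    let ?M = "adj V ** M ** V"
    have "trace ?M = trace (V ** (adj V ** M))" by (rule trace_mul_sym)
    then have tr: "trace ?M = trace M" by (simp add: matrix_mul_assoc UU)
    have dM: "dep X = sc (trace X / 2) (mat 1)" for X
      by (simp add: mat2_eq_iff dep_def pauli_entry)
    have "adj V ** dep M ** V = dep ?M"
      unfolding dM tr conj_lin by (simp add: UU)
    then have "N M - N (dep M) = U ** N' ?M ** adj U - U ** N' (dep ?M) ** adj U"
      by (simp add: N)
    also have "\<dots> = U ** (N' ?M - N' (dep ?M)) ** adj U"
      by (simp add: mat2_eq_iff mult_entry algebra_simps)
    also have "\<dots> = (\<Sum>m<4. w m *\<^sub>R (U ** (pauli m ** ?M ** pauli m) ** adj U))"
      unfolding diff sum_less_4 conj_lin ..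
    also have "\<dots> = (\<Sum>m<4. w m *\<^sub>R (W m ** M ** adj (W m)))"
      by (simp only: W_def adj_mult adj_pauli adj_adj matrix_mul_assoc)
    finally show ?thesis .
  qed
  let ?s = "\<bar>DX\<bar> + \<bar>DY\<bar> + \<bar>DZ\<bar>"
  have "(\<Sum>m<(4::nat). \<bar>w m\<bar>) \<le> ?s"
  proof -
    have "\<bar>DX + DY + DZ\<bar> \<le> ?s" "\<bar>DX - DY - DZ\<bar> \<le> ?s" "\<bar>DY - DX - DZ\<bar> \<le> ?s" "\<bar>DZ - DX - DY\<bar> \<le> ?s"
      by linarith+
    then show ?thesis by (simp add: sum_less_4 w_def)
  qed
  \<comment> \<open>Cauchy-Schwarz bounds the square of \<open>?s\<close> by \<open>9 * c\<close>,
    which is below 9/48 = 3/16 and hence below 1/4.\<close>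
  moreover have "?s < 1 / 2"
  proof (rule power2_less_imp_less)
    have "(x + y + z)\<^sup>2 \<le> 3 * (x\<^sup>2 + y\<^sup>2 + z\<^sup>2)" for x y z :: real
      using sum_squares_bound[of x y] sum_squares_bound[of x z] sum_squares_bound[of y z]
      by (simp add: power2_eq_square algebra_simps)
    from this[of "\<bar>DX\<bar>" "\<bar>DY\<bar>" "\<bar>DZ\<bar>"] have "?s\<^sup>2 \<le> 3 * (DX\<^sup>2 + DY\<^sup>2 + DZ\<^sup>2)"
      by (simp only: power2_abs)
    moreover have "DX\<^sup>2 + DY\<^sup>2 + DZ\<^sup>2 \<le> 3 * c" unfolding ceq by simp
    ultimately show "?s\<^sup>2 < (1 / 2)\<^sup>2" using c by (simp add: power2_eq_square)
  qed simp
  moreover have "\<forall>m<4. unitary (W m)"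
    unfolding W_def by (simp add: U V unitary_mult unitary_adj unitary_pauli)
  ultimately show ?thesis using that[of W w ?s] main by simp
qed

lemma tbound_nonneg: "tbound I b X \<Longrightarrow> finite I \<Longrightarrow> 0 \<le> b"
  unfolding tbound_def using psd_on_otrace_nonneg[of I] by (meson add_nonneg_nonneg order_trans)

text \<open>
  \<open>spread V t X\<close>: \<open>X\<close> is a sum of operators each of which has vanishing partial trace over some
  qubit of \<open>V\<close>, with trace norms adding up to at most \<open>t\<close>.
\<close>

inductive spread :: "nat set \<Rightarrow> real \<Rightarrow> nat set operator \<Rightarrow> bool" for V where
  spread_zero: "spread V 0 (\<lambda>S T. 0)"
| spread_single: "k \<in> V \<Longrightarrow> traceless {k} X \<Longrightarrow> tbound (Pow V) b X \<Longrightarrow> spread V b X"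
| spread_add: "spread V a X \<Longrightarrow> spread V b Y \<Longrightarrow> spread V (a + b) (\<lambda>S T. X S T + Y S T)"
| spread_mono: "spread V a X \<Longrightarrow> a \<le> b \<Longrightarrow> spread V b X"

lemma spread_hs_norm:
  assumes "spread V t X" "finite V"
  shows "hs_norm_on (Pow V) X \<le> t"
  using assms(1)
proof induction
  case spread_zero
  then show ?case by (simp add: hs_norm_on_def)
next
  case (spread_single k X b)
  then show ?case using assms(2) by (intro tbound_hs_norm) auto
next
  case (spread_add a X b Y)
  then show ?case using hs_norm_triangle[of "Pow V" X Y] by linarith
qed simp

section \<open>Conjugation by layers of gates\<close>

lemma conjugate_on_add:
  "conjugate_on I U (\<lambda>i j. X i j + Y i j) = (\<lambda>i j. conjugate_on I U X i j + conjugate_on I U Y i j)"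
  by (intro ext) (simp add: conjugate_on_def algebra_simps sum.distrib)

lemma conjugate_on_diff:
  "conjugate_on I U (\<lambda>i j. X i j - Y i j) = (\<lambda>i j. conjugate_on I U X i j - conjugate_on I U Y i j)"
  by (intro ext) (simp add: conjugate_on_def algebra_simps sum_subtractf)

definition isometry_on :: "'i set \<Rightarrow> 'i operator \<Rightarrow> bool" where
  "isometry_on I U \<longleftrightarrow> (\<forall>i\<in>I. \<forall>j\<in>I. (\<Sum>k\<in>I. cnj (U k i) * U k j) = of_bool (i = j))"

lemma sum_of_bool_eq:
  assumes "finite I" "i \<in> I"
  shows "(\<Sum>j\<in>I. of_bool (i = j) * f j) = (f i :: complex)"
proof -
  have "(\<Sum>j\<in>I. of_bool (i = j) * f j) = (\<Sum>j\<in>I. if j = i then f j else 0)"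
    by (intro sum.cong) auto
  then show ?thesis using assms by simp
qed

lemma otrace_conjugate:
  assumes "finite I" "isometry_on I U"
  shows "otrace I (conjugate_on I U X) = otrace I X"
proof -
  have "otrace I (conjugate_on I U X) = (\<Sum>k\<in>I. \<Sum>l\<in>I. (\<Sum>i\<in>I. cnj (U i l) * U i k) * X k l)"
  proof -
    have "otrace I (conjugate_on I U X) = (\<Sum>k\<in>I. \<Sum>i\<in>I. \<Sum>l\<in>I. U i k * X k l * cnj (U i l))"
      unfolding otrace_def conjugate_on_def by (rule sum.swap)
    also have "\<dots> = (\<Sum>k\<in>I. \<Sum>l\<in>I. \<Sum>i\<in>I. U i k * X k l * cnj (U i l))"
      by (intro sum.cong refl sum.swap)
    also have "\<dots> = (\<Sum>k\<in>I. \<Sum>l\<in>I. (\<Sum>i\<in>I. cnj (U i l) * U i k) * X k l)"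
      unfolding sum_distrib_right by (intro sum.cong refl) (simp only: mult_ac)
    finally show ?thesis .
  qed
  also have "\<dots> = (\<Sum>k\<in>I. \<Sum>l\<in>I. of_bool (k = l) * X k l)"
    using assms(2) by (intro sum.cong refl) (auto simp: isometry_on_def)
  also have "\<dots> = otrace I X"
    using assms(1) by (simp add: otrace_def sum_of_bool_eq)
  finally show ?thesis .
qed

lemma tbound_conjugate:
  assumes "finite I" "isometry_on I U" "tbound I b X"
  shows "tbound I b (conjugate_on I U X)"
  using assms by (intro tbound_map[of _ _ _ "conjugate_on I U"])
    (auto simp: otrace_conjugate psd_on_conjugate conjugate_on_diff)

text \<open>Summing over the labels of \<open>e\<close> contracts \<open>g\<close> with its adjoint
  to the identity and leaves the partial trace of \<open>X\<close>, dressed by \<open>U'\<close>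
  only. The chain of swaps carries the sum over \<open>R\<close> inwards to the place of this
  contraction.\<close>

lemma traceless_conjugate:
  assumes V: "finite V" "e \<subseteq> V" and g: "isometry_on (Pow e) g"
    and U: "\<And>S T. U S T = g (S \<inter> e) (T \<inter> e) * U' (S - e) (T - e)"
    and X: "traceless e X"
  shows "traceless e (conjugate_on (Pow V) U X)"
proof -
  have fin: "finite e" using V by (rule rev_finite_subset)
  have "ptrace e (conjugate_on (Pow V) U X) S T = 0" for S T
  proof -
    have int: "(S - e \<union> R) \<inter> e = R" "S - e \<union> R - e = S - e" if "R \<in> Pow e" for R S using that by auto
    have int': "(Q \<union> K) \<inter> e = Q" "Q \<union> K - e = K" if "Q \<in> Pow e" "K \<in> Pow (V - e)" for Q K
      using that by auto
    let ?a = "\<lambda>K. U' (S - e) K" and ?b = "\<lambda>L. cnj (U' (T - e) L)"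
    have inner: "(\<Sum>R\<in>Pow e. g R Q * cnj (g R Q')) = of_bool (Q = Q')" if "Q \<in> Pow e" "Q' \<in> Pow e" for Q Q'
    proof -
      have "(\<Sum>R\<in>Pow e. cnj (g R Q') * g R Q) = of_bool (Q' = Q)"
        using g that by (simp add: isometry_on_def)
      then show ?thesis by (simp add: mult.commute eq_commute)
    qed
    have "ptrace e (conjugate_on (Pow V) U X) S T =
        (\<Sum>R\<in>Pow e. \<Sum>Q\<in>Pow e. \<Sum>K\<in>Pow (V - e). \<Sum>Q'\<in>Pow e. \<Sum>L\<in>Pow (V - e).
          (g R Q * ?a K) * X (Q \<union> K) (Q' \<union> L) * (cnj (g R Q') * ?b L))"
      unfolding ptrace_def conjugate_on_def sum_Pow_split[OF V]
      by (intro sum.cong refl) (simp only: U int int' complex_cnj_mult)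
    also have "\<dots> = (\<Sum>Q\<in>Pow e. \<Sum>R\<in>Pow e. \<Sum>K\<in>Pow (V - e). \<Sum>Q'\<in>Pow e. \<Sum>L\<in>Pow (V - e).
          (g R Q * ?a K) * X (Q \<union> K) (Q' \<union> L) * (cnj (g R Q') * ?b L))"
      by (rule sum.swap)
    also have "\<dots> = (\<Sum>Q\<in>Pow e. \<Sum>K\<in>Pow (V - e). \<Sum>R\<in>Pow e. \<Sum>Q'\<in>Pow e. \<Sum>L\<in>Pow (V - e).
          (g R Q * ?a K) * X (Q \<union> K) (Q' \<union> L) * (cnj (g R Q') * ?b L))"
      by (rule sum.cong[OF refl], rule sum.swap)
    also have "\<dots> = (\<Sum>Q\<in>Pow e. \<Sum>K\<in>Pow (V - e). \<Sum>Q'\<in>Pow e. \<Sum>R\<in>Pow e. \<Sum>L\<in>Pow (V - e).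
          (g R Q * ?a K) * X (Q \<union> K) (Q' \<union> L) * (cnj (g R Q') * ?b L))"
      by (rule sum.cong[OF refl], rule sum.cong[OF refl], rule sum.swap)
    also have "\<dots> = (\<Sum>Q\<in>Pow e. \<Sum>K\<in>Pow (V - e). \<Sum>Q'\<in>Pow e. \<Sum>L\<in>Pow (V - e). \<Sum>R\<in>Pow e.
          (g R Q * ?a K) * X (Q \<union> K) (Q' \<union> L) * (cnj (g R Q') * ?b L))"
      by (rule sum.cong[OF refl], rule sum.cong[OF refl], rule sum.cong[OF refl], rule sum.swap)
    also have "\<dots> = (\<Sum>Q\<in>Pow e. \<Sum>K\<in>Pow (V - e). \<Sum>Q'\<in>Pow e.
          of_bool (Q = Q') * (\<Sum>L\<in>Pow (V - e). ?a K * X (Q \<union> K) (Q' \<union> L) * ?b L))"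
    proof (intro sum.cong refl)
      fix Q K Q' assume Q: "Q \<in> Pow e" "Q' \<in> Pow e"
      have "(\<Sum>R\<in>Pow e. (g R Q * ?a K) * X (Q \<union> K) (Q' \<union> L) * (cnj (g R Q') * ?b L)) =
          of_bool (Q = Q') * (?a K * X (Q \<union> K) (Q' \<union> L) * ?b L)" for L
        unfolding inner[OF Q, symmetric] sum_distrib_right by (intro sum.cong refl) (simp only: mult_ac)
      then show "(\<Sum>L\<in>Pow (V - e). \<Sum>R\<in>Pow e. (g R Q * ?a K) * X (Q \<union> K) (Q' \<union> L) * (cnj (g R Q') * ?b L)) =
          of_bool (Q = Q') * (\<Sum>L\<in>Pow (V - e). ?a K * X (Q \<union> K) (Q' \<union> L) * ?b L)"
        by (simp only: sum_distrib_left)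
    qed
    also have "\<dots> = (\<Sum>Q\<in>Pow e. \<Sum>K\<in>Pow (V - e). \<Sum>L\<in>Pow (V - e). ?a K * X (Q \<union> K) (Q \<union> L) * ?b L)"
      using fin by - (rule sum.cong[OF refl], rule sum.cong[OF refl], simp only: sum_of_bool_eq finite_Pow_iff)
    also have "\<dots> = (\<Sum>K\<in>Pow (V - e). \<Sum>Q\<in>Pow e. \<Sum>L\<in>Pow (V - e). ?a K * X (Q \<union> K) (Q \<union> L) * ?b L)"
      by (rule sum.swap)
    also have "\<dots> = (\<Sum>K\<in>Pow (V - e). \<Sum>L\<in>Pow (V - e). \<Sum>Q\<in>Pow e. ?a K * X (Q \<union> K) (Q \<union> L) * ?b L)"
      by (rule sum.cong[OF refl], rule sum.swap)
    also have "\<dots> = (\<Sum>K\<in>Pow (V - e). \<Sum>L\<in>Pow (V - e). ?a K * ptrace e X K L * ?b L)"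
    proof (intro sum.cong refl)
      fix K L assume "K \<in> Pow (V - e)" "L \<in> Pow (V - e)"
      then have "K - e = K" "L - e = L" by auto
      then show "(\<Sum>Q\<in>Pow e. ?a K * X (Q \<union> K) (Q \<union> L) * ?b L) = ?a K * ptrace e X K L * ?b L"
        by (simp add: ptrace_def sum_distrib_left sum_distrib_right Un_commute)
    qed
    also have "\<dots> = 0" using X by (simp add: traceless_def)
    finally show ?thesis .
  qed
  then show ?thesis by (simp add: traceless_def fun_eq_iff)
qed

lemma layer_unitary_insert:
  assumes "finite M" "e \<notin> M" "\<forall>e'\<in>M. e' \<inter> e = {}"
  shows "layer_unitary (insert e M, g) S T = g e (S \<inter> e) (T \<inter> e) * layer_unitary (M, g) (S - e) (T - e)"
proof -
  have "(S - e) \<inter> e' = S \<inter> e'" if "e' \<in> M" for S e' using that assms(3) by auto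
  moreover have "S - e - \<Union>M = S - \<Union>(insert e M)" for S by auto
  ultimately show ?thesis using assms(1,2) by (simp add: layer_unitary_def)
qed

text \<open>An idle qubit carries the identity gate, which gives it the same factorised form as a
  qubit inside a gate.\<close>

lemma layer_unitary_idle:
  assumes "k \<notin> \<Union>M"
  shows "layer_unitary (M, g) S T = of_bool (S \<inter> {k} = T \<inter> {k}) * layer_unitary (M, g) (S - {k}) (T - {k})"
proof -
  have "(S - {k}) \<inter> e' = S \<inter> e'" if "e' \<in> M" for S e' using that assms by auto
  moreover have "S - \<Union>M = T - \<Union>M \<longleftrightarrow> S \<inter> {k} = T \<inter> {k} \<and> S - {k} - \<Union>M = T - {k} - \<Union>M"
    using assms by (auto simp: set_eq_iff)
  ultimately show ?thesis by (simp add: layer_unitary_def)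
qed

lemma isometry_on_layer_unitary:
  assumes "finite M" "pairwise disjnt M" "\<forall>e\<in>M. isometry_on (Pow e) (g e)" "finite V" "\<Union>M \<subseteq> V"
  shows "isometry_on (Pow V) (layer_unitary (M, g))"
  using assms
\<comment> \<open>\<open>V\<close> has to vary: once the gate on \<open>e\<close> is split off, the
  others act on \<open>V - e\<close>.\<close>
proof (induction M arbitrary: V rule: finite_induct)
  case empty
  then show ?case by (auto simp: isometry_on_def layer_unitary_def if_distrib[of cnj] if_distrib[of "\<lambda>x. x * _"] cong: if_cong)
next
  case (insert e M)
  let ?U = "layer_unitary (M, g)"
  have disj: "\<forall>e'\<in>M. e' \<inter> e = {}" using insert.prems(1) insert.hyps(2) by (auto simp: pairwise_insert disjnt_def)
  have e: "e \<subseteq> V" using insert.prems(4) by auto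
  have "isometry_on (Pow (V - e)) ?U"
    using insert.prems disj by (intro insert.IH) (auto simp: pairwise_insert)
  then have IH: "(\<Sum>K\<in>Pow (V - e). cnj (?U K (S - e)) * ?U K (T - e)) = of_bool (S - e = T - e)"
    if "S \<in> Pow V" "T \<in> Pow V" for S T
    using that by (simp only: isometry_on_def) blast
  have ge: "(\<Sum>Q\<in>Pow e. cnj (g e Q (S \<inter> e)) * g e Q (T \<inter> e)) = of_bool (S \<inter> e = T \<inter> e)" for S T
    using insert.prems(2) by (simp add: isometry_on_def)
  show ?case unfolding isometry_on_def
  proof (intro ballI)
    fix S T assume ST: "S \<in> Pow V" "T \<in> Pow V"
    have int': "(Q \<union> K) \<inter> e = Q" "Q \<union> K - e = K" if "Q \<in> Pow e" "K \<in> Pow (V - e)" for Q K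
      using that by auto
    have "(\<Sum>K\<in>Pow V. cnj (layer_unitary (insert e M, g) K S) * layer_unitary (insert e M, g) K T) =
        (\<Sum>Q\<in>Pow e. \<Sum>K\<in>Pow (V - e). (cnj (g e Q (S \<inter> e)) * g e Q (T \<inter> e)) * (cnj (?U K (S - e)) * ?U K (T - e)))"
      unfolding sum_Pow_split[OF insert.prems(3) e] layer_unitary_insert[OF insert.hyps(1,2) disj]
      by (intro sum.cong refl) (simp only: int' complex_cnj_mult mult_ac)
    also have "\<dots> = of_bool (S \<inter> e = T \<inter> e) * of_bool (S - e = T - e)"
      unfolding ge[symmetric] IH[OF ST, symmetric] sum_product ..
    also have "\<dots> = of_bool (S = T)" by auto
    finally show "(\<Sum>K\<in>Pow V. cnj (layer_unitary (insert e M, g) K S) * layer_unitary (insert e M, g) K T) = of_bool (S = T)" .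
  qed
qed

text \<open>Gates create no labels outside \<open>V\<close>. This matters because
  \<open>traceless\<close> is an equality at all label sets, also at those outside the
  system.\<close>

lemma layer_unitary_outside:
  assumes "\<Union>M \<subseteq> V" "\<not> S \<subseteq> V" "T \<subseteq> V"
  shows "layer_unitary (M, g) S T = 0"
proof -
  obtain x where "x \<in> S" "x \<notin> V" using assms(2) by auto
  then have "x \<in> S - \<Union>M" "x \<notin> T - \<Union>M" using assms by auto
  then have "S - \<Union>M \<noteq> T - \<Union>M" by metis
  then show ?thesis by (simp add: layer_unitary_def)
qed

text \<open>The interface between one qubit and many. The 2 in \<open>2 * s < 1\<close> is the
  number of qubits of a gate.\<close>

locale contracting_channel =
  fixes N :: "qubit_matrix \<Rightarrow> qubit_matrix" and w :: "nat \<Rightarrow> real" and W :: "nat \<Rightarrow> qubit_matrix" and s :: real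
  assumes channel: "quantum_channel N"
    and unitary_W: "\<And>m. m < 4 \<Longrightarrow> unitary (W m)"
    and weights: "(\<Sum>m<4. \<bar>w m\<bar>) \<le> s"
    and s: "0 \<le> s" "2 * s < 1"
    and mixture: "\<And>M. N M - N (dep M) = (\<Sum>m<4. w m *\<^sub>R (W m ** M ** adj (W m)))"
begin

lemma N_linear: "complex_linear N" and N_trace: "trace (N M) = trace M"
  using channel by (auto simp: quantum_channel_def)

lemma site_diff_dep:
  "site N k (\<lambda>S T. X S T - site dep k X S T) = site (\<lambda>M. N M - N (dep M)) k X"
proof -
  have lin: "complex_linear (\<lambda>M. N M - N (dep M))"
  proof -
    have eqs: "N (X + Y) = N X + N Y" "N (\<chi> i j. c * X $ i $ j) = (\<chi> i j. c * N X $ i $ j)"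
      "dep (X + Y) = dep X + dep Y" "dep (\<chi> i j. c * X $ i $ j) = (\<chi> i j. c * dep X $ i $ j)" for X Y c
      using N_linear dep_linear by (auto simp: complex_linear_def)
    show ?thesis
      unfolding complex_linear_def eqs by (simp add: mat2_eq_iff right_diff_distrib)
  qed
  show ?thesis
    by (intro ext) (simp add: site_diff site_slice[OF N_linear] site_slice[OF lin] slice_site[OF dep_linear])
qed

text \<open>One qubit \<open>k\<close> of \<open>e\<close> is split off at a time. The difference of
  \<open>Y\<close> and its depolarised version gains the factor \<open>s\<close> from the noise on
  \<open>k\<close> and stays traceless there; the depolarised part keeps the bound \<open>b\<close>
  and is traceless over the rest. Nothing is left at the end, because an operator traceless over the
  empty set is 0. Each qubit of \<open>e\<close> thus costs one \<open>s * b\<close>.\<close>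

lemma spread_sites:
  assumes V: "finite V" "distinct ks" "set ks = V"
  shows "distinct e \<Longrightarrow> set e \<subseteq> V \<Longrightarrow> traceless (set e) Y \<Longrightarrow> tbound (Pow V) b Y \<Longrightarrow>
    spread V (real (length e) * (s * b)) (sites N ks Y)"
proof (induction e arbitrary: Y)
  case Nil
  then have "Y = (\<lambda>S T. 0)" by (simp add: traceless_def ptrace_def)
  moreover have "sites N ks (\<lambda>S T. 0) = (\<lambda>S T. 0)"
    by (induction ks) (simp_all add: sites_def site_def)
  ultimately show ?case by (simp add: spread_zero)
next
  case (Cons k e)
  let ?D = "site dep k Y"
  let ?Z = "\<lambda>S T. Y S T - ?D S T"
  have k: "k \<in> V" "k \<in> set ks" using Cons.prems V by auto
  have "0 \<le> b" using tbound_nonneg[OF Cons.prems(4)] V by simp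
  have "sites N ks ?Z = sites N (remove1 k ks) (site (\<lambda>M. N M - N (dep M)) k Y)"
    by (simp add: sites_remove1[OF k(2), of N ?Z] site_diff_dep)
  moreover have "tbound (Pow V) (s * b) (site (\<lambda>M. N M - N (dep M)) k Y)"
  proof (rule tbound_mono)
    show "tbound (Pow V) ((\<Sum>m<4. \<bar>w m\<bar>) * b) (site (\<lambda>M. N M - N (dep M)) k Y)"
      using mixture unitary_W V(1) k(1) Cons.prems(4) by (rule tbound_site_mixture)
    show "(\<Sum>m<4. \<bar>w m\<bar>) * b \<le> s * b"
      using weights \<open>0 \<le> b\<close> by (rule mult_right_mono)
  qed
  ultimately have tb: "tbound (Pow V) (s * b) (sites N ks ?Z)"
    using tbound_sites[OF channel V(1), of "remove1 k ks"] set_remove1_subset[of k ks] V(3) by auto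
  have first: "spread V (s * b) (sites N ks ?Z)"
    by (rule spread_single[OF k(1) _ tb]) (intro traceless_sites N_linear N_trace traceless_diff_dep)
  have "spread V (real (length e) * (s * b)) (sites N ks ?D)"
  proof (rule Cons.IH)
    show "traceless (set e) ?D" using Cons.prems by (intro traceless_dep) auto
    have "tbound (Pow V) ((\<Sum>m<(4::nat). \<bar>1 / 4\<bar>) * b) ?D"
      using dep_mixture unitary_pauli V(1) k(1) Cons.prems(4) by (rule tbound_site_mixture)
    then show "tbound (Pow V) b ?D" by simp
  qed (use Cons.prems in auto)
  from spread_add[OF first this]
  have "spread V (s * b + real (length e) * (s * b)) (\<lambda>S T. sites N ks ?Z S T + sites N ks ?D S T)" .
  moreover have "(\<lambda>S T. sites N ks ?Z S T + sites N ks ?D S T) = sites N ks Y"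
    unfolding sites_add[symmetric] by simp
  ultimately show ?case by (simp add: algebra_simps)
qed

text \<open>\<open>noisy_layer\<close> with the noise written qubit by qubit; the two are only
  compared on \<open>Pow {..<n}\<close>, since \<open>noise\<close> ignores labels from
  \<open>n\<close> on while \<open>sites\<close> carries them along.\<close>

definition site_layer :: "nat \<Rightarrow> layer \<Rightarrow> nat set operator \<Rightarrow> nat set operator" where
  "site_layer n ly X = sites N [0..<n] (conjugate_on (Pow {..<n}) (layer_unitary ly) X)"

end

definition valid_layer :: "nat \<Rightarrow> layer \<Rightarrow> bool" where
  "valid_layer n ly \<longleftrightarrow> finite (fst ly) \<and> pairwise disjnt (fst ly) \<and>
     (\<forall>e\<in>fst ly. e \<subseteq> {..<n} \<and> card e = 2 \<and> isometry_on (Pow e) (snd ly e))"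

lemma valid_layerI:
  assumes "interaction_graph n \<Delta> E" "local_layer E ly"
  shows "valid_layer n ly"
proof -
  obtain M g where ly: "ly = (M, g)" by fastforce
  have M: "M \<subseteq> E" "pairwise disjnt M" "\<forall>e\<in>M. unitary_on (Pow e) (g e)"
    using assms(2) by (auto simp: local_layer_def ly)
  have E: "\<forall>e\<in>E. e \<subseteq> {..<n} \<and> card e = 2" using assms(1) by (auto simp: interaction_graph_def)
  then have "E \<subseteq> Pow {..<n}" by auto
  then have "finite M" using M(1) by (meson finite_Pow_iff finite_lessThan finite_subset)
  then show ?thesis using M E by (auto simp: valid_layer_def ly isometry_on_def unitary_on_def)
qed

lemma valid_layer_isometry: "valid_layer n (M, g) \<Longrightarrow> isometry_on (Pow {..<n}) (layer_unitary (M, g))"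
  by (intro isometry_on_layer_unitary) (auto simp: valid_layer_def)

text \<open>The light cone of one layer: the gate containing \<open>k\<close>, or \<open>k\<close>
  alone if it is idle.\<close>

lemma valid_layer_traceless:
  assumes ly: "valid_layer n ly" and k: "k < n" and X: "traceless {k} X"
  obtains e where "e \<subseteq> {..<n}" "e \<noteq> {}" "card e \<le> 2"
    "traceless e (conjugate_on (Pow {..<n}) (layer_unitary ly) X)"
proof -
  obtain M g where lyeq: "ly = (M, g)" by fastforce
  have M: "finite M" "pairwise disjnt M" "\<And>e. e \<in> M \<Longrightarrow> e \<subseteq> {..<n} \<and> card e = 2 \<and> isometry_on (Pow e) (g e)"
    using ly by (auto simp: valid_layer_def lyeq)
  show ?thesis
  proof (cases "k \<in> \<Union>M")
    case True
    then obtain e where e: "e \<in> M" "k \<in> e" by auto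
    have fe: "finite e" using M(3)[OF e(1)] by (metis finite_lessThan finite_subset)
    have "\<forall>e'\<in>M - {e}. e' \<inter> e = {}" using M(2) e by (auto simp: pairwise_def disjnt_def)
    then have fac: "layer_unitary ly S T = g e (S \<inter> e) (T \<inter> e) * layer_unitary (M - {e}, g) (S - e) (T - e)" for S T
      using layer_unitary_insert[of "M - {e}" e g S T] M(1) e by (simp add: lyeq insert_absorb)
    have "traceless e (conjugate_on (Pow {..<n}) (layer_unitary ly) X)"
      by (rule traceless_conjugate[where g = "g e" and U' = "layer_unitary (M - {e}, g)"])
        (use M(3)[OF e(1)] fac traceless_mono[OF X e(2) fe] in auto)
    then show ?thesis using that[of e] M(3)[OF e(1)] e by auto
  next
    case False
    have "isometry_on (Pow {k}) (\<lambda>S T. of_bool (S = T))"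
      by (auto simp: isometry_on_def Pow_insert)
    then have "traceless {k} (conjugate_on (Pow {..<n}) (layer_unitary ly) X)"
      unfolding lyeq
      by (intro traceless_conjugate[where g = "\<lambda>S T. of_bool (S = T)" and U' = "layer_unitary (M, g)"]
          layer_unitary_idle[OF False] X) (use k in auto)
    then show ?thesis using that[of "{k}"] k by auto
  qed
qed

context contracting_channel
begin

lemma site_layer_add: "site_layer n ly (\<lambda>S T. X S T + Y S T) = (\<lambda>S T. site_layer n ly X S T + site_layer n ly Y S T)"
  unfolding site_layer_def conjugate_on_add sites_add ..

lemma spread_site_layer_single:
  assumes "e \<subseteq> {..<n}" "tbound (Pow {..<n}) b X" "valid_layer n ly"
    and "traceless e (conjugate_on (Pow {..<n}) (layer_unitary ly) X)"
  shows "spread {..<n} (real (card e) * (s * b)) (site_layer n ly X)"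
proof -
  have fe: "finite e" using assms(1) by (rule finite_subset) simp
  have "tbound (Pow {..<n}) b (conjugate_on (Pow {..<n}) (layer_unitary ly) X)"
    using assms(2,3) by (cases ly) (auto intro!: tbound_conjugate valid_layer_isometry)
  then show ?thesis
    using spread_sites[of "{..<n}" "[0..<n]" "sorted_list_of_set e"] assms fe
    by (simp add: site_layer_def atLeast0LessThan)
qed

lemma spread_site_layer:
  assumes "spread {..<n} t X" "valid_layer n ly"
  shows "spread {..<n} (2 * s * t) (site_layer n ly X)"
  using assms(1)
proof induction
  case spread_zero
  have "site_layer n ly (\<lambda>S T. 0) = (\<lambda>S T. 0)"
  proof -
    have "sites N ks (\<lambda>S T. 0) = (\<lambda>S T. 0)" for ks
      by (induction ks) (simp_all add: sites_def site_def)
    then show ?thesis by (simp add: site_layer_def conjugate_on_def)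
  qed
  then show ?case by (simp add: spread.spread_zero)
next
  case (spread_single k X b)
  then obtain e where e: "e \<subseteq> {..<n}" "card e \<le> 2"
    "traceless e (conjugate_on (Pow {..<n}) (layer_unitary ly) X)"
    using valid_layer_traceless[OF assms(2), of k X] by auto
  have "0 \<le> b" using tbound_nonneg[OF spread_single(3)] by simp
  then have "real (card e) * (s * b) \<le> 2 * (s * b)" using e(2) s(1) by (intro mult_right_mono) auto
  then show ?case
    using spread_mono[OF spread_site_layer_single[OF e(1) spread_single(3) assms(2) e(3)]] by (simp add: mult.assoc)
next
  case (spread_add a X b Y)
  then show ?case
    using spread.spread_add by (simp add: site_layer_add distrib_left)
next
  case (spread_mono a X b)
  then show ?case using spread.spread_mono s(1) by (metis mult_left_mono mult_nonneg_nonneg zero_le_numeral)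
qed

lemma site_layer_diff: "site_layer n ly (\<lambda>S T. X S T - Y S T) = (\<lambda>S T. site_layer n ly X S T - site_layer n ly Y S T)"
proof -
  have "sites N ks (\<lambda>S T. X S T - Y S T) = (\<lambda>S T. sites N ks X S T - sites N ks Y S T)" for ks X Y
    by (induction ks arbitrary: X Y) (simp_all add: sites_def site_diff)
  then show ?thesis by (simp add: site_layer_def conjugate_on_diff)
qed

lemma fold_site_layer_diff:
  "fold (site_layer n) lys (\<lambda>S T. X S T - Y S T) = (\<lambda>S T. fold (site_layer n) lys X S T - fold (site_layer n) lys Y S T)"
  by (induction lys arbitrary: X Y) (simp_all add: site_layer_diff)

lemma spread_fold:
  assumes "spread {..<n} t X" "\<forall>ly\<in>set lys. valid_layer n ly"
  shows "spread {..<n} ((2 * s) ^ length lys * t) (fold (site_layer n) lys X)"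
  using assms
proof (induction lys arbitrary: t X)
  case (Cons ly lys)
  have "spread {..<n} (2 * s * t) (site_layer n ly X)" using Cons.prems by (intro spread_site_layer) auto
  then show ?case using Cons.IH[of "2 * s * t" "site_layer n ly X"] Cons.prems by (simp add: mult_ac)
qed simp

definition density :: "nat \<Rightarrow> nat set operator \<Rightarrow> bool" where
  "density n X \<longleftrightarrow> psd_on (Pow {..<n}) X \<and> otrace (Pow {..<n}) X = 1"

lemma density_site_layer:
  assumes "density n X" "valid_layer n ly"
  shows "density n (site_layer n ly X)"
proof -
  have "psd_on (Pow {..<n}) (sites N ks Y)" "otrace (Pow {..<n}) (sites N ks Y) = otrace (Pow {..<n}) Y"
    if "psd_on (Pow {..<n}) Y" "set ks \<subseteq> {..<n}" for ks Y
    using that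
    by (induction ks arbitrary: Y)
      (use channel in \<open>auto simp: sites_def psd_on_site otrace_site quantum_channel_def\<close>)
  then show ?thesis
    using assms by (cases ly)
      (simp add: density_def site_layer_def psd_on_conjugate otrace_conjugate valid_layer_isometry atLeast0LessThan)
qed

lemma density_fold:
  assumes "density n X" "\<forall>ly\<in>set lys. valid_layer n ly"
  shows "density n (fold (site_layer n) lys X)"
  using assms by (induction lys arbitrary: X) (simp_all add: density_site_layer)

text \<open>The first layer costs \<open>n * s * 2\<close>, where 2 bounds the trace norm of a
  difference of states, and each later layer costs \<open>2 * s\<close>; the product is
  \<open>n * (2 * s) ^ length lys\<close>.\<close>

lemma forgetting:
  assumes n: "2 \<le> n" and X: "density n X" and Y: "density n Y" and lys: "\<forall>ly\<in>set lys. valid_layer n ly"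
  shows "hs_norm_on (Pow {..<n}) (\<lambda>S T. fold (site_layer n) lys X S T - fold (site_layer n) lys Y S T)
    \<le> real n * (2 * s) ^ length lys"
proof -
  let ?D = "\<lambda>S T. X S T - Y S T"
  have tb: "tbound (Pow {..<n}) 2 ?D"
    unfolding tbound_def using X Y by (intro exI[of _ X] exI[of _ Y]) (auto simp: density_def)
  show ?thesis
  proof (cases lys)
    case Nil
    \<comment> \<open>Without layers nothing decays, and the trivial bound 2 is at most
      \<open>n\<close>.\<close>
    have "hs_norm_on (Pow {..<n}) ?D \<le> 2" by (intro tbound_hs_norm tb) simp
    then show ?thesis using n Nil by simp
  next
    case (Cons ly lys')
    have ly: "valid_layer n ly" using lys Cons by simp
    obtain M g where lyeq: "ly = (M, g)" by fastforce
    let ?C = "conjugate_on (Pow {..<n}) (layer_unitary ly) ?D"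
    have "otrace (Pow {..<n}) ?C = otrace (Pow {..<n}) ?D"
      using valid_layer_isometry[of n M g] ly by (simp add: otrace_conjugate lyeq)
    also have "\<dots> = 0" using X Y by (simp add: density_def otrace_def sum_subtractf)
    finally have tr: "otrace (Pow {..<n}) ?C = 0" .
    have "ptrace {..<n} ?C S T = 0" for S T
    proof (cases "S \<subseteq> {..<n} \<and> T \<subseteq> {..<n}")
      case True
      then have "S - {..<n} = {}" "T - {..<n} = {}" by auto
      then show ?thesis using tr by (simp only: ptrace_def otrace_def Un_empty_left)
    next
      case False
      have M: "\<Union>M \<subseteq> {..<n}" using ly by (auto simp: valid_layer_def lyeq)
      have "?C (S - {..<n} \<union> R) (T - {..<n} \<union> R) = 0" for R
        unfolding conjugate_on_def
      proof (intro sum.neutral ballI)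
        fix K L assume "K \<in> Pow {..<n}" "L \<in> Pow {..<n}"
        then have "layer_unitary ly (S - {..<n} \<union> R) K = 0 \<or> layer_unitary ly (T - {..<n} \<union> R) L = 0"
          using False layer_unitary_outside[OF M, of "S - {..<n} \<union> R" K g]
            layer_unitary_outside[OF M, of "T - {..<n} \<union> R" L g] lyeq by fastforce
        then show "layer_unitary ly (S - {..<n} \<union> R) K * ?D K L * cnj (layer_unitary ly (T - {..<n} \<union> R) L) = 0"
          by auto
      qed
      then show ?thesis by (simp add: ptrace_def)
    qed
    then have "traceless {..<n} ?C" by (simp add: traceless_def fun_eq_iff)
    then have "spread {..<n} (real (card {..<n}) * (s * 2)) (site_layer n ly ?D)"
      using tb ly by (intro spread_site_layer_single) auto
    from spread_fold[OF this, of lys'] lys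
    have "spread {..<n} ((2 * s) ^ length lys' * (real n * (s * 2))) (fold (site_layer n) lys ?D)"
      by (simp add: Cons)
    from spread_hs_norm[OF this]
    have "hs_norm_on (Pow {..<n}) (fold (site_layer n) lys ?D) \<le> real n * (2 * s) ^ length lys"
      by (simp add: Cons mult_ac)
    then show ?thesis by (simp only: fold_site_layer_diff)
  qed
qed

end

section \<open>Rank across the cut\<close>

text \<open>The factors are arbitrary and the identity is imposed at all label sets, so that
  products, conjugations and single-qubit maps are handled by plain algebra of sums.\<close>

definition cut_rank :: "nat set \<Rightarrow> nat \<Rightarrow> nat set operator \<Rightarrow> bool" where
  "cut_rank A r X \<longleftrightarrow> (\<exists>F G. \<forall>S T. X S T = (\<Sum>\<alpha><r. F \<alpha> (S \<inter> A) (T \<inter> A) * G \<alpha> (S - A) (T - A)))"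

lemma cut_rankI:
  assumes "finite J" "card J = r"
    and "\<And>S T. X S T = (\<Sum>j\<in>J. F j (S \<inter> A) (T \<inter> A) * G j (S - A) (T - A))"
  shows "cut_rank A r X"
proof -
  obtain h where h: "bij_betw h {..<r} J"
    using ex_bij_betw_nat_finite[OF assms(1)] assms(2) by (auto simp: atLeast0LessThan)
  have "X S T = (\<Sum>\<alpha><r. F (h \<alpha>) (S \<inter> A) (T \<inter> A) * G (h \<alpha>) (S - A) (T - A))" for S T
    unfolding assms(3) by (rule sum.reindex_bij_betw[OF h, symmetric])
  then show ?thesis unfolding cut_rank_def
    by (intro exI[of _ "\<lambda>\<alpha>. F (h \<alpha>)"] exI[of _ "\<lambda>\<alpha>. G (h \<alpha>)"]) blast
qed

lemma cut_rank_mono: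
  assumes "cut_rank A r X" "r \<le> r'"
  shows "cut_rank A r' X"
proof -
  obtain F G where X: "\<And>S T. X S T = (\<Sum>\<alpha><r. F \<alpha> (S \<inter> A) (T \<inter> A) * G \<alpha> (S - A) (T - A))"
    using assms(1) unfolding cut_rank_def by blast
  show ?thesis
  proof (rule cut_rankI[where J = "{..<r'}" and F = "\<lambda>\<alpha> S T. if \<alpha> < r then F \<alpha> S T else 0" and G = G])
    fix S T
    show "X S T = (\<Sum>\<alpha><r'. (if \<alpha> < r then F \<alpha> (S \<inter> A) (T \<inter> A) else 0) * G \<alpha> (S - A) (T - A))"
      unfolding X using assms(2) by (intro sum.mono_neutral_cong_left) auto
  qed auto
qed

lemma cut_rank_left: "cut_rank A 1 (\<lambda>S T. f (S \<inter> A) (T \<inter> A))"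
  by (rule cut_rankI[where J = "{0::nat}" and F = "\<lambda>_. f" and G = "\<lambda>_ _ _. 1"]) auto

lemma cut_rank_right: "cut_rank A 1 (\<lambda>S T. f (S - A) (T - A))"
  by (rule cut_rankI[where J = "{0::nat}" and F = "\<lambda>_ _ _. 1" and G = "\<lambda>_. f"]) auto

lemma cut_rank_times:
  assumes "cut_rank A r X" "cut_rank A q Y"
  shows "cut_rank A (r * q) (\<lambda>S T. X S T * Y S T)"
proof -
  obtain F G where X: "\<And>S T. X S T = (\<Sum>\<alpha><r. F \<alpha> (S \<inter> A) (T \<inter> A) * G \<alpha> (S - A) (T - A))"
    using assms(1) unfolding cut_rank_def by blast
  obtain F' G' where Y: "\<And>S T. Y S T = (\<Sum>\<alpha><q. F' \<alpha> (S \<inter> A) (T \<inter> A) * G' \<alpha> (S - A) (T - A))"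
    using assms(2) unfolding cut_rank_def by blast
  show ?thesis
  proof (rule cut_rankI[where J = "{..<r} \<times> {..<q}" and F = "\<lambda>z S T. F (fst z) S T * F' (snd z) S T"
        and G = "\<lambda>z S T. G (fst z) S T * G' (snd z) S T"])
    fix S T
    show "X S T * Y S T = (\<Sum>z\<in>{..<r} \<times> {..<q}. (F (fst z) (S \<inter> A) (T \<inter> A) * F' (snd z) (S \<inter> A) (T \<inter> A)) *
        (G (fst z) (S - A) (T - A) * G' (snd z) (S - A) (T - A)))"
      unfolding X Y sum_product sum_Times fst_conv snd_conv
      by (intro sum.cong refl) (simp only: mult_ac)
  qed auto
qed

lemma cut_rank_prod:
  assumes "finite M" "\<And>e. e \<in> M \<Longrightarrow> cut_rank A (r e) (f e)"
  shows "cut_rank A (\<Prod>e\<in>M. r e) (\<lambda>S T. \<Prod>e\<in>M. f e S T)"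
  using assms
proof (induction M rule: finite_induct)
  case empty
  then show ?case using cut_rank_left[of A "\<lambda>S T. 1"] by simp
next
  case (insert e M)
  then show ?case using cut_rank_times[of A "r e" "f e"] by simp
qed

text \<open>A crossing gate has exactly one qubit in \<open>A\<close>. The four terms are the pairs
  of row and column values of its bit, each selecting one block of the gate for the other
  side.\<close>

lemma cut_rank_gate:
  assumes "card e = 2"
  shows "cut_rank A (if crosses A e then 4 else 1) (\<lambda>S T. g (S \<inter> e) (T \<inter> e))"
proof (cases "crosses A e")
  case False
  then consider "e \<inter> A = {}" | "e \<subseteq> A" by (auto simp: crosses_def)
  then show ?thesis
  proof cases
    case 1
    then have "S \<inter> e = (S - A) \<inter> e" for S by auto
    then show ?thesis using cut_rank_right[of A "\<lambda>S T. g (S \<inter> e) (T \<inter> e)"] False by simp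
  next
    case 2
    then have "S \<inter> e = (S \<inter> A) \<inter> e" for S by auto
    then show ?thesis using cut_rank_left[of A "\<lambda>S T. g (S \<inter> e) (T \<inter> e)"] False by simp
  qed
next
  case True
  obtain a b where e: "e = {a, b}" "a \<noteq> b" using assms by (meson card_2_iff)
  then obtain x where x: "e \<inter> A = {x}" using True by (auto simp: crosses_def)
  let ?J = "Pow {x} \<times> Pow {x}"
  have "card ?J = 4" by (simp add: card_cartesian_product card_Pow)
  moreover have "g (S \<inter> e) (T \<inter> e) = (\<Sum>z\<in>?J. of_bool (S \<inter> A \<inter> e = fst z \<and> T \<inter> A \<inter> e = snd z) *
      g (fst z \<union> (S - A) \<inter> e) (snd z \<union> (T - A) \<inter> e))" for S T
  proof -
    have in_J: "(S \<inter> A \<inter> e, T \<inter> A \<inter> e) \<in> ?J" using x by auto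
    have "(\<Sum>z\<in>?J. of_bool (S \<inter> A \<inter> e = fst z \<and> T \<inter> A \<inter> e = snd z) *
        g (fst z \<union> (S - A) \<inter> e) (snd z \<union> (T - A) \<inter> e)) =
        (\<Sum>z\<in>?J. if z = (S \<inter> A \<inter> e, T \<inter> A \<inter> e) then
          g (fst z \<union> (S - A) \<inter> e) (snd z \<union> (T - A) \<inter> e) else 0)"
      by (intro sum.cong refl) auto
    also have "\<dots> = g (S \<inter> A \<inter> e \<union> (S - A) \<inter> e) (T \<inter> A \<inter> e \<union> (T - A) \<inter> e)"
      using in_J by (subst sum.delta) simp_all
    also have "\<dots> = g (S \<inter> e) (T \<inter> e)" by (intro arg_cong2[of _ _ _ _ g]) auto
    finally show ?thesis by simp
  qed
  ultimately have "cut_rank A 4 (\<lambda>S T. g (S \<inter> e) (T \<inter> e))"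
    by (intro cut_rankI[where J = ?J and F = "\<lambda>z S T. of_bool (S \<inter> e = fst z \<and> T \<inter> e = snd z)"
        and G = "\<lambda>z S T. g (fst z \<union> S \<inter> e) (snd z \<union> T \<inter> e)"]) auto
  then show ?thesis using True by simp
qed

lemma cut_rank_layer_unitary:
  assumes "finite M" "\<forall>e\<in>M. card e = 2"
  shows "cut_rank A (4 ^ card {e\<in>M. crosses A e}) (layer_unitary (M, g))"
proof -
  let ?f = "\<lambda>S T. of_bool (S \<inter> A - \<Union>M = T \<inter> A - \<Union>M) * of_bool (S - A - \<Union>M = T - A - \<Union>M) :: complex"
  have id: "cut_rank A (1 * 1) ?f"
    by (intro cut_rank_times cut_rank_left[of A "\<lambda>S T. of_bool (S - \<Union>M = T - \<Union>M)"]
        cut_rank_right[of A "\<lambda>S T. of_bool (S - \<Union>M = T - \<Union>M)"])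
  have gates: "cut_rank A (\<Prod>e\<in>M. if crosses A e then 4 else 1) (\<lambda>S T. \<Prod>e\<in>M. g e (S \<inter> e) (T \<inter> e))"
    using assms by (intro cut_rank_prod cut_rank_gate) auto
  have "(\<Prod>e\<in>M. if crosses A e then 4 else 1) = (4::nat) ^ card {e\<in>M. crosses A e}"
    using assms(1) by (simp add: prod.If_cases Int_def)
  moreover have "layer_unitary (M, g) = (\<lambda>S T. ?f S T * (\<Prod>e\<in>M. g e (S \<inter> e) (T \<inter> e)))"
  proof (intro ext)
    fix S T
    have "S - \<Union>M = T - \<Union>M \<longleftrightarrow> S \<inter> A - \<Union>M = T \<inter> A - \<Union>M \<and> S - A - \<Union>M = T - A - \<Union>M"
      by (auto simp: set_eq_iff)
    then show "layer_unitary (M, g) S T = ?f S T * (\<Prod>e\<in>M. g e (S \<inter> e) (T \<inter> e))"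
      by (simp add: layer_unitary_def)
  qed
  ultimately show ?thesis using cut_rank_times[OF id gates] by simp
qed

lemma sum_product3:
  fixes a b c :: "'a \<Rightarrow> 'b :: comm_semiring_0"
  shows "(\<Sum>x\<in>I. a x) * (\<Sum>y\<in>J. b y) * (\<Sum>z\<in>K. c z) = (\<Sum>x\<in>I. \<Sum>y\<in>J. \<Sum>z\<in>K. a x * b y * c z)"
proof -
  have "(\<Sum>x\<in>I. a x) * (\<Sum>y\<in>J. b y) * (\<Sum>z\<in>K. c z) = (\<Sum>x\<in>I. a x) * ((\<Sum>y\<in>J. b y) * (\<Sum>z\<in>K. c z))"
    by (rule mult.assoc)
  also have "\<dots> = (\<Sum>x\<in>I. a x * (\<Sum>y\<in>J. \<Sum>z\<in>K. b y * c z))"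
    unfolding sum_product[of b J c K] by (rule sum_distrib_right)
  finally show ?thesis by (simp only: sum_distrib_left mult.assoc)
qed

text \<open>\<open>U\<close> and its adjoint contribute a factor \<open>u\<close> each; an index
  triple names a term of \<open>U\<close>, of \<open>X\<close> and of the adjoint.\<close>

lemma cut_rank_conjugate:
  assumes V: "finite V" "A \<subseteq> V" and U: "cut_rank A u U" and X: "cut_rank A r X"
  shows "cut_rank A (u * (r * u)) (conjugate_on (Pow V) U X)"
proof -
  obtain F G where U: "\<And>S T. U S T = (\<Sum>\<alpha><u. F \<alpha> (S \<inter> A) (T \<inter> A) * G \<alpha> (S - A) (T - A))"
    using U unfolding cut_rank_def by blast
  obtain F' G' where X: "\<And>S T. X S T = (\<Sum>\<alpha><r. F' \<alpha> (S \<inter> A) (T \<inter> A) * G' \<alpha> (S - A) (T - A))"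
    using X unfolding cut_rank_def by blast
  let ?J = "{..<u} \<times> ({..<r} \<times> {..<u})"
  define P where "P z S T = (\<Sum>K\<in>Pow A. \<Sum>L\<in>Pow A.
    F (fst z) S K * F' (fst (snd z)) K L * cnj (F (snd (snd z)) T L))" for z :: "nat \<times> nat \<times> nat" and S T
  define Q where "Q z S T = (\<Sum>K\<in>Pow (V - A). \<Sum>L\<in>Pow (V - A).
    G (fst z) S K * G' (fst (snd z)) K L * cnj (G (snd (snd z)) T L))" for z :: "nat \<times> nat \<times> nat" and S T
  have int: "(K \<union> K') \<inter> A = K" "K \<union> K' - A = K'" if "K \<in> Pow A" "K' \<in> Pow (V - A)" for K K'
    using that by auto
  have "conjugate_on (Pow V) U X S T = (\<Sum>z\<in>?J. P z (S \<inter> A) (T \<inter> A) * Q z (S - A) (T - A))" for S T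
  proof -
    let ?t = "\<lambda>z K K' L L'. (F (fst z) (S \<inter> A) K * F' (fst (snd z)) K L * cnj (F (snd (snd z)) (T \<inter> A) L)) *
        (G (fst z) (S - A) K' * G' (fst (snd z)) K' L' * cnj (G (snd (snd z)) (T - A) L'))"
    have "conjugate_on (Pow V) U X S T = (\<Sum>K\<in>Pow A. \<Sum>K'\<in>Pow (V - A). \<Sum>L\<in>Pow A. \<Sum>L'\<in>Pow (V - A). \<Sum>z\<in>?J. ?t z K K' L L')"
      unfolding conjugate_on_def sum_Pow_split[OF V]
    proof (intro sum.cong refl)
      fix K K' L L' assume K: "K \<in> Pow A" "K' \<in> Pow (V - A)" "L \<in> Pow A" "L' \<in> Pow (V - A)"
      have "U S (K \<union> K') * X (K \<union> K') (L \<union> L') * cnj (U T (L \<union> L')) =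
        (\<Sum>\<alpha><u. F \<alpha> (S \<inter> A) K * G \<alpha> (S - A) K') * (\<Sum>\<beta><r. F' \<beta> K L * G' \<beta> K' L') *
          (\<Sum>\<gamma><u. cnj (F \<gamma> (T \<inter> A) L) * cnj (G \<gamma> (T - A) L'))"
        by (simp only: U X int[OF K(1,2)] int[OF K(3,4)] cnj_sum complex_cnj_mult)
      also have "\<dots> = (\<Sum>\<alpha><u. \<Sum>\<beta><r. \<Sum>\<gamma><u. ?t (\<alpha>, \<beta>, \<gamma>) K K' L L')"
        unfolding sum_product3 fst_conv snd_conv
        by (intro sum.cong refl) (simp only: mult_ac)
      finally show "U S (K \<union> K') * X (K \<union> K') (L \<union> L') * cnj (U T (L \<union> L')) = (\<Sum>z\<in>?J. ?t z K K' L L')"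
        unfolding sum_Times .
    qed
    also have "\<dots> = (\<Sum>K\<in>Pow A. \<Sum>K'\<in>Pow (V - A). \<Sum>L\<in>Pow A. \<Sum>z\<in>?J. \<Sum>L'\<in>Pow (V - A). ?t z K K' L L')"
      by (rule sum.cong[OF refl], rule sum.cong[OF refl], rule sum.cong[OF refl], rule sum.swap)
    also have "\<dots> = (\<Sum>K\<in>Pow A. \<Sum>K'\<in>Pow (V - A). \<Sum>z\<in>?J. \<Sum>L\<in>Pow A. \<Sum>L'\<in>Pow (V - A). ?t z K K' L L')"
      by (rule sum.cong[OF refl], rule sum.cong[OF refl], rule sum.swap)
    also have "\<dots> = (\<Sum>K\<in>Pow A. \<Sum>z\<in>?J. \<Sum>K'\<in>Pow (V - A). \<Sum>L\<in>Pow A. \<Sum>L'\<in>Pow (V - A). ?t z K K' L L')"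
      by (rule sum.cong[OF refl], rule sum.swap)
    also have "\<dots> = (\<Sum>z\<in>?J. \<Sum>K\<in>Pow A. \<Sum>K'\<in>Pow (V - A). \<Sum>L\<in>Pow A. \<Sum>L'\<in>Pow (V - A). ?t z K K' L L')"
      by (rule sum.swap)
    also have "\<dots> = (\<Sum>z\<in>?J. P z (S \<inter> A) (T \<inter> A) * Q z (S - A) (T - A))"
      unfolding P_def Q_def sum_product ..
    finally show ?thesis .
  qed
  then show ?thesis by (intro cut_rankI[where J = ?J and F = P and G = Q]) (auto simp: card_cartesian_product)
qed

text \<open>A map on one qubit changes the factors of one side only, so the number of terms is
  kept.\<close>

lemma cut_rank_site:
  assumes "cut_rank A r X"
  shows "cut_rank A r (site N k X)"
proof -
  obtain F G where X: "\<And>S T. X S T = (\<Sum>\<alpha><r. F \<alpha> (S \<inter> A) (T \<inter> A) * G \<alpha> (S - A) (T - A))"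
    using assms unfolding cut_rank_def by blast
  have swap: "(\<Sum>a\<in>UNIV. \<Sum>b\<in>UNIV. (\<Sum>\<alpha><r. f \<alpha> a b)) = (\<Sum>\<alpha><r. \<Sum>a\<in>UNIV. \<Sum>b\<in>UNIV. f \<alpha> a b)"
    for f :: "nat \<Rightarrow> bool \<Rightarrow> bool \<Rightarrow> complex"
    by (simp add: sum_bool sum.distrib)
  show ?thesis
  proof (cases "k \<in> A")
    case True
    then have "with_bit S k a \<inter> A = with_bit (S \<inter> A) k a" "with_bit S k a - A = S - A"
      "k \<in> S \<inter> A \<longleftrightarrow> k \<in> S" for S a
      by (auto simp: with_bit_def)
    then have "site N k X S T = (\<Sum>\<alpha><r. site N k (F \<alpha>) (S \<inter> A) (T \<inter> A) * G \<alpha> (S - A) (T - A))" for S T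
      unfolding site_def X sum_distrib_right swap by (simp only: mult_ac)
    then show ?thesis by (intro cut_rankI[where J = "{..<r}" and F = "\<lambda>\<alpha>. site N k (F \<alpha>)" and G = G]) auto
  next
    case False
    then have "with_bit S k a \<inter> A = S \<inter> A" "with_bit S k a - A = with_bit (S - A) k a"
      "k \<in> S - A \<longleftrightarrow> k \<in> S" for S a
      by (auto simp: with_bit_def)
    then have "site N k X S T = (\<Sum>\<alpha><r. F \<alpha> (S \<inter> A) (T \<inter> A) * site N k (G \<alpha>) (S - A) (T - A))" for S T
      unfolding site_def X sum_distrib_left sum_distrib_right swap by (simp only: mult_ac)
    then show ?thesis by (intro cut_rankI[where J = "{..<r}" and F = F and G = "\<lambda>\<alpha>. site N k (G \<alpha>)"]) auto
  qed
qed

lemma cut_rank_sites: "cut_rank A r X \<Longrightarrow> cut_rank A r (sites N ks X)"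
  by (induction ks arbitrary: X) (simp_all add: sites_def cut_rank_site)

lemma cut_rank_initial_state: "cut_rank A 1 initial_state"
proof (rule cut_rankI[where J = "{0::nat}" and F = "\<lambda>_ S T. of_bool (S = {} \<and> T = {})"
      and G = "\<lambda>_ S T. of_bool (S = {} \<and> T = {})"])
  fix S T :: "nat set"
  have "S = {} \<longleftrightarrow> S \<inter> A = {} \<and> S - A = {}" for S by auto
  from this[of S] this[of T]
  show "initial_state S T = (\<Sum>j\<in>{0::nat}. of_bool (S \<inter> A = {} \<and> T \<inter> A = {}) * of_bool (S - A = {} \<and> T - A = {}))"
    unfolding initial_state_def by auto
qed auto

context contracting_channel
begin

lemma cut_rank_site_layer:
  assumes "valid_layer n ly" "A \<subseteq> {..<n}" "card {e\<in>fst ly. crosses A e} \<le> k" "cut_rank A r X"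
  shows "cut_rank A (16 ^ k * r) (site_layer n ly X)"
proof -
  obtain M g where ly: "ly = (M, g)" by fastforce
  have "cut_rank A (4 ^ k) (layer_unitary ly)"
    using assms(1,3) unfolding ly
    by (intro cut_rank_mono[OF cut_rank_layer_unitary]) (auto simp: valid_layer_def power_increasing)
  from cut_rank_conjugate[OF _ assms(2) this assms(4)]
  have "cut_rank A (4 ^ k * (r * 4 ^ k)) (site_layer n ly X)"
    by (simp add: site_layer_def cut_rank_sites)
  moreover have "(16::nat) ^ k = 4 ^ k * 4 ^ k" by (simp flip: power_mult_distrib)
  ultimately show ?thesis by (simp add: mult_ac)
qed

lemma cut_rank_fold:
  assumes "\<forall>ly\<in>set lys. valid_layer n ly \<and> card {e\<in>fst ly. crosses A e} \<le> k" "A \<subseteq> {..<n}" "cut_rank A r X"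
  shows "cut_rank A (16 ^ (k * length lys) * r) (fold (site_layer n) lys X)"
  using assms
proof (induction lys arbitrary: r X)
  case (Cons ly lys)
  have "cut_rank A (16 ^ k * r) (site_layer n ly X)" using Cons.prems by (intro cut_rank_site_layer) auto
  then have "cut_rank A (16 ^ (k * length lys) * (16 ^ k * r)) (fold (site_layer n) lys (site_layer n ly X))"
    using Cons.prems by (intro Cons.IH) auto
  then show ?case by (simp add: power_add mult_ac)
qed simp

lemma density_initial_state: "density n initial_state"
proof -
  have "qform (Pow {..<n}) initial_state v = cnj (v {}) * v {}" for v
  proof -
    have "qform (Pow {..<n}) initial_state v = (\<Sum>S\<in>Pow {..<n}. \<Sum>T\<in>Pow {..<n}.
        if T = {} then (if S = {} then cnj (v S) * v T else 0) else 0)"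
      unfolding qform_def initial_state_def by (intro sum.cong refl) auto
    then show ?thesis by simp
  qed
  then have "psd_on (Pow {..<n}) initial_state"
    by (simp add: psd_on_qform complex_norm_square[symmetric] mult.commute[of "cnj _"] flip: of_real_power)
  moreover have "otrace (Pow {..<n}) initial_state = (\<Sum>S\<in>Pow {..<n}. if S = {} then 1 else 0)"
    unfolding otrace_def initial_state_def by (intro sum.cong refl) auto
  ultimately show ?thesis by (simp add: density_def)
qed

lemma low_rank_approximation:
  assumes n: "2 \<le> n" and A: "A \<subseteq> {..<n}"
    and lys: "\<forall>ly\<in>set lys. valid_layer n ly \<and> card {e\<in>fst ly. crosses A e} \<le> k"
  obtains \<sigma> where "cut_rank A (16 ^ (k * l)) \<sigma>"
    "hs_norm_on (Pow {..<n}) (\<lambda>S T. fold (site_layer n) lys initial_state S T - \<sigma> S T) \<le> real n * (2 * s) ^ l"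
proof (cases "length lys \<le> l")
  case True
  \<comment> \<open>A circuit of depth at most \<open>l\<close> needs no approximation: its output
    already has the required rank.\<close>
  have "cut_rank A (16 ^ (k * length lys) * 1) (fold (site_layer n) lys initial_state)"
    by (intro cut_rank_fold lys A cut_rank_initial_state)
  then have "cut_rank A (16 ^ (k * l)) (fold (site_layer n) lys initial_state)"
    by (rule cut_rank_mono) (simp add: True power_increasing)
  moreover have "hs_norm_on (Pow {..<n}) (\<lambda>S T. fold (site_layer n) lys initial_state S T -
      fold (site_layer n) lys initial_state S T) \<le> real n * (2 * s) ^ l"
    using s by (simp add: hs_norm_on_def)
  ultimately show ?thesis using that by blast
next
  case False
  define xs where "xs = take (length lys - l) lys"
  define ys where "ys = drop (length lys - l) lys"
  have split: "lys = xs @ ys" "length ys = l" using False by (simp_all add: xs_def ys_def)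
  have valid: "\<forall>ly\<in>set xs. valid_layer n ly" "\<forall>ly\<in>set ys. valid_layer n ly" using lys split by auto
  have "cut_rank A (16 ^ (k * length ys) * 1) (fold (site_layer n) ys initial_state)"
    using lys split(1) by (intro cut_rank_fold A cut_rank_initial_state) auto
  \<comment> \<open>The two runs differ only in what enters the last \<open>l\<close> layers. Both
    inputs are density matrices, so the bound does not see how long \<open>xs\<close> is; this gives
    uniformity in the depth.\<close>
  moreover have "hs_norm_on (Pow {..<n}) (\<lambda>S T. fold (site_layer n) ys (fold (site_layer n) xs initial_state) S T -
      fold (site_layer n) ys initial_state S T) \<le> real n * (2 * s) ^ length ys"
    by (intro forgetting n valid density_fold density_initial_state)
  ultimately show ?thesis using that split by simp
qed

text \<open>Conjugation reads only entries on \<open>Pow {..<n}\<close>, so agreement there passes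
  from layer to layer although the operators may differ elsewhere.\<close>

lemma output_state_eq:
  assumes "\<forall>ly\<in>set lys. valid_layer n ly" "S \<subseteq> {..<n}" "T \<subseteq> {..<n}"
  shows "output_state N n lys S T = fold (site_layer n) lys initial_state S T"
proof -
  have "\<forall>S\<in>Pow {..<n}. \<forall>T\<in>Pow {..<n}. fold (noisy_layer N n) lys X S T = fold (site_layer n) lys Y S T"
    if "\<forall>S\<in>Pow {..<n}. \<forall>T\<in>Pow {..<n}. X S T = Y S T" for X Y
    using that
  proof (induction lys arbitrary: X Y)
    case (Cons ly lys)
    have "conjugate_on (Pow {..<n}) (layer_unitary ly) X = conjugate_on (Pow {..<n}) (layer_unitary ly) Y"
      using Cons.prems by (intro ext) (simp add: conjugate_on_def)
    then have "\<forall>S\<in>Pow {..<n}. \<forall>T\<in>Pow {..<n}. noisy_layer N n ly X S T = site_layer n ly Y S T"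
      by (simp add: noisy_layer_def site_layer_def noise_eq_sites)
    from Cons.IH[OF this] show ?case by simp
  qed simp
  then show ?thesis using assms by (simp add: output_state_def)
qed

end

section \<open>Operator Schmidt decompositions\<close>

lemma hs_inner_ip: "hs_inner_on I X Y = ip (I \<times> I) (case_prod X) (case_prod Y)"
  by (simp add: hs_inner_on_def ip_def sum_Times)

lemma orthonormal_on_family:
  "orthonormal_on I r F \<longleftrightarrow> orthonormal_family (I \<times> I) r (\<lambda>\<alpha>. case_prod (F \<alpha>))"
  by (simp add: orthonormal_on_def orthonormal_family_def hs_inner_ip)

lemma Un_split:
  assumes "S' \<subseteq> A" "S'' \<subseteq> V - A"
  shows "(S' \<union> S'') \<inter> A = S'" "S' \<union> S'' - A = S''"
  using assms by auto

text \<open>Regrouping: pairs of labels inside \<open>A\<close> index rows and pairs outside index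
  columns, and a singular value decomposition of this matrix is a Schmidt decomposition. It makes
  the choice by \<open>SOME\<close> a genuine one.\<close>

lemma operator_schmidt_exists:
  assumes "finite V" "A \<subseteq> V"
  shows "is_operator_schmidt V A \<rho> (operator_schmidt V A \<rho>)"
proof -
  let ?I = "Pow A \<times> Pow A" and ?J = "Pow (V - A) \<times> Pow (V - A)"
  have "finite A" using assms finite_subset by blast
  then have fin: "finite ?I" "finite ?J" using assms by auto
  obtain r lam u v where *: "orthonormal_family ?I r u" "orthonormal_family ?J r v"
    "\<forall>\<alpha><r. 0 < lam \<alpha>" "\<forall>\<alpha> \<beta>. \<alpha> \<le> \<beta> \<and> \<beta> < r \<longrightarrow> (lam \<beta> :: real) \<le> lam \<alpha>"
    "\<forall>i\<in>?I. \<forall>j\<in>?J. \<rho> (fst i \<union> fst j) (snd i \<union> snd j) = (\<Sum>\<alpha><r. of_real (lam \<alpha>) * u \<alpha> i * v \<alpha> j)"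
    by (rule singular_value_decomposition[OF fin, of "\<lambda>i j. \<rho> (fst i \<union> fst j) (snd i \<union> snd j)"])
  have "\<rho> S T = (\<Sum>\<alpha><r. of_real (lam \<alpha>) * u \<alpha> (S \<inter> A, T \<inter> A) * v \<alpha> (S - A, T - A))"
    if "S \<in> Pow V" "T \<in> Pow V" for S T
  proof -
    have "(S \<inter> A, T \<inter> A) \<in> ?I" "(S - A, T - A) \<in> ?J" using that by auto
    from *(5)[rule_format, OF this] show ?thesis by (simp add: Int_Diff_Un)
  qed
  then have "is_operator_schmidt V A \<rho> (r, lam, \<lambda>\<alpha> S T. u \<alpha> (S, T), \<lambda>\<alpha> S T. v \<alpha> (S, T))"
    using *(1-4) by (simp add: is_operator_schmidt_def orthonormal_on_family)
  then show ?thesis unfolding operator_schmidt_def by (rule someI)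
qed

lemma hs_norm_split:
  assumes "finite V" "A \<subseteq> V"
  shows "(hs_norm_on (Pow V) X)\<^sup>2 = (\<Sum>i\<in>Pow A \<times> Pow A. \<Sum>j\<in>Pow (V - A) \<times> Pow (V - A).
    (cmod (X (fst i \<union> fst j) (snd i \<union> snd j)))\<^sup>2)"
proof -
  have "(hs_norm_on (Pow V) X)\<^sup>2 = (\<Sum>S\<in>Pow V. \<Sum>T\<in>Pow V. (cmod (X S T))\<^sup>2)"
    by (simp add: hs_norm_on_def sum_nonneg)
  also have "\<dots> = (\<Sum>S\<in>Pow A. \<Sum>S'\<in>Pow (V - A). \<Sum>T\<in>Pow A. \<Sum>T'\<in>Pow (V - A). (cmod (X (S \<union> S') (T \<union> T')))\<^sup>2)"
    unfolding sum_Pow_split[OF assms] ..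
  also have "\<dots> = (\<Sum>S\<in>Pow A. \<Sum>T\<in>Pow A. \<Sum>S'\<in>Pow (V - A). \<Sum>T'\<in>Pow (V - A). (cmod (X (S \<union> S') (T \<union> T')))\<^sup>2)"
    by (rule sum.cong[OF refl], rule sum.swap)
  finally show ?thesis unfolding sum_Times fst_conv snd_conv .
qed

lemma schmidt_tail_le:
  assumes V: "finite V" "A \<subseteq> V" and D: "is_operator_schmidt V A \<rho> (r, lam, L, R)" and K: "cut_rank A m \<sigma>"
  shows "(\<Sum>\<alpha>\<in>{m..<r}. (lam \<alpha>)\<^sup>2) \<le> (hs_norm_on (Pow V) (\<lambda>S T. \<rho> S T - \<sigma> S T))\<^sup>2"
proof -
  let ?I = "Pow A \<times> Pow A" and ?J = "Pow (V - A) \<times> Pow (V - A)"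
  obtain F G where \<sigma>: "\<And>S T. \<sigma> S T = (\<Sum>\<alpha><m. F \<alpha> (S \<inter> A) (T \<inter> A) * G \<alpha> (S - A) (T - A))"
    using K unfolding cut_rank_def by blast
  have \<rho>: "\<And>S T. S \<in> Pow V \<Longrightarrow> T \<in> Pow V \<Longrightarrow>
      \<rho> S T = (\<Sum>\<alpha><r. of_real (lam \<alpha>) * L \<alpha> (S \<inter> A) (T \<inter> A) * R \<alpha> (S - A) (T - A))"
    using D by (simp add: is_operator_schmidt_def)
  have A: "finite A" using V finite_subset by blast
  show ?thesis unfolding hs_norm_split[OF V]
  proof (rule singular_tail_le)
    show "orthonormal_family ?I r (\<lambda>\<alpha>. case_prod (L \<alpha>))" "orthonormal_family ?J r (\<lambda>\<alpha>. case_prod (R \<alpha>))"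
      using D by (simp_all add: is_operator_schmidt_def orthonormal_on_family)
    fix i j assume "i \<in> ?I" "j \<in> ?J"
    then obtain S T S' T' where ij: "i = (S, T)" "j = (S', T')" "S \<subseteq> A" "T \<subseteq> A" "S' \<subseteq> V - A" "T' \<subseteq> V - A"
      by auto
    then have "S \<union> S' \<in> Pow V" "T \<union> T' \<in> Pow V" using V by auto
    from \<rho>[OF this] show "\<rho> (fst i \<union> fst j) (snd i \<union> snd j) =
        (\<Sum>\<alpha><r. of_real (lam \<alpha>) * case_prod (L \<alpha>) i * case_prod (R \<alpha>) j)"
      by (simp add: ij(1,2) Un_split[OF ij(3,5)] Un_split[OF ij(4,6)])
    show "\<sigma> (fst i \<union> fst j) (snd i \<union> snd j) = (\<Sum>\<beta><m. case_prod (F \<beta>) i * case_prod (G \<beta>) j)"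
      by (simp add: \<sigma> ij(1,2) Un_split[OF ij(3,5)] Un_split[OF ij(4,6)])
  qed (use V A D in \<open>auto simp: is_operator_schmidt_def\<close>)
qed

text \<open>The discarded terms are products of orthonormal factors, so Parseval applies. Together
  with \<open>schmidt_tail_le\<close> this makes the truncation a best approximation of rank
  \<open>m\<close>.\<close>

lemma schmidt_truncation_error:
  assumes V: "finite V" "A \<subseteq> V" and D: "is_operator_schmidt V A \<rho> (r, lam, L, R)"
  shows "(hs_norm_on (Pow V) (\<lambda>S T. \<rho> S T -
      (\<Sum>\<alpha><min m r. of_real (lam \<alpha>) * L \<alpha> (S \<inter> A) (T \<inter> A) * R \<alpha> (S - A) (T - A))))\<^sup>2 =
    (\<Sum>\<alpha>\<in>{m..<r}. (lam \<alpha>)\<^sup>2)"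
proof -
  let ?I = "Pow A \<times> Pow A" and ?J = "Pow (V - A) \<times> Pow (V - A)"
  define c where "c \<alpha> = (if \<alpha> < m then 0 else complex_of_real (lam \<alpha>))" for \<alpha>
  have on: "orthonormal_family ?I r (\<lambda>\<alpha>. case_prod (L \<alpha>))" "orthonormal_family ?J r (\<lambda>\<alpha>. case_prod (R \<alpha>))"
    using D by (simp_all add: is_operator_schmidt_def orthonormal_on_family)
  have \<rho>: "\<And>S T. S \<in> Pow V \<Longrightarrow> T \<in> Pow V \<Longrightarrow>
      \<rho> S T = (\<Sum>\<alpha><r. of_real (lam \<alpha>) * L \<alpha> (S \<inter> A) (T \<inter> A) * R \<alpha> (S - A) (T - A))"
    using D by (simp add: is_operator_schmidt_def)
  let ?X = "\<lambda>S T. \<rho> S T -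
      (\<Sum>\<alpha><min m r. of_real (lam \<alpha>) * L \<alpha> (S \<inter> A) (T \<inter> A) * R \<alpha> (S - A) (T - A))"
  have X: "?X S T = (\<Sum>\<alpha><r. c \<alpha> * L \<alpha> (S \<inter> A) (T \<inter> A) * R \<alpha> (S - A) (T - A))"
    if "S \<in> Pow V" "T \<in> Pow V" for S T
  proof -
    let ?f = "\<lambda>\<alpha>. of_real (lam \<alpha>) * L \<alpha> (S \<inter> A) (T \<inter> A) * R \<alpha> (S - A) (T - A)"
    have "(\<Sum>\<alpha><min m r. ?f \<alpha>) = (\<Sum>\<alpha><r. if \<alpha> < m then ?f \<alpha> else 0)"
      by (intro sum.mono_neutral_cong_left) auto
    then have "?X S T = (\<Sum>\<alpha><r. ?f \<alpha> - (if \<alpha> < m then ?f \<alpha> else 0))"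
      by (simp only: \<rho>[OF that] sum_subtractf)
    also have "\<dots> = (\<Sum>\<alpha><r. c \<alpha> * L \<alpha> (S \<inter> A) (T \<inter> A) * R \<alpha> (S - A) (T - A))"
      by (intro sum.cong refl) (simp add: c_def)
    finally show ?thesis .
  qed
  have "(hs_norm_on (Pow V) ?X)\<^sup>2 = (\<Sum>i\<in>?I. \<Sum>j\<in>?J. (cmod (\<Sum>\<alpha><r. c \<alpha> * case_prod (L \<alpha>) i * case_prod (R \<alpha>) j))\<^sup>2)"
    unfolding hs_norm_split[OF V]
  proof (intro sum.cong refl)
    fix i j assume "i \<in> ?I" "j \<in> ?J"
    then obtain S T S' T' where ij: "i = (S, T)" "j = (S', T')" "S \<subseteq> A" "T \<subseteq> A" "S' \<subseteq> V - A" "T' \<subseteq> V - A"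
      by auto
    then have "S \<union> S' \<in> Pow V" "T \<union> T' \<in> Pow V" using V by auto
    from X[OF this] show "(cmod (?X (fst i \<union> fst j) (snd i \<union> snd j)))\<^sup>2 =
        (cmod (\<Sum>\<alpha><r. c \<alpha> * case_prod (L \<alpha>) i * case_prod (R \<alpha>) j))\<^sup>2"
      by (simp add: ij(1,2) Un_split[OF ij(3,5)] Un_split[OF ij(4,6)])
  qed
  also have "\<dots> = (\<Sum>j\<in>?J. nsq ?I (\<lambda>i. \<Sum>\<alpha><r. c \<alpha> * case_prod (L \<alpha>) i * case_prod (R \<alpha>) j))"
    unfolding nsq_def by (rule sum.swap)
  also have "\<dots> = (\<Sum>\<alpha><r. (cmod (c \<alpha>))\<^sup>2)" by (rule nsq_bilinear_combination[OF on])
  also have "\<dots> = (\<Sum>\<alpha>\<in>{m..<r}. (lam \<alpha>)\<^sup>2)"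
    by (intro sum.mono_neutral_cong_right) (auto simp: c_def)
  finally show ?thesis .
qed

section \<open>Entropy and truncation rank from a low-rank approximation\<close>

lemma schmidt_count_le:
  assumes "finite V" "A \<subseteq> V" "is_operator_schmidt V A \<rho> (r, lam, L, R)"
  shows "r \<le> 4 ^ card V"
proof -
  have A: "finite A" "card A \<le> card V" using assms finite_subset card_mono by auto
  have "r \<le> card (Pow A \<times> Pow A)"
    using assms(3) A by (intro orthonormal_family_card) (auto simp: is_operator_schmidt_def orthonormal_on_family)
  also have "\<dots> = 4 ^ card A" using A by (simp add: card_cartesian_product card_Pow flip: power_mult_distrib)
  also have "\<dots> \<le> 4 ^ card V" using A by (intro power_increasing) auto
  finally show ?thesis .
qed

text \<open>The bound \<open>ln x \<le> x - 1\<close> at \<open>x = 1 / (p i * Q)\<close>, weighted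
  by \<open>p i\<close>. It is stated for weights of arbitrary total mass because it is applied to
  the head and the tail of a spectrum separately.\<close>

lemma entropy_sum_le:
  fixes p :: "'a \<Rightarrow> real"
  assumes "finite I" "\<And>i. i \<in> I \<Longrightarrow> 0 < p i" "card I \<le> Q" "1 \<le> Q"
  shows "- (\<Sum>i\<in>I. p i * ln (p i)) \<le> (\<Sum>i\<in>I. p i) * ln (real Q) + 1"
proof -
  have Q: "0 < real Q" using assms(4) by simp
  have "- (p i * ln (p i)) \<le> p i * ln (real Q) + 1 / real Q" if "i \<in> I" for i
  proof -
    have p: "0 < p i" using assms(2) that .
    have "ln (1 / (p i * real Q)) \<le> 1 / (p i * real Q) - 1"
      using p Q by (intro ln_le_minus_one) simp
    then have "p i * (- ln (p i) - ln (real Q)) \<le> p i * (1 / (p i * real Q) - 1)"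
      using p Q by (intro mult_left_mono) (simp_all add: ln_div ln_mult)
    also have "\<dots> = 1 / real Q - p i" using p Q by (simp add: field_simps)
    also have "\<dots> \<le> 1 / real Q" using p by simp
    finally show ?thesis by (simp add: algebra_simps)
  qed
  then have "(\<Sum>i\<in>I. - (p i * ln (p i))) \<le> (\<Sum>i\<in>I. p i * ln (real Q) + 1 / real Q)" by (rule sum_mono)
  also have "\<dots> = (\<Sum>i\<in>I. p i) * ln (real Q) + real (card I) / real Q"
    by (simp add: sum.distrib sum_distrib_right)
  also have "\<dots> \<le> (\<Sum>i\<in>I. p i) * ln (real Q) + 1" using assms(3) Q by simp
  finally show ?thesis by (simp add: sum_negf)
qed

text \<open>The spectrum is split at \<open>m\<close>. The head has at most \<open>m\<close> terms
  and mass at most 1. The tail has mass at most \<open>\<delta>\<close> and at most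
  \<open>4 ^ card V\<close> terms, which gives \<open>2 * \<delta> * card V\<close>. The 4 comes
  from one additive 1 for each part, in natural units, divided by
  \<open>ln 2 \<ge> 1 / 2\<close>.\<close>

lemma operator_entanglement_le:
  assumes V: "finite V" "A \<subseteq> V" and \<rho>: "psd_on (Pow V) \<rho>" "otrace (Pow V) \<rho> = 1"
    and \<sigma>: "cut_rank A m \<sigma>" "1 \<le> m"
    and d: "(hs_norm_on (Pow V) (\<lambda>S T. \<rho> S T - \<sigma> S T))\<^sup>2 \<le> \<delta>"
  shows "operator_entanglement V A \<rho> \<le> log 2 (real m) + 2 * \<delta> * real (card V) + 4"
proof -
  obtain r lam L R where D: "operator_schmidt V A \<rho> = (r, lam, L, R)" by (metis prod_cases4)
  have schmidt: "is_operator_schmidt V A \<rho> (r, lam, L, R)"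
    using operator_schmidt_exists[OF V, of \<rho>] by (simp add: D)
  let ?p = "\<lambda>\<alpha>. (lam \<alpha>)\<^sup>2"
  have pos: "0 < ?p \<alpha>" if "\<alpha> < r" for \<alpha>
  proof -
    have "0 < lam \<alpha>" using schmidt that by (simp add: is_operator_schmidt_def)
    then show ?thesis by simp
  qed
  have tail: "(\<Sum>\<alpha>\<in>{m..<r}. ?p \<alpha>) \<le> \<delta>" using schmidt_tail_le[OF V schmidt \<sigma>(1)] d by linarith
  \<comment> \<open>Against rank 0 the tail is the whole spectrum, so the total mass is bounded by
    the purity of the state.\<close>
  have "cut_rank A 0 (\<lambda>S T. 0)" by (rule cut_rankI[where J = "{} :: nat set"]) auto
  then have "(\<Sum>\<alpha>\<in>{0..<r}. ?p \<alpha>) \<le> (hs_norm_on (Pow V) \<rho>)\<^sup>2"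
    using schmidt_tail_le[OF V schmidt, of 0 "\<lambda>S T. 0"] by simp
  moreover have "hs_norm_on (Pow V) \<rho> \<le> 1" using hs_norm_psd_le[OF \<rho>(1)] V \<rho>(2) by simp
  then have "(hs_norm_on (Pow V) \<rho>)\<^sup>2 \<le> 1"
    by (intro power_le_one) (simp_all add: hs_norm_on_def sum_nonneg)
  ultimately have total: "(\<Sum>\<alpha><r. ?p \<alpha>) \<le> 1" by (simp add: atLeast0LessThan)
  have split: "(\<Sum>\<alpha><r. f \<alpha>) = (\<Sum>\<alpha><min m r. f \<alpha>) + (\<Sum>\<alpha>\<in>{m..<r}. f \<alpha>)" for f :: "nat \<Rightarrow> real"
    using sum.atLeastLessThan_concat[of 0 m r f]
    by (cases "m \<le> r") (auto simp: atLeast0LessThan min_def)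
  have head: "(\<Sum>\<alpha><min m r. ?p \<alpha>) \<le> 1"
    using total split[of ?p] sum_nonneg[of "{m..<r}" ?p] by simp
  have "- (\<Sum>\<alpha><min m r. ?p \<alpha> * ln (?p \<alpha>)) \<le> (\<Sum>\<alpha><min m r. ?p \<alpha>) * ln (real m) + 1"
    using pos \<sigma>(2) by (intro entropy_sum_le) auto
  also have "\<dots> \<le> 1 * ln (real m) + 1"
    using head \<sigma>(2) by (intro add_right_mono mult_right_mono) auto
  finally have 1: "- (\<Sum>\<alpha><min m r. ?p \<alpha> * ln (?p \<alpha>)) \<le> ln (real m) + 1" by simp
  have "- (\<Sum>\<alpha>\<in>{m..<r}. ?p \<alpha> * ln (?p \<alpha>)) \<le> (\<Sum>\<alpha>\<in>{m..<r}. ?p \<alpha>) * ln (real (4 ^ card V)) + 1"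
    using pos schmidt_count_le[OF V schmidt] by (intro entropy_sum_le) auto
  also have "\<dots> \<le> \<delta> * ln (real (4 ^ card V)) + 1"
    using tail by (intro add_right_mono mult_right_mono) auto
  also have "ln (real (4 ^ card V)) = real (card V) * (2 * ln 2)"
  proof -
    have "ln (4::real) = 2 * ln 2" using ln_realpow[of 2 2] by simp
    then show ?thesis by (simp add: ln_realpow)
  qed
  finally have 2: "- (\<Sum>\<alpha>\<in>{m..<r}. ?p \<alpha> * ln (?p \<alpha>)) \<le> 2 * \<delta> * real (card V) * ln 2 + 1"
    by (simp add: mult_ac)
  have ln2: "1 / 2 \<le> ln (2::real)" using ln_le_minus_one[of "1/2::real"] by (simp add: ln_div)
  have "operator_entanglement V A \<rho> * ln 2 = - (\<Sum>\<alpha><r. ?p \<alpha> * ln (?p \<alpha>))"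
  proof -
    have "log 2 x * ln 2 = ln x" for x :: real by (simp add: log_def)
    then show ?thesis by (simp add: operator_entanglement_def D sum_distrib_right mult.assoc)
  qed
  also have "\<dots> \<le> ln (real m) + 2 * \<delta> * real (card V) * ln 2 + 2"
    using 1 2 by (simp add: split[of "\<lambda>\<alpha>. ?p \<alpha> * ln (?p \<alpha>)"])
  also have "\<dots> \<le> (log 2 (real m) + 2 * \<delta> * real (card V) + 4) * ln 2"
    using ln2 by (simp add: log_def algebra_simps)
  finally show ?thesis by simp
qed

text \<open>By optimality of the truncation, any operator of rank \<open>m\<close> within the
  tolerance certifies that truncating after \<open>m\<close> terms meets it too.\<close>

lemma R_abs_bounds:
  assumes V: "finite V" "A \<subseteq> V" and \<sigma>: "cut_rank A m \<sigma>" "1 \<le> m"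
    and d: "(hs_norm_on (Pow V) (\<lambda>S T. \<rho> S T - \<sigma> S T))\<^sup>2 \<le> \<epsilon>"
  shows "1 \<le> R_abs \<epsilon> V A \<rho>" "R_abs \<epsilon> V A \<rho> \<le> m"
proof -
  obtain r lam L R where D: "operator_schmidt V A \<rho> = (r, lam, L, R)" by (metis prod_cases4)
  have schmidt: "is_operator_schmidt V A \<rho> (r, lam, L, R)"
    using operator_schmidt_exists[OF V, of \<rho>] by (simp add: D)
  let ?P = "\<lambda>m. 1 \<le> m \<and> (hs_norm_on (Pow V) (\<lambda>S T. \<rho> S T - schmidt_truncation V A \<rho> m S T))\<^sup>2 \<le> \<epsilon>"
  have "?P m"
    using schmidt_truncation_error[OF V schmidt, of m] schmidt_tail_le[OF V schmidt \<sigma>(1)] d \<sigma>(2)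
    by (simp add: schmidt_truncation_def D)
  then show "1 \<le> R_abs \<epsilon> V A \<rho>" "R_abs \<epsilon> V A \<rho> \<le> m"
    unfolding R_abs_def using LeastI[of ?P m] Least_le[of ?P m] by blast+
qed

text \<open>Blocks of \<open>i\<close> steps at least halve the error. \<open>2 * t\<close> blocks,
  with \<open>t\<close> the rounded logarithm of \<open>n\<close>, gain two powers of
  \<open>n\<close>: one against the prefactor and one for the target. The \<open>j\<close> extra
  steps supply \<open>\<eta>\<close>.\<close>

lemma logarithmic_depth:
  fixes q \<eta> :: real
  assumes "0 \<le> q" "q < 1" "0 < \<eta>"
  obtains c where "0 \<le> c" "\<And>n. 2 \<le> n \<Longrightarrow> \<exists>l. real l \<le> c * log 2 (real n) \<and> real n * q ^ l \<le> \<eta> / real n"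
proof -
  obtain i where i: "q ^ i < 1 / 2" using real_arch_pow_inv[of "1 / 2" q] assms by auto
  obtain j where j: "q ^ j < \<eta>" using real_arch_pow_inv[of \<eta> q] assms by auto
  have "\<exists>l. real l \<le> real (4 * i + j) * log 2 (real n) \<and> real n * q ^ l \<le> \<eta> / real n" if n: "2 \<le> n" for n :: nat
  proof -
    define t where "t = nat \<lceil>log 2 (real n)\<rceil>"
    \<comment> \<open>This absorbs the rounding in \<open>t\<close> and the additive
      \<open>j\<close> into a multiple of the logarithm.\<close>
    have log1: "1 \<le> log 2 (real n)" using n by (simp add: le_log_iff)
    have t: "log 2 (real n) \<le> real t" "real t \<le> 2 * log 2 (real n)"
      using log1 unfolding t_def by linarith+
    have "real n \<le> 2 ^ t"
      using t(1) n by (simp add: log_le_iff powr_realpow)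
    then have n2: "(real n)\<^sup>2 \<le> (2 ^ t)\<^sup>2" by (intro power_mono) auto
    let ?l = "2 * i * t + j"
    have "q ^ ?l = (q ^ i) ^ (2 * t) * q ^ j" by (simp add: power_add power_mult[symmetric] mult_ac)
    also have "\<dots> \<le> (1 / 2) ^ (2 * t) * \<eta>"
      using i j assms by (intro mult_mono power_mono) auto
    also have "\<dots> = \<eta> / (2 ^ t)\<^sup>2" by (simp add: power_mult power_one_over power2_eq_square power_mult_distrib mult.commute[of 2 t])
    also have "\<dots> \<le> \<eta> / (real n)\<^sup>2" using n2 n assms by (intro divide_left_mono) auto
    finally have "real n * q ^ ?l \<le> real n * (\<eta> / (real n)\<^sup>2)" by (intro mult_left_mono) auto
    also have "\<dots> = \<eta> / real n" using n by (simp add: power2_eq_square)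
    finally have small: "real n * q ^ ?l \<le> \<eta> / real n" .
    have "real ?l = 2 * real i * real t + real j" by simp
    also have "\<dots> \<le> 2 * real i * (2 * log 2 (real n)) + real j * log 2 (real n)"
      using t(2) log1 by (intro add_mono mult_left_mono) (auto simp: mult_left_le mult_le_cancel_left1)
    also have "\<dots> = real (4 * i + j) * log 2 (real n)" by (simp add: algebra_simps)
    finally show ?thesis using small by blast
  qed
  then show ?thesis by (intro that[of "real (4 * i + j)"] of_nat_0_le_iff) blast
qed

section \<open>Entanglement and bond dimension of circuit outputs\<close>

context contracting_channel
begin

lemma circuit_setting_valid:
  assumes "circuit_setting Cb n \<Delta> E A lys"
  shows "\<forall>ly\<in>set lys. valid_layer n ly \<and> card {e\<in>fst ly. crosses A e} \<le> nat \<lfloor>Cb * real (boundary_size E A)\<rfloor>"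
proof (intro ballI conjI)
  fix ly assume "ly \<in> set lys"
  then have "local_layer E ly" "real (card {e\<in>fst ly. crosses A e}) \<le> Cb * real (boundary_size E A)"
    and "interaction_graph n \<Delta> E"
    using assms by (auto simp: circuit_setting_def)
  then show "valid_layer n ly" "card {e\<in>fst ly. crosses A e} \<le> nat \<lfloor>Cb * real (boundary_size E A)\<rfloor>"
    by (auto intro: valid_layerI simp: le_nat_floor)
qed

lemma output_approximation:
  assumes set: "circuit_setting Cb n \<Delta> E A lys" and Cb: "0 < Cb"
  obtains \<sigma> m where "cut_rank A m \<sigma>" "1 \<le> m" "log 2 (real m) \<le> 4 * Cb * real (boundary_size E A) * real l"
    "hs_norm_on (Pow {..<n}) (\<lambda>S T. output_state N n lys S T - \<sigma> S T) \<le> real n * (2 * s) ^ l"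
proof -
  let ?k = "nat \<lfloor>Cb * real (boundary_size E A)\<rfloor>"
  have n: "2 \<le> n" "A \<subseteq> {..<n}" using set by (auto simp: circuit_setting_def)
  note valid = circuit_setting_valid[OF set]
  obtain \<sigma> where \<sigma>: "cut_rank A (16 ^ (?k * l)) \<sigma>"
    "hs_norm_on (Pow {..<n}) (\<lambda>S T. fold (site_layer n) lys initial_state S T - \<sigma> S T) \<le> real n * (2 * s) ^ l"
    by (rule low_rank_approximation[OF n valid])
  have "hs_norm_on (Pow {..<n}) (\<lambda>S T. output_state N n lys S T - \<sigma> S T) =
      hs_norm_on (Pow {..<n}) (\<lambda>S T. fold (site_layer n) lys initial_state S T - \<sigma> S T)"
    using valid by (simp add: hs_norm_on_def output_state_eq)
  moreover have "log 2 (real (16 ^ (?k * l))) \<le> 4 * Cb * real (boundary_size E A) * real l"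
  proof -
    \<comment> \<open>Base 16 is \<open>2 ^ 4\<close>, the origin of the 4 in
      \<open>4 * Cb\<close>.\<close>
    have "(16::real) ^ (?k * l) = 2 ^ (4 * (?k * l))" by (simp add: power_mult)
    then have "log 2 (real (16 ^ (?k * l))) = 4 * (real ?k * real l)" by simp
    also have "\<dots> \<le> 4 * (Cb * real (boundary_size E A) * real l)"
      using Cb by (intro mult_left_mono mult_right_mono) (auto simp: of_nat_floor)
    finally show ?thesis by (simp add: mult_ac)
  qed
  ultimately show ?thesis using that[OF \<sigma>(1)] \<sigma>(2) by simp
qed

lemma density_output_state:
  assumes "\<forall>ly\<in>set lys. valid_layer n ly"
  shows "density n (output_state N n lys)"
proof -
  have "density n (fold (site_layer n) lys initial_state)"
    by (intro density_fold density_initial_state assms)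
  moreover have "psd_on (Pow {..<n}) (output_state N n lys) \<longleftrightarrow> psd_on (Pow {..<n}) (fold (site_layer n) lys initial_state)"
    by (intro psd_on_cong) (simp add: output_state_eq assms)
  moreover have "otrace (Pow {..<n}) (output_state N n lys) = otrace (Pow {..<n}) (fold (site_layer n) lys initial_state)"
    unfolding otrace_def by (intro sum.cong refl) (simp add: output_state_eq assms)
  ultimately show ?thesis by (simp add: density_def)
qed

lemma entanglement_bound:
  assumes Cb: "0 < Cb"
  shows "\<exists>C. \<forall>n \<Delta> E A lys. circuit_setting Cb n \<Delta> E A lys \<longrightarrow>
    operator_entanglement {..<n} A (output_state N n lys)
      \<le> C * (real (boundary_size E A) * log 2 (real n) + log 2 (real n))"
proof -
  obtain c where c: "0 \<le> c" "\<And>n. 2 \<le> n \<Longrightarrow> \<exists>l. real l \<le> c * log 2 (real n) \<and> real n * (2 * s) ^ l \<le> 1 / real n"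
    using logarithmic_depth[of "2 * s" 1] s by auto
  show ?thesis
  \<comment> \<open>\<open>4 * Cb * c\<close> comes from the rank. The 6 covers the constants, 4
    from the entropy bound and at most 1 from the tail, since the logarithm of \<open>n\<close> is
    at least 1.\<close>
  proof (intro exI[of _ "4 * Cb * c + 6"] allI impI)
    fix n \<Delta> E A lys
    assume set: "circuit_setting Cb n \<Delta> E A lys"
    let ?a = "real (boundary_size E A)"
    let ?\<rho> = "output_state N n lys"
    have n: "2 \<le> n" "A \<subseteq> {..<n}" using set by (auto simp: circuit_setting_def)
    obtain l where l: "real l \<le> c * log 2 (real n)" "real n * (2 * s) ^ l \<le> 1 / real n" using c(2)[OF n(1)] by blast
    obtain \<sigma> m where \<sigma>: "cut_rank A m \<sigma>" "1 \<le> m" "log 2 (real m) \<le> 4 * Cb * ?a * real l"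
      "hs_norm_on (Pow {..<n}) (\<lambda>S T. ?\<rho> S T - \<sigma> S T) \<le> real n * (2 * s) ^ l"
      by (rule output_approximation[OF set Cb])
    have d: "(hs_norm_on (Pow {..<n}) (\<lambda>S T. ?\<rho> S T - \<sigma> S T))\<^sup>2 \<le> (1 / real n)\<^sup>2"
      using \<sigma>(4) l(2) by (intro power_mono) (auto simp: hs_norm_on_def sum_nonneg)
    have "density n ?\<rho>" using circuit_setting_valid[OF set] by (intro density_output_state) auto
    then have "operator_entanglement {..<n} A ?\<rho> \<le> log 2 (real m) + 2 * (1 / real n)\<^sup>2 * real (card {..<n}) + 4"
      using n d \<sigma> by (intro operator_entanglement_le) (auto simp: density_def)
    also have "2 * (1 / real n)\<^sup>2 * real (card {..<n}) = 2 / real n" using n by (simp add: power2_eq_square)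
    also have "\<dots> \<le> 1" using n by simp
    finally have "operator_entanglement {..<n} A ?\<rho> \<le> 4 * Cb * ?a * real l + 5" using \<sigma>(3) by simp
    also have "\<dots> \<le> 4 * Cb * ?a * (c * log 2 (real n)) + 6 * log 2 (real n)"
    proof -
      have "1 \<le> log 2 (real n)" using n by (simp add: le_log_iff)
      moreover have "4 * Cb * ?a * real l \<le> 4 * Cb * ?a * (c * log 2 (real n))"
        using l(1) Cb by (intro mult_left_mono) auto
      ultimately show ?thesis by linarith
    qed
    also have "\<dots> \<le> (4 * Cb * c + 6) * (?a * log 2 (real n) + log 2 (real n))"
    proof -
      have "0 \<le> Cb * c * log 2 (real n)" "0 \<le> ?a * log 2 (real n)" using Cb c(1) n by simp_all
      then show ?thesis by (simp add: algebra_simps)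
    qed
    finally show "operator_entanglement {..<n} A ?\<rho> \<le> (4 * Cb * c + 6) * (?a * log 2 (real n) + log 2 (real n))" .
  qed
qed

text \<open>The exponent \<open>1 / a\<close> in the average cancels the factor \<open>a\<close> in
  the logarithm of the rank, so the boundary size disappears. Positivity is carried along so that
  the logarithm can be undone for the polynomial bound.\<close>

lemma bond_dimension_bound:
  assumes Cb: "0 < Cb" and eps: "0 < \<epsilon>"
  shows "\<exists>C. \<forall>n \<Delta> E A lys. circuit_setting Cb n \<Delta> E A lys \<longrightarrow>
    0 < avg_bond_dim \<epsilon> {..<n} E A (output_state N n lys) \<and>
    log 2 (avg_bond_dim \<epsilon> {..<n} E A (output_state N n lys)) \<le> C * log 2 (real n)"
proof -
  obtain c where c: "0 \<le> c" "\<And>n. 2 \<le> n \<Longrightarrow> \<exists>l. real l \<le> c * log 2 (real n) \<and> real n * (2 * s) ^ l \<le> sqrt \<epsilon> / real n"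
    using logarithmic_depth[of "2 * s" "sqrt \<epsilon>"] s eps by auto
  show ?thesis
  proof (intro exI[of _ "4 * Cb * c"] allI impI)
    fix n \<Delta> E A lys
    assume set: "circuit_setting Cb n \<Delta> E A lys"
    let ?a = "real (boundary_size E A)"
    let ?\<rho> = "output_state N n lys"
    let ?R = "real (R_abs \<epsilon> {..<n} A ?\<rho>)"
    have n: "2 \<le> n" "A \<subseteq> {..<n}" and a: "0 < ?a" using set by (auto simp: circuit_setting_def)
    obtain l where l: "real l \<le> c * log 2 (real n)" "real n * (2 * s) ^ l \<le> sqrt \<epsilon> / real n" using c(2)[OF n(1)] by blast
    obtain \<sigma> m where \<sigma>: "cut_rank A m \<sigma>" "1 \<le> m" "log 2 (real m) \<le> 4 * Cb * ?a * real l"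
      "hs_norm_on (Pow {..<n}) (\<lambda>S T. ?\<rho> S T - \<sigma> S T) \<le> real n * (2 * s) ^ l"
      by (rule output_approximation[OF set Cb])
    have "sqrt \<epsilon> / real n \<le> sqrt \<epsilon> / 1" using n eps by (intro divide_left_mono) auto
    then have "hs_norm_on (Pow {..<n}) (\<lambda>S T. ?\<rho> S T - \<sigma> S T) \<le> sqrt \<epsilon>" using \<sigma>(4) l(2) by linarith
    then have "(hs_norm_on (Pow {..<n}) (\<lambda>S T. ?\<rho> S T - \<sigma> S T))\<^sup>2 \<le> (sqrt \<epsilon>)\<^sup>2"
      by (intro power_mono) (auto simp: hs_norm_on_def sum_nonneg)
    then have d: "(hs_norm_on (Pow {..<n}) (\<lambda>S T. ?\<rho> S T - \<sigma> S T))\<^sup>2 \<le> \<epsilon>" using eps by simp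
    have R: "1 \<le> ?R" "?R \<le> real m"
      using R_abs_bounds[OF _ n(2) \<sigma>(1,2) d] by simp_all
    have "log 2 (avg_bond_dim \<epsilon> {..<n} E A ?\<rho>) = log 2 ?R / ?a"
      using R by (simp add: avg_bond_dim_def log_powr)
    also have "\<dots> \<le> (4 * Cb * ?a * real l) / ?a"
    proof (rule divide_right_mono)
      have "log 2 ?R \<le> log 2 (real m)" using R by simp
      then show "log 2 ?R \<le> 4 * Cb * ?a * real l" using \<sigma>(3) by linarith
    qed simp
    also have "\<dots> = 4 * Cb * real l" using a by simp
    also have "\<dots> \<le> 4 * Cb * (c * log 2 (real n))" using l(1) Cb by (intro mult_left_mono) auto
    finally have "log 2 (avg_bond_dim \<epsilon> {..<n} E A ?\<rho>) \<le> 4 * Cb * c * log 2 (real n)" by (simp add: mult_ac)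
    moreover have "0 < avg_bond_dim \<epsilon> {..<n} E A ?\<rho>" using R by (simp add: avg_bond_dim_def)
    ultimately show "0 < avg_bond_dim \<epsilon> {..<n} E A ?\<rho> \<and>
        log 2 (avg_bond_dim \<epsilon> {..<n} E A ?\<rho>) \<le> 4 * Cb * c * log 2 (real n)" by blast
  qed
qed

end

theorem theorem14:
  fixes N :: "qubit_matrix \<Rightarrow> qubit_matrix" and c Cb :: real
  assumes "quantum_channel N"
    and "\<exists>!\<omega>. fixed_point N \<omega>"
    and "has_contraction_coeff N c" and "c < 1 / 48"
    and "0 < Cb"
  shows
    "(\<exists>C::real. \<forall>n \<Delta> E A lys. circuit_setting Cb n \<Delta> E A lys \<longrightarrow>
        operator_entanglement {..<n} A (output_state N n lys)
          \<le> C * (real (boundary_size E A) * log 2 (real n) + log 2 (real n))) \<and>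
     (\<forall>\<epsilon>>0.
        (\<exists>C'::real. \<forall>n \<Delta> E A lys. circuit_setting Cb n \<Delta> E A lys \<longrightarrow>
           log 2 (avg_bond_dim \<epsilon> {..<n} E A (output_state N n lys)) \<le> C' * log 2 (real n)) \<and>
        (\<exists>p::real poly. \<forall>n \<Delta> E A lys. circuit_setting Cb n \<Delta> E A lys \<longrightarrow>
           avg_bond_dim \<epsilon> {..<n} E A (output_state N n lys) \<le> poly p (real n)))"
proof -
  obtain w W s where W: "\<forall>m<4. unitary (W m)" "(\<Sum>m<(4::nat). \<bar>w m\<bar>) \<le> s" "0 \<le> s" "s < 1 / 2"
    "\<forall>M. N M - N (dep M) = (\<Sum>m<(4::nat). w m *\<^sub>R (W m ** M ** adj (W m)))"
    using assms(1) by (auto simp: quantum_channel_def intro: channel_mixture[OF _ assms(3,4)])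
  interpret contracting_channel N w W s
    by unfold_locales (use assms(1) W in auto)
  show ?thesis
  proof (intro conjI allI impI)
    show "\<exists>C::real. \<forall>n \<Delta> E A lys. circuit_setting Cb n \<Delta> E A lys \<longrightarrow>
        operator_entanglement {..<n} A (output_state N n lys)
          \<le> C * (real (boundary_size E A) * log 2 (real n) + log 2 (real n))"
      by (rule entanglement_bound[OF assms(5)])
  next
    fix \<epsilon> :: real assume "0 < \<epsilon>"
    then obtain C where C: "\<And>n \<Delta> E A lys. circuit_setting Cb n \<Delta> E A lys \<Longrightarrow>
      0 < avg_bond_dim \<epsilon> {..<n} E A (output_state N n lys) \<and>
      log 2 (avg_bond_dim \<epsilon> {..<n} E A (output_state N n lys)) \<le> C * log 2 (real n)"
      using bond_dimension_bound[OF assms(5)] by blast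
    then show "\<exists>C'::real. \<forall>n \<Delta> E A lys. circuit_setting Cb n \<Delta> E A lys \<longrightarrow>
       log 2 (avg_bond_dim \<epsilon> {..<n} E A (output_state N n lys)) \<le> C' * log 2 (real n)"
      by blast
    show "\<exists>p::real poly. \<forall>n \<Delta> E A lys. circuit_setting Cb n \<Delta> E A lys \<longrightarrow>
       avg_bond_dim \<epsilon> {..<n} E A (output_state N n lys) \<le> poly p (real n)"
    \<comment> \<open>\<open>C\<close> may be negative or fractional; rounding it up to a natural
      number only enlarges the power of \<open>n\<close>, as \<open>n \<ge> 2\<close>.\<close>
    proof (intro exI[of _ "monom 1 (nat \<lceil>C\<rceil>)"] allI impI)
      fix n \<Delta> E A lys assume set: "circuit_setting Cb n \<Delta> E A lys"
      let ?x = "avg_bond_dim \<epsilon> {..<n} E A (output_state N n lys)"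
      have n: "2 \<le> n" using set by (simp add: circuit_setting_def)
      have "?x = 2 powr log 2 ?x" using C[OF set] by simp
      also have "\<dots> \<le> 2 powr (C * log 2 (real n))" using C[OF set] by (intro powr_mono) auto
      also have "\<dots> = real n powr C" using n by (simp add: powr_powr[symmetric] mult.commute[of C])
      also have "\<dots> \<le> real n powr real (nat \<lceil>C\<rceil>)" using n by (intro powr_mono) linarith+
      also have "\<dots> = poly (monom 1 (nat \<lceil>C\<rceil>)) (real n)" using n by (simp add: poly_monom powr_realpow)
      finally show "?x \<le> poly (monom 1 (nat \<lceil>C\<rceil>)) (real n)" .
    qed
  qed
qed

end
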